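(* Let $m\ge 0$, $1<p<\infty$, $\omega\in A_p(\mathbb{R}^n)$, let $\mathscr{T}$ be a mesh of $\Omega$ from the shape regular family $\mathbb{T}$ and let $z$ be an interior node of $\mathscr{T}$. If $v\in W^{m+1}_p(\omega,S_z)$, then $$\|v-Q^m_z v\|_{L^p(\omega,S_z)}\le C\,h_z^{m+1}\,|v|_{W^{m+1}_p(\omega,S_z)},$$ where the constant $C$ depends only on $C_{p,\omega}$, $\sigma$, $\psi$ and $m$ (and on the fixed $n$, $p$).
   Context: $\Omega\subset\mathbb{R}^n$, $n\ge1$, is open, bounded, connected, with polyhedral Lipschitz boundary. A weight is $\omega\in L^1_{\rm loc}(\mathbb{R}^n)$ with $\omega>0$ a.e. For $1<p<\infty$, $\omega\in A_p(\mathbb{R}^n)$ means $C_{p,\omega}=\sup_B\big(\frac1{|B|}\int_B\omega\big)\big(\frac1{|B|}\int_B\omega^{1/(1-p)}\big)^{p-1}<\infty$, the supremum being over all balls $B$. $\|u\|_{L^p(\omega,D)}=(\int_D|u|^p\omega)^{1/p}$; $W^k_p(\omega,D)$ is the set of $u\in L^p(\omega,D)$ with weak derivatives $D^\kappa u\in L^p(\omega,D)$ for $|\kappa|\le k$, and $|u|_{W^k_p(\omega,D)}=(\sum_{|\kappa|=k}\|D^\kappa u\|^p_{L^p(\omega,D)})^{1/p}$. Meshes: $\mathbb{T}$ is a family of conforming meshes $\mathscr{T}=\{T\}$ of $\Omega$ into (closed) simplices or $n$-rectangles, shape regular: $h_T/\rho_T\le\sigma$ for all $T\in\mathscr{T}\in\mathbb{T}$,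 with a fixed $\sigma>1$, $h_T=\mathrm{diam}\,T$, $\rho_T$ the diameter of the largest ball contained in $T$. Nodes are the Lagrange nodes of the degree $m$ elements (the vertices if $m\in\{0,1\}$); a node is interior if it does not lie on $\partial\Omega$. For a node $z$, $S_z=\bigcup_{T\ni z}T$ and $h_z=\min\{h_T: z\in T\}$. Averaged Taylor polynomial: $\psi\in C^\infty(\mathbb{R}^n)$ is fixed with $\int\psi=1$ and $\mathrm{supp}\,\psi$ contained in the ball of radius $r=r(\sigma)$ centered at $0$, and $\psi_z(x)=\frac{(m+1)^n}{h_z^n}\psi\big(\frac{(m+1)(z-x)}{h_z}\big)$, where $r$ is chosen so small that $\mathrm{supp}\,\psi_z\subset S_z$ for every interior node $z$ of every mesh of the family. With $P^m v(x,y)=\sum_{|\alpha|\le m}\frac1{\alpha!}D^\alpha v(x)(y-x)^\alpha$, set $Q^m_zv(y)=\int P^mv(x,y)\psi_z(x)\,dx$.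
   Formalization: For n = 1 only, it is additionally assumed that intersecting elements of a mesh satisfy h_T ≤ σ h_T'; in one dimension shape regularity is vacuous and the stated estimate fails without such a bound (e.g. elements [-ε,0], [0,1], v(x) = x). *)

theory Defs
  imports "HOL-Analysis.Analysis"
begin

subsection \<open>Smooth functions and multi-indices\<close>

definition supp :: "(real^'n \<Rightarrow> real) \<Rightarrow> (real^'n) set" where
  "supp f = closure {x. f x \<noteq> 0}"

definition partial_deriv :: "'n \<Rightarrow> (real^'n \<Rightarrow> real) \<Rightarrow> real^'n \<Rightarrow> real" where
  "partial_deriv i f x = frechet_derivative f (at x) (axis i 1)"

definition smooth :: "(real^'n \<Rightarrow> real) \<Rightarrow> bool" where
  "smooth f \<longleftrightarrow> (\<forall>is. foldr partial_deriv is f differentiable_on UNIV)"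

definition mi_order :: "('n::finite \<Rightarrow> nat) \<Rightarrow> nat" where
  "mi_order \<alpha> = (\<Sum>i\<in>UNIV. \<alpha> i)"

definition mi_fact :: "('n::finite \<Rightarrow> nat) \<Rightarrow> real" where
  "mi_fact \<alpha> = (\<Prod>i\<in>UNIV. fact (\<alpha> i))"

definition mi_power :: "real^'n \<Rightarrow> ('n \<Rightarrow> nat) \<Rightarrow> real" where
  "mi_power x \<alpha> = (\<Prod>i\<in>UNIV. (x $ i) ^ \<alpha> i)"

text \<open>
  The classical derivative of multi-index order \<open>\<alpha>\<close>: the directions are listed in an arbitrary
  order, direction \<open>i\<close> occurring \<open>\<alpha> i\<close> times. It is only applied to smooth functions, for which
  the order is immaterial.
\<close>
definition mi_deriv :: "('n \<Rightarrow> nat) \<Rightarrow> (real^'n \<Rightarrow> real) \<Rightarrow> real^'n \<Rightarrow> real" where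
  "mi_deriv \<alpha> f = foldr partial_deriv (SOME is. count_list is = \<alpha>) f"

subsection \<open>Muckenhoupt weights\<close>

definition weight :: "(real^'n \<Rightarrow> real) \<Rightarrow> bool" where
  "weight \<omega> \<longleftrightarrow> \<omega> \<in> borel_measurable lebesgue \<and>
     (\<forall>K. compact K \<longrightarrow> set_integrable lebesgue K \<omega>) \<and> (AE x in lebesgue. \<omega> x > 0)"

definition average :: "(real^'n) set \<Rightarrow> (real^'n \<Rightarrow> real) \<Rightarrow> real" where
  "average B f = (LINT x:B|lebesgue. f x) / measure lebesgue B"

definition Ap_quotients :: "real \<Rightarrow> (real^'n \<Rightarrow> real) \<Rightarrow> real set" where
  "Ap_quotients p \<omega> =
     {average (ball x s) \<omega> * average (ball x s) (\<lambda>y. \<omega> y powr (1 / (1 - p))) powr (p - 1) | x s. s > 0}"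

text \<open>
  Finiteness of the supremum over all balls comprises integrability of the dual weight on every
  ball. This has to be required separately, since the Bochner integral of a non-integrable
  function is \<open>0\<close> rather than \<open>\<infinity>\<close>.
\<close>
definition muckenhoupt :: "real \<Rightarrow> (real^'n \<Rightarrow> real) \<Rightarrow> bool" where
  "muckenhoupt p \<omega> \<longleftrightarrow> weight \<omega> \<and>
     (\<forall>x s. s > 0 \<longrightarrow> set_integrable lebesgue (ball x s) (\<lambda>y. \<omega> y powr (1 / (1 - p)))) \<and>
     bdd_above (Ap_quotients p \<omega>)"

definition Ap_const :: "real \<Rightarrow> (real^'n \<Rightarrow> real) \<Rightarrow> real" where
  "Ap_const p \<omega> = Sup (Ap_quotients p \<omega>)"

subsection \<open>Weighted Sobolev spaces\<close>

definition weighted_Lp :: "real \<Rightarrow> (real^'n \<Rightarrow> real) \<Rightarrow> (real^'n) set \<Rightarrow> (real^'n \<Rightarrow> real) set" where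
  "weighted_Lp p \<omega> D = {u. set_borel_measurable lebesgue D u \<and>
     set_integrable lebesgue D (\<lambda>x. \<bar>u x\<bar> powr p * \<omega> x)}"

definition weighted_Lp_norm :: "real \<Rightarrow> (real^'n \<Rightarrow> real) \<Rightarrow> (real^'n) set \<Rightarrow> (real^'n \<Rightarrow> real) \<Rightarrow> real" where
  "weighted_Lp_norm p \<omega> D u = (LINT x:D|lebesgue. \<bar>u x\<bar> powr p * \<omega> x) powr (1 / p)"

text \<open>
  The sets \<open>D\<close> of interest are stars of a mesh, which are closed with a Lebesgue-null boundary.
  Weak derivatives on \<open>D\<close> are those on the open set \<open>interior D\<close>.
\<close>
definition test_function :: "(real^'n) set \<Rightarrow> (real^'n \<Rightarrow> real) \<Rightarrow> bool" where
  "test_function D \<phi> \<longleftrightarrow> smooth \<phi> \<and> compact (supp \<phi>) \<and> supp \<phi> \<subseteq> interior D"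

definition locally_integrable :: "(real^'n) set \<Rightarrow> (real^'n \<Rightarrow> real) \<Rightarrow> bool" where
  "locally_integrable D u \<longleftrightarrow> (\<forall>K. compact K \<and> K \<subseteq> interior D \<longrightarrow> set_integrable lebesgue K u)"

definition has_weak_deriv ::
    "(real^'n) set \<Rightarrow> ('n \<Rightarrow> nat) \<Rightarrow> (real^'n \<Rightarrow> real) \<Rightarrow> (real^'n \<Rightarrow> real) \<Rightarrow> bool" where
  "has_weak_deriv D \<kappa> u g \<longleftrightarrow> locally_integrable D u \<and> locally_integrable D g \<and>
     (\<forall>\<phi>. test_function D \<phi> \<longrightarrow>
        (LINT x:D|lebesgue. u x * mi_deriv \<kappa> \<phi> x) =
        (-1) ^ mi_order \<kappa> * (LINT x:D|lebesgue. g x * \<phi> x))"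

definition weak_deriv ::
    "(real^'n) set \<Rightarrow> ('n \<Rightarrow> nat) \<Rightarrow> (real^'n \<Rightarrow> real) \<Rightarrow> real^'n \<Rightarrow> real" where
  "weak_deriv D \<kappa> u = (SOME g. has_weak_deriv D \<kappa> u g)"

definition weighted_sobolev ::
    "nat \<Rightarrow> real \<Rightarrow> (real^'n \<Rightarrow> real) \<Rightarrow> (real^'n) set \<Rightarrow> (real^'n \<Rightarrow> real) set" where
  "weighted_sobolev k p \<omega> D = {u \<in> weighted_Lp p \<omega> D.
     \<forall>\<kappa>. mi_order \<kappa> \<le> k \<longrightarrow> (\<exists>g \<in> weighted_Lp p \<omega> D. has_weak_deriv D \<kappa> u g)}"

definition sobolev_seminorm ::
    "nat \<Rightarrow> real \<Rightarrow> (real^'n \<Rightarrow> real) \<Rightarrow> (real^'n) set \<Rightarrow> (real^'n \<Rightarrow> real) \<Rightarrow> real" where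
  "sobolev_seminorm k p \<omega> D u =
     (\<Sum>\<kappa> | mi_order \<kappa> = k. weighted_Lp_norm p \<omega> D (weak_deriv D \<kappa> u) powr p) powr (1 / p)"

subsection \<open>Domains and meshes\<close>

text \<open>
  Near each boundary point the domain is the strict epigraph, in some direction \<open>e\<close>, of a Lipschitz
  function on the hyperplane orthogonal to \<open>e\<close>.
\<close>
definition lipschitz_boundary :: "(real^'n) set \<Rightarrow> bool" where
  "lipschitz_boundary \<Omega> \<longleftrightarrow> (\<forall>x \<in> frontier \<Omega>. \<exists>U e \<phi> L. open U \<and> x \<in> U \<and> norm e = 1 \<and>
     L-lipschitz_on {y. y \<bullet> e = 0} \<phi> \<and>
     \<Omega> \<inter> U = {y \<in> U. \<phi> (y - (y \<bullet> e) *\<^sub>R e) < y \<bullet> e})"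

definition polyhedral_boundary :: "(real^'n) set \<Rightarrow> bool" where
  "polyhedral_boundary \<Omega> \<longleftrightarrow> (\<exists>\<P>. finite \<P> \<and> (\<forall>P\<in>\<P>. polytope P) \<and> frontier \<Omega> = \<Union>\<P>)"

definition polyhedral_lipschitz_domain :: "(real^'n) set \<Rightarrow> bool" where
  "polyhedral_lipschitz_domain \<Omega> \<longleftrightarrow> open \<Omega> \<and> bounded \<Omega> \<and> connected \<Omega> \<and>
     polyhedral_boundary \<Omega> \<and> lipschitz_boundary \<Omega>"

definition is_simplex :: "(real^'n) set \<Rightarrow> bool" where
  "is_simplex T \<longleftrightarrow> int CARD('n) simplex T"

text \<open>An \<open>n\<close>-rectangle is a product of \<open>n\<close> nondegenerate compact intervals.\<close>
definition is_rectangle :: "(real^'n) set \<Rightarrow> bool" where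
  "is_rectangle T \<longleftrightarrow> (\<exists>a b. T = cbox a b \<and> box a b \<noteq> {})"

definition conforming_mesh :: "(real^'n) set \<Rightarrow> (real^'n) set set \<Rightarrow> bool" where
  "conforming_mesh \<Omega> \<T> \<longleftrightarrow> finite \<T> \<and> (\<forall>T\<in>\<T>. is_simplex T \<or> is_rectangle T) \<and>
     \<Union>\<T> = closure \<Omega> \<and>
     (\<forall>T\<in>\<T>. \<forall>T'\<in>\<T>. (T \<inter> T') face_of T \<and> (T \<inter> T') face_of T')"

definition inball_diameter :: "(real^'n) set \<Rightarrow> real" where
  "inball_diameter T = 2 * Sup {s. s \<ge> 0 \<and> (\<exists>c. cball c s \<subseteq> T)}"

definition shape_regular :: "real \<Rightarrow> (real^'n) set set \<Rightarrow> bool" where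
  "shape_regular \<sigma> \<T> \<longleftrightarrow> (\<forall>T\<in>\<T>. diameter T / inball_diameter T \<le> \<sigma>)"

definition simplex_nodes :: "nat \<Rightarrow> (real^'n) set \<Rightarrow> (real^'n) set" where
  "simplex_nodes k T = {z. \<exists>c :: real^'n \<Rightarrow> nat. (\<Sum>v | v extreme_point_of T. c v) = k \<and>
     z = (\<Sum>v | v extreme_point_of T. (real (c v) / real k) *\<^sub>R v)}"

definition rectangle_nodes :: "nat \<Rightarrow> (real^'n) set \<Rightarrow> (real^'n) set" where
  "rectangle_nodes k T = {z. \<exists>a b. \<exists>c :: 'n \<Rightarrow> nat. T = cbox a b \<and> box a b \<noteq> {} \<and>
     (\<forall>i. c i \<le> k \<and> z $ i = a $ i + real (c i) / real k * (b $ i - a $ i))}"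

text \<open>
  The Lagrange nodes of degree \<open>m\<close>; for \<open>m = 0\<close> these are the vertices, as for \<open>m = 1\<close>.
\<close>
definition lagrange_nodes :: "nat \<Rightarrow> (real^'n) set \<Rightarrow> (real^'n) set" where
  "lagrange_nodes m T =
     (if is_simplex T then simplex_nodes (max m 1) T else rectangle_nodes (max m 1) T)"

definition interior_nodes :: "nat \<Rightarrow> (real^'n) set \<Rightarrow> (real^'n) set set \<Rightarrow> (real^'n) set" where
  "interior_nodes m \<Omega> \<T> = (\<Union>T\<in>\<T>. lagrange_nodes m T) - frontier \<Omega>"

definition star :: "(real^'n) set set \<Rightarrow> real^'n \<Rightarrow> (real^'n) set" where
  "star \<T> z = \<Union>{T \<in> \<T>. z \<in> T}"

definition node_size :: "(real^'n) set set \<Rightarrow> real^'n \<Rightarrow> real" where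
  "node_size \<T> z = Min (diameter ` {T \<in> \<T>. z \<in> T})"

subsection \<open>The averaged Taylor polynomial\<close>

definition scaled_bump ::
    "nat \<Rightarrow> (real^'n \<Rightarrow> real) \<Rightarrow> real \<Rightarrow> real^'n \<Rightarrow> real^'n \<Rightarrow> real" where
  "scaled_bump m \<psi> h z x =
     real (m + 1) ^ CARD('n) / h ^ CARD('n) * \<psi> ((real (m + 1) / h) *\<^sub>R (z - x))"

definition taylor_poly ::
    "(real^'n) set \<Rightarrow> nat \<Rightarrow> (real^'n \<Rightarrow> real) \<Rightarrow> real^'n \<Rightarrow> real^'n \<Rightarrow> real" where
  "taylor_poly D m v x y =
     (\<Sum>\<alpha> | mi_order \<alpha> \<le> m. 1 / mi_fact \<alpha> * weak_deriv D \<alpha> v x * mi_power (y - x) \<alpha>)"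

definition averaged_taylor ::
    "nat \<Rightarrow> (real^'n \<Rightarrow> real) \<Rightarrow> (real^'n) set set \<Rightarrow> real^'n \<Rightarrow> (real^'n \<Rightarrow> real) \<Rightarrow> real^'n \<Rightarrow> real" where
  "averaged_taylor m \<psi> \<T> z v y =
     (LINT x|lebesgue. taylor_poly (star \<T> z) m v x y * scaled_bump m \<psi> (node_size \<T> z) z x)"

end

theory Submission
  imports Defs
begin

text \<open>
  Write \<open>T x v y\<close> for the value at \<open>y\<close> of the Taylor polynomial of degree \<open>m\<close> of \<open>v\<close> centred at \<open>x\<close>. As a function
  of the centre \<open>x\<close> its gradient contains derivatives of order \<open>m + 1\<close> only, and it equals \<open>v y\<close> at \<open>x = y\<close>.
  By shape regularity the star of an interior node \<open>z\<close> is star-shaped with respect to a ball \<open>B\<close> around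
  \<open>z\<close> of radius comparable to \<open>h\<close>. Moving the centre from \<open>y\<close> to \<open>w \<in> B\<close> and on to \<open>x\<close> along segments, and averaging
  over \<open>w\<close>, bounds \<open>v y - T x v y\<close> by \<open>h ^ (m + 1) * (F y + F x)\<close>, where \<open>F y\<close> averages the derivatives of order
  \<open>m + 1\<close> over the segments from \<open>y\<close> to \<open>B\<close>; for Sobolev functions this follows by mollification with \<open>\<psi>\<close> itself.
  At a fixed relative position on these segments the average runs over a ball near \<open>y\<close> whose radius is comparable to
  its distance from \<open>y\<close>, so Hoelder's inequality, Tonelli's theorem and the \<open>A\<^sub>p\<close> condition bound \<open>F\<close> in the weighted
  space without any maximal function.
\<close>

text \<open>The star need not be convex, so a segment between two of its points may leave it; hence
  the detour through \<open>w\<close>. The function \<open>scaled_bump\<close> cannot serve as the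
  weight of the average over \<open>w\<close>: its support is only known to lie in the star, not in
  the ball about the node. So the averages over \<open>w\<close> and over \<open>x\<close> are
  separate and a term \<open>F x\<close> remains; integrated over \<open>x\<close> it becomes a
  number, whose weighted norm costs a second use of the Muckenhoupt condition. The radius
  \<open>h / (2 * \<sigma> * max m 1)\<close> of the ball comes from barycentric coordinates: at a
  node those that do not vanish are at least \<open>1 / max m 1\<close>, and their gradients are at
  most \<open>2 * \<sigma> / h\<close>. The diameter of the star must be bounded by the size
  \<open>h\<close> of its smallest element. In dimension at least 2 its elements are linked by
  neighbours that share more than a point, and shape regularity compares those. In dimension 1
  neighbours share only a point and every interval is shape regular, so the theorem assumes the
  comparability.\<close>

subsection \<open>Elements as intersections of half-spaces\<close>

text \<open>These are the only properties of simplices and \<open>n\<close>-rectangles that are used; \<open>J\<close> lists the facets.\<close>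
definition cell :: "(real^'n) set \<Rightarrow> ((real^'n) \<times> real) set \<Rightarrow> bool" where
  "cell T J \<longleftrightarrow> finite J \<and> compact T \<and> interior T \<noteq> {} \<and> T = {x. \<forall>(a, c)\<in>J. 0 \<le> a \<bullet> x + c} \<and>
     (\<forall>x\<in>T. \<forall>(a, c)\<in>J. a \<bullet> x + c \<le> 1) \<and>
     (\<forall>v. v extreme_point_of T \<longrightarrow> (\<forall>(a, c)\<in>J. a \<bullet> v + c \<in> {0, 1})) \<and>
     (\<forall>v w. v extreme_point_of T \<longrightarrow> w extreme_point_of T \<longrightarrow> v \<noteq> w \<longrightarrow>
        (\<exists>(a, c)\<in>J. a \<bullet> v + c = 1 \<and> a \<bullet> w + c = 0))"

lemma cellD:
  assumes "cell T J"
  shows "finite J" "compact T" "interior T \<noteq> {}" "x \<in> T \<longleftrightarrow> (\<forall>(a, c)\<in>J. 0 \<le> a \<bullet> x + c)"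
    "x \<in> T \<Longrightarrow> (a, c) \<in> J \<Longrightarrow> a \<bullet> x + c \<le> 1"
    "v extreme_point_of T \<Longrightarrow> (a, c) \<in> J \<Longrightarrow> a \<bullet> v + c = 0 \<or> a \<bullet> v + c = 1"
    "v extreme_point_of T \<Longrightarrow> w extreme_point_of T \<Longrightarrow> v \<noteq> w \<Longrightarrow>
        \<exists>a c. (a, c)\<in>J \<and> a \<bullet> v + c = 1 \<and> a \<bullet> w + c = 0"
proof -
  have c: "finite J" "compact T" "interior T \<noteq> {}" "T = {x. \<forall>(a, c)\<in>J. 0 \<le> a \<bullet> x + c}"
    "\<forall>x\<in>T. \<forall>(a, c)\<in>J. a \<bullet> x + c \<le> 1"
    "\<forall>v. v extreme_point_of T \<longrightarrow> (\<forall>(a, c)\<in>J. a \<bullet> v + c \<in> {0, 1})"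
    "\<forall>v w. v extreme_point_of T \<longrightarrow> w extreme_point_of T \<longrightarrow> v \<noteq> w \<longrightarrow>
        (\<exists>(a, c)\<in>J. a \<bullet> v + c = 1 \<and> a \<bullet> w + c = 0)"
    using assms[unfolded cell_def] by - (elim conjE, assumption)+
  show "finite J" "compact T" "interior T \<noteq> {}" by (fact c)+
  show "x \<in> T \<longleftrightarrow> (\<forall>(a, c)\<in>J. 0 \<le> a \<bullet> x + c)" by (subst c(4)) simp
  show "x \<in> T \<Longrightarrow> (a, c) \<in> J \<Longrightarrow> a \<bullet> x + c \<le> 1" using c(5) by fast
  show "v extreme_point_of T \<Longrightarrow> (a, c) \<in> J \<Longrightarrow> a \<bullet> v + c = 0 \<or> a \<bullet> v + c = 1"
    using c(6) by fast
  show "v extreme_point_of T \<Longrightarrow> w extreme_point_of T \<Longrightarrow> v \<noteq> w \<Longrightarrow>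
        \<exists>a c. (a, c)\<in>J \<and> a \<bullet> v + c = 1 \<and> a \<bullet> w + c = 0"
    using c(7) by fast
qed

lemma cell_convex:
  assumes "cell T J" shows "convex T"
proof -
  have "T = (\<Inter>(a, c)\<in>J. {x. 0 \<le> a \<bullet> x + c})" using cellD(4)[OF assms] by auto
  moreover have "convex {x. 0 \<le> a \<bullet> x + c}" for a :: "real^'n" and c
  proof -
    have "{x. 0 \<le> a \<bullet> x + c} = {x. a \<bullet> x \<ge> - c}" by auto
    then show ?thesis by (simp only: convex_halfspace_ge)
  qed
  ultimately show ?thesis by (auto intro!: convex_INT)
qed

text \<open>The functions \<open>x \<mapsto> a \<bullet> x + c\<close> are the barycentric coordinates.\<close>
lemma simplex_cell:
  fixes T :: "(real^'n) set"
  assumes "is_simplex T" shows "\<exists>J. cell T J"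
proof -
  obtain C where ind: "\<not> affine_dependent C" and card: "int (card C) = int CARD('n) + 1" and T: "T = convex hull C"
    using assms unfolding is_simplex_def simplex_def by auto
  have fin: "finite C" using ind by (rule aff_independent_finite)
  have adim: "aff_dim C = int CARD('n)" using aff_dim_affine_independent[OF ind] card by simp
  then have full: "affine hull C = UNIV" using aff_dim_eq_full[of C] by simp
  \<comment> \<open>The facet opposite to \<open>v\<close> spans a hyperplane that misses
    \<open>v\<close>; its equation, divided by its value at \<open>v\<close>, is the barycentric
    coordinate of \<open>v\<close>.\<close>
  have "\<exists>a c. \<forall>w\<in>C. a \<bullet> w + c = (if w = v then 1 else 0)" if v: "v \<in> C" for v
  proof -
    have ind': "\<not> affine_dependent (C - {v})" using ind affine_dependent_subset by blast
    have "int (card (C - {v})) = int CARD('n)" using card fin v by simp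
    then have "aff_dim (C - {v}) = int (DIM(real^'n) - 1)"
      using aff_dim_affine_independent[OF ind'] by (simp add: of_nat_diff)
    then obtain a b where ab: "a \<noteq> 0" "affine hull (C - {v}) = {x. a \<bullet> x = b}"
      by (metis aff_dim_eq_hyperplane of_nat_diff DIM_positive Suc_leI One_nat_def of_nat_1)
    have "v \<notin> affine hull (C - {v})" using ind v by (auto simp: affine_dependent_def)
    then have ne: "a \<bullet> v \<noteq> b" using ab by simp
    have "a \<bullet> w = b" if "w \<in> C" "w \<noteq> v" for w
      using that hull_inc[of w "C - {v}" affine] ab by blast
    then have "\<forall>w\<in>C. ((1 / (a \<bullet> v - b)) *\<^sub>R a) \<bullet> w + (- b / (a \<bullet> v - b)) = (if w = v then 1 else 0)"
      using ne by (auto simp: divide_simps)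
    then show ?thesis by blast
  qed
  then obtain A c where Ac: "\<And>v w. v \<in> C \<Longrightarrow> w \<in> C \<Longrightarrow> A v \<bullet> w + c v = (if w = v then 1 else 0)" by metis
  have bary: "A v \<bullet> (\<Sum>w\<in>C. u w *\<^sub>R w) + c v = u v" if "v \<in> C" "sum u C = 1" for u v
  proof -
    have "A v \<bullet> (\<Sum>w\<in>C. u w *\<^sub>R w) + c v = (\<Sum>w\<in>C. u w * (A v \<bullet> w)) + (\<Sum>w\<in>C. u w) * c v"
      using that by (simp add: inner_sum_right)
    also have "\<dots> = (\<Sum>w\<in>C. u w * (A v \<bullet> w + c v))"
      by (simp add: sum.distrib distrib_left sum_distrib_right)
    also have "\<dots> = (\<Sum>w\<in>C. u w * (if w = v then 1 else 0))" using Ac that by (intro sum.cong) auto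
    also have "\<dots> = u v" using that fin by (simp add: sum.delta if_distrib cong: if_cong)
    finally show ?thesis .
  qed
  define J where "J = (\<lambda>v. (A v, c v)) ` C"
  have ext: "v \<in> C" if "v extreme_point_of T" for v
    using that T extreme_point_of_convex_hull by blast
  have hull: "x \<in> T \<longleftrightarrow> (\<forall>v\<in>C. 0 \<le> A v \<bullet> x + c v)" for x
  proof
    assume "x \<in> T"
    then obtain u where "\<forall>x\<in>C. 0 \<le> u x" "sum u C = 1" "(\<Sum>w\<in>C. u w *\<^sub>R w) = x"
      unfolding T convex_hull_finite[OF fin] by blast
    then show "\<forall>v\<in>C. 0 \<le> A v \<bullet> x + c v" using bary by auto
  next
    assume x: "\<forall>v\<in>C. 0 \<le> A v \<bullet> x + c v"
    \<comment> \<open>As \<open>C\<close> spans the whole space affinely, \<open>x\<close> is an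
      affine combination of \<open>C\<close>; the weights are the coordinates and hence
      nonnegative.\<close>
    have "x \<in> affine hull C" using full by simp
    then obtain u where u: "sum u C = 1" "(\<Sum>w\<in>C. u w *\<^sub>R w) = x"
      unfolding affine_hull_finite[OF fin] by blast
    then have "\<forall>w\<in>C. 0 \<le> u w" using bary x by fastforce
    then show "x \<in> T" unfolding T convex_hull_finite[OF fin] using u by blast
  qed
  have "cell T J"
    unfolding cell_def
  proof (intro conjI allI impI ballI)
    show "finite J" unfolding J_def using fin by simp
    show "compact T" unfolding T using fin by (simp add: finite_imp_compact_convex_hull)
    have "interior (convex hull C) \<noteq> {}"
      using rel_interior_eq_empty[of "convex hull C"] rel_interior_interior[of "convex hull C"] full card fin
      by (auto simp: affine_hull_convex_hull)
    then show "interior T \<noteq> {}" by (simp add: T)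
    show "T = {x. \<forall>(a, c)\<in>J. 0 \<le> a \<bullet> x + c}" using hull by (auto simp: J_def)
    fix x ac assume x: "x \<in> T" and "ac \<in> J"
    then obtain v where v: "v \<in> C" "ac = (A v, c v)" by (auto simp: J_def)
    obtain u where u: "\<forall>x\<in>C. 0 \<le> u x" "sum u C = 1" "(\<Sum>w\<in>C. u w *\<^sub>R w) = x"
      using x unfolding T convex_hull_finite[OF fin] by blast
    have "u v \<le> sum u C" using u v fin by (intro member_le_sum) auto
    then show "case ac of (a, c) \<Rightarrow> a \<bullet> x + c \<le> 1" using bary[OF v(1) u(2)] u v by simp
  next
    fix v ac assume "v extreme_point_of T" "ac \<in> J"
    then show "case ac of (a, c) \<Rightarrow> a \<bullet> v + c \<in> {0, 1}"
      using ext Ac by (auto simp: J_def)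
  next
    fix v w assume "v extreme_point_of T" "w extreme_point_of T" "v \<noteq> w"
    then show "\<exists>(a, c)\<in>J. a \<bullet> v + c = 1 \<and> a \<bullet> w + c = 0"
      using ext Ac by (intro bexI[of _ "(A v, c v)"]) (auto simp: J_def)
  qed
  then show ?thesis by blast
qed

text \<open>A point with a coordinate strictly between the ends is the midpoint of two shifts of
  itself along that axis.\<close>

lemma extreme_point_of_cbox:
  fixes a b v :: "real^'n"
  assumes v: "v extreme_point_of cbox a b"
  shows "v $ i = a $ i \<or> v $ i = b $ i"
proof (rule ccontr)
  assume n: "\<not> (v $ i = a $ i \<or> v $ i = b $ i)"
  have vb: "\<And>j. a $ j \<le> v $ j \<and> v $ j \<le> b $ j"
    using v by (auto simp: extreme_point_of_def mem_box_cart)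
  define e where "e = min (v $ i - a $ i) (b $ i - v $ i)"
  have e: "e > 0" "e \<le> v $ i - a $ i" "e \<le> b $ i - v $ i" using n vb[of i] by (auto simp: e_def)
  define x where "x = v - e *\<^sub>R axis i 1"
  define y where "y = v + e *\<^sub>R axis i 1"
  have "x \<in> cbox a b" "y \<in> cbox a b"
    using vb e by (auto simp: mem_box_cart x_def y_def axis_def algebra_simps)
  moreover have "v \<in> open_segment x y"
  proof -
    have "x $ i \<noteq> y $ i" using e by (simp add: x_def y_def)
    then have "x \<noteq> y" by auto
    moreover have "v = midpoint x y" by (simp add: midpoint_def x_def y_def flip: scaleR_add_right) 
    ultimately show ?thesis by (simp add: midpoint_in_open_segment)
  qed
  ultimately show False using v unfolding extreme_point_of_def by blast
qed

text \<open>\<open>L i\<close> and \<open>U i\<close> give the distances to the lower and the upper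
  face in direction \<open>i\<close>, divided by the edge length so that the values at corners are 0
  and 1.\<close>

lemma rectangle_cell:
  fixes T :: "(real^'n) set"
  assumes "is_rectangle T" shows "\<exists>J. cell T J"
proof -
  obtain a b where T: "T = cbox a b" and ne: "box a b \<noteq> {}" using assms by (auto simp: is_rectangle_def)
  have ab: "a $ i < b $ i" for i using ne by (force simp: box_ne_empty Basis_vec_def inner_axis)
  have ab_simps: "0 \<le> (x $ i - a $ i) / (b $ i - a $ i) \<longleftrightarrow> a $ i \<le> x $ i"
    "0 \<le> (b $ i - x $ i) / (b $ i - a $ i) \<longleftrightarrow> x $ i \<le> b $ i"
    "(x $ i - a $ i) / (b $ i - a $ i) \<le> 1 \<longleftrightarrow> x $ i \<le> b $ i"
    "(b $ i - x $ i) / (b $ i - a $ i) \<le> 1 \<longleftrightarrow> a $ i \<le> x $ i" for x i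
    using ab[of i] by (auto simp: zero_le_divide_iff)
  define L where "L i = (axis i (1 / (b $ i - a $ i)) :: real^'n, - a $ i / (b $ i - a $ i))" for i
  define U where "U i = (axis i (- 1 / (b $ i - a $ i)) :: real^'n, b $ i / (b $ i - a $ i))" for i
  define J where "J = range L \<union> range U"
  have L: "fst (L i) \<bullet> x + snd (L i) = (x $ i - a $ i) / (b $ i - a $ i)" for i x
    by (simp add: L_def inner_axis' diff_divide_distrib)
  have U: "fst (U i) \<bullet> x + snd (U i) = (b $ i - x $ i) / (b $ i - a $ i)" for i x
    by (simp add: U_def inner_axis' diff_divide_distrib)
  \<comment> \<open>The universal clauses of \<open>cell\<close> range over all of \<open>J\<close>;
    with such a clause as \<open>P\<close>, both families are checked at once.\<close>
  have J: "(\<forall>ac\<in>J. P (\<lambda>x. fst ac \<bullet> x + snd ac)) \<longleftrightarrow>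
    (\<forall>i. P (\<lambda>x. (x $ i - a $ i) / (b $ i - a $ i)) \<and> P (\<lambda>x. (b $ i - x $ i) / (b $ i - a $ i)))" for P
    unfolding J_def by (auto simp: ball_Un L U)
  have "cell T J"
    unfolding cell_def case_prod_unfold
  proof (intro conjI allI impI)
    show "finite J" by (simp add: J_def)
    show "compact T" by (simp add: T)
    show "interior T \<noteq> {}" using ne by (simp add: T interior_cbox)
    show "T = {x. \<forall>ac\<in>J. 0 \<le> fst ac \<bullet> x + snd ac}"
    proof -
      have "x \<in> T \<longleftrightarrow> (\<forall>ac\<in>J. 0 \<le> fst ac \<bullet> x + snd ac)" for x
        unfolding J[of "\<lambda>f. 0 \<le> f x"] ab_simps by (auto simp: T mem_box_cart)
      then show ?thesis by blast
    qed
    show "\<forall>x\<in>T. \<forall>ac\<in>J. fst ac \<bullet> x + snd ac \<le> 1"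
    proof
      fix x assume "x \<in> T"
      then show "\<forall>ac\<in>J. fst ac \<bullet> x + snd ac \<le> 1"
        unfolding J[of "\<lambda>f. f x \<le> 1"] ab_simps by (auto simp: T mem_box_cart)
    qed
  next
    fix v assume "v extreme_point_of T"
    then show "\<forall>ac\<in>J. fst ac \<bullet> v + snd ac \<in> {0, 1}"
      unfolding J[of "\<lambda>f. f v \<in> {0, 1}"]
    proof (intro allI)
      fix i
      have "v $ i = a $ i \<or> v $ i = b $ i"
        using \<open>v extreme_point_of T\<close> unfolding T by (rule extreme_point_of_cbox)
      then show "(v $ i - a $ i) / (b $ i - a $ i) \<in> {0, 1} \<and> (b $ i - v $ i) / (b $ i - a $ i) \<in> {0, 1}"
        using ab[of i] by auto
    qed
  next
    fix v w assume vw: "v extreme_point_of T" "w extreme_point_of T" "v \<noteq> w"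
    then obtain i where i: "v $ i \<noteq> w $ i" by (auto simp: vec_eq_iff)
    have "v $ i = a $ i \<and> w $ i = b $ i \<or> v $ i = b $ i \<and> w $ i = a $ i"
      using extreme_point_of_cbox vw(1,2) i unfolding T by metis
    then show "\<exists>ac\<in>J. fst ac \<bullet> v + snd ac = 1 \<and> fst ac \<bullet> w + snd ac = 0"
    proof
      assume "v $ i = a $ i \<and> w $ i = b $ i"
      then show ?thesis using ab[of i] by (intro bexI[of _ "U i"]) (auto simp: U J_def)
    next
      assume "v $ i = b $ i \<and> w $ i = a $ i"
      then show ?thesis using ab[of i] by (intro bexI[of _ "L i"]) (auto simp: L J_def)
    qed
  qed
  then show ?thesis by blast
qed

text \<open>Along the diameter of the ball in direction \<open>a\<close> the function grows by
  \<open>norm a * (2 * s)\<close>, but on \<open>T\<close> it stays between 0 and 1.\<close>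

lemma cell_gradient_bound:
  assumes T: "cell T J" and ac: "(a, c) \<in> J" and ball: "cball y s \<subseteq> T" "0 < s"
  shows "norm a * (2 * s) \<le> 1"
proof (cases "a = 0")
  case False
  define e where "e = (s / norm a) *\<^sub>R a"
  have e: "norm e = s" using False ball by (simp add: e_def)
  then have "y + e \<in> T" "y - e \<in> T" using ball by (auto simp: subset_eq dist_norm)
  then have "a \<bullet> (y + e) + c \<le> 1" "0 \<le> a \<bullet> (y - e) + c"
    using cellD(5)[OF T _ ac] cellD(4)[OF T] ac by auto
  then have "2 * (a \<bullet> e) \<le> 1" by (simp add: inner_add_right inner_diff_right)
  moreover have "a \<bullet> e = norm a * s" using False by (simp add: e_def dot_square_norm power2_eq_square)
  ultimately show ?thesis by simp
qed simp

text \<open>A radius above half the supremum in \<open>inball_diameter\<close> exists without an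
  argument that the supremum is attained; the half accounts for the 4 in place of a 2.\<close>

lemma inscribed_ball:
  fixes T :: "(real^'n) set"
  assumes T: "cell T J" and \<sigma>: "diameter T / inball_diameter T \<le> \<sigma>"
  obtains y s where "0 < s" "cball y s \<subseteq> T" "diameter T < 4 * \<sigma> * s" "2 * s \<le> diameter T"
proof -
  define R where "R = {s. 0 \<le> s \<and> (\<exists>c. cball c s \<subseteq> T)}"
  have bT: "bounded T" using cellD(2)[OF T] by (rule compact_imp_bounded)
  have le: "2 * s \<le> diameter T" if "cball y s \<subseteq> T" "0 \<le> s" for y :: "real^'n" and s
    using diameter_subset[OF that(1) bT] that(2) by simp
  have bdd: "bdd_above R" unfolding bdd_above_def R_def using le by (intro exI[of _ "diameter T / 2"]) force
  obtain x e where xe: "e > 0" "cball x e \<subseteq> T"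
    using cellD(3)[OF T] by (meson ex_in_conv mem_interior_cball)
  then have eR: "e \<in> R" by (auto simp: R_def)
  then have "e \<le> Sup R" using bdd by (rule cSup_upper)
  then have Sup: "Sup R > 0" using xe by simp
  then have "Sup R / 2 < Sup R" by simp
  then obtain s where s: "s \<in> R" "Sup R / 2 < s" using less_cSup_iff[OF _ bdd] eR by blast
  then obtain y where y: "cball y s \<subseteq> T" by (auto simp: R_def)
  have s0: "s > 0" using s Sup by simp
  have d0: "diameter T > 0" using le[OF y] s0 by simp
  have inb: "inball_diameter T = 2 * Sup R" by (simp add: inball_diameter_def R_def)
  have "diameter T \<le> \<sigma> * (2 * Sup R)" using \<sigma> Sup unfolding inb by (simp add: pos_divide_le_eq)
  moreover have "\<sigma> > 0"
    using \<sigma> d0 Sup unfolding inb by (metis divide_pos_pos less_le_trans mult_pos_pos zero_less_numeral)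
  moreover from this have "\<sigma> * (2 * Sup R) < \<sigma> * (4 * s)"
    using s(2) by (intro mult_strict_left_mono) auto
  ultimately have "diameter T < \<sigma> * (4 * s)" by linarith
  then have "diameter T < 4 * \<sigma> * s" by (simp only: mult.commute mult.left_commute)
  then show thesis using that s0 y le[OF y] by simp
qed

text \<open>The constant is \<open>1 / (2 * s)\<close> for the gradient times
  \<open>4 * \<sigma> * s\<close> for the diameter.\<close>

lemma cell_gradient_diameter_bound:
  assumes T: "cell T J" and ac: "(a, c) \<in> J" and \<sigma>: "diameter T / inball_diameter T \<le> \<sigma>"
  shows "0 < diameter T" "norm a * diameter T \<le> 2 * \<sigma>"
proof -
  obtain y s where s: "0 < s" "cball y s \<subseteq> T" "diameter T < 4 * \<sigma> * s" "2 * s \<le> diameter T"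
    using inscribed_ball[OF T \<sigma>] .
  show "0 < diameter T" using s by simp
  then have "4 * \<sigma> * s > 0" using s by linarith
  then have \<sigma>0: "\<sigma> > 0" using s(1) by (simp add: zero_less_mult_iff)
  have "norm a * diameter T \<le> norm a * (4 * \<sigma> * s)" using s by (intro mult_left_mono) auto
  also have "\<dots> = (norm a * (2 * s)) * (2 * \<sigma>)" by simp
  also have "\<dots> \<le> 1 * (2 * \<sigma>)" using \<sigma>0 cell_gradient_bound[OF T ac s(2,1)] by (intro mult_right_mono) auto
  finally show "norm a * diameter T \<le> 2 * \<sigma>" by simp
qed

text \<open>A common face that is not a point contains an edge of both elements, whose length is comparable to both diameters.\<close>
lemma adjacent_cells_comparable:
  fixes T T' :: "(real^'n) set"
  assumes T: "cell T J" and \<sigma>: "diameter T / inball_diameter T \<le> \<sigma>" and T': "compact T'"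
    and F: "(T \<inter> T') face_of T" and xy: "x \<in> T \<inter> T'" "y \<in> T \<inter> T'" "x \<noteq> y"
  shows "diameter T \<le> 2 * \<sigma> * diameter T'"
proof -
  let ?F = "T \<inter> T'"
  have cF: "compact ?F" "convex ?F" using cellD(2)[OF T] T' F face_of_imp_convex by (auto intro: compact_Int)
  \<comment> \<open>By Krein-Milman a common face with two points has two extreme points. They are
    vertices of \<open>T\<close>, so some coordinate of \<open>T\<close> rises by 1 between them,
    while their distance is at most \<open>diameter T'\<close>.\<close>
  have KM: "?F = convex hull {v. v extreme_point_of ?F}" using cF by (rule Krein_Milman_Minkowski)
  have "\<exists>v w. v extreme_point_of ?F \<and> w extreme_point_of ?F \<and> v \<noteq> w"
  proof (rule ccontr)
    assume "\<not> ?thesis"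
    then have "{v. v extreme_point_of ?F} = {} \<or> (\<exists>v. {v. v extreme_point_of ?F} = {v})" by blast
    then have "convex hull {v. v extreme_point_of ?F} = {} \<or> (\<exists>v. convex hull {v. v extreme_point_of ?F} = {v})" by auto
    then show False using KM xy by (metis empty_iff singletonD)
  qed
  then obtain v w where vw: "v extreme_point_of ?F" "w extreme_point_of ?F" "v \<noteq> w" by blast
  then have "v extreme_point_of T" "w extreme_point_of T" using extreme_point_of_face[OF F] by auto
  then obtain a c where ac: "(a, c) \<in> J" "a \<bullet> v + c = 1" "a \<bullet> w + c = 0" using cellD(7)[OF T] vw(3) by blast
  have "v \<in> T'" "w \<in> T'" using vw by (auto simp: extreme_point_of_def)
  then have dvw: "norm (v - w) \<le> diameter T'"
    using diameter_bounded_bound[OF compact_imp_bounded[OF T']] by (simp add: dist_norm)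
  note g = cell_gradient_diameter_bound[OF T ac(1) \<sigma>]
  have "1 = a \<bullet> (v - w)" using ac by (simp add: inner_diff_right)
  also have "\<dots> \<le> norm a * norm (v - w)" by (rule norm_cauchy_schwarz)
  also have "\<dots> \<le> norm a * diameter T'" using dvw by (intro mult_left_mono) auto
  finally have "diameter T * 1 \<le> diameter T * (norm a * diameter T')" using g(1) by (intro mult_left_mono) auto
  also have "\<dots> = (norm a * diameter T) * diameter T'" by simp
  also have "\<dots> \<le> 2 * \<sigma> * diameter T'" using g(2) order_trans[OF norm_ge_zero dvw] by (intro mult_right_mono)
  finally show ?thesis by simp
qed

text \<open>The combination lies on an open segment from \<open>v i\<close> to the normalized
  combination \<open>y\<close> of the other points, so a face through it contains
  \<open>v i\<close>. In the cases \<open>u i = 1\<close> and \<open>v i = y\<close>, where there is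
  no such segment, it equals \<open>v i\<close>.\<close>

lemma convex_combination_in_face:
  fixes v :: "'i \<Rightarrow> 'a::euclidean_space"
  assumes F: "F face_of T" and T: "convex T" and I: "finite I" "\<And>i. i \<in> I \<Longrightarrow> v i \<in> T" "\<And>i. i \<in> I \<Longrightarrow> 0 \<le> u i" "sum u I = 1"
    and z: "(\<Sum>i\<in>I. u i *\<^sub>R v i) \<in> F" and i: "i \<in> I" "0 < u i"
  shows "v i \<in> F"
proof -
  let ?z = "\<Sum>i\<in>I. u i *\<^sub>R v i"
  have split: "?z = u i *\<^sub>R v i + (\<Sum>j\<in>I - {i}. u j *\<^sub>R v j)" using I(1) i(1) by (rule sum.remove)
  have su: "sum u (I - {i}) = 1 - u i" using sum.remove[OF I(1) i(1), of u] I(4) by simp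
  have "sum u (I - {i}) \<ge> 0" using I(3) by (intro sum_nonneg) auto
  then have "u i \<le> 1" using su by simp
  show ?thesis
  proof (cases "u i = 1")
    case True
    then have "sum u (I - {i}) = 0" using su by simp
    then have "\<forall>j\<in>I - {i}. u j = 0" using I(1,3) by (subst sum_nonneg_eq_0_iff[symmetric]) auto
    then have "?z = v i" unfolding split using True by simp
    then show ?thesis using z by simp
  next
    case False
    then have ui: "u i < 1" using \<open>u i \<le> 1\<close> by simp
    define y where "y = (\<Sum>j\<in>I - {i}. (u j / (1 - u i)) *\<^sub>R v j)"
    have y: "y \<in> T" unfolding y_def using I ui su
      by (intro convex_sum[OF _ T]) (auto simp flip: sum_divide_distrib)
    have zy: "?z = u i *\<^sub>R v i + (1 - u i) *\<^sub>R y"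
      unfolding split y_def scaleR_sum_right using ui by simp
    show ?thesis
    proof (cases "v i = y")
      case True
      then have "?z = v i" using zy by (simp flip: scaleR_add_left)
      then show ?thesis using z by simp
    next
      case False
      have "?z \<in> open_segment (v i) y"
        unfolding in_segment using False ui i zy by (intro conjI exI[of _ "1 - u i"]) auto
      then show ?thesis using F z I(2)[OF i(1)] y unfolding face_of_def by blast
    qed
  qed
qed

text \<open>Only vertices in \<open>F\<close> carry weight, and there the function is 0 or 1; its
  value at \<open>z\<close> is thus a sum of weights. As it is constrained on \<open>F\<close> only,
  it may be a coordinate of another element that shares with \<open>T\<close> just the face
  \<open>F\<close>.\<close>

lemma convex_combination_vertex_gap:
  fixes v :: "'i \<Rightarrow> real^'n"
  assumes F: "F face_of T" and T: "convex T" and I: "finite I" "\<And>i. i \<in> I \<Longrightarrow> v i extreme_point_of T"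
      "\<And>i. i \<in> I \<Longrightarrow> u i = 0 \<or> \<kappa> \<le> u i" "sum u I = 1" and \<kappa>: "0 < \<kappa>"
    and z: "z = (\<Sum>i\<in>I. u i *\<^sub>R v i)" "z \<in> F" and val: "\<And>v. v extreme_point_of F \<Longrightarrow> a \<bullet> v + c = 0 \<or> a \<bullet> v + c = 1"
  shows "a \<bullet> z + c = 0 \<or> \<kappa> \<le> a \<bullet> z + c"
proof -
  have u0: "0 \<le> u i" if "i \<in> I" for i using I(3)[OF that] \<kappa> by auto
  have vT: "v i \<in> T" if "i \<in> I" for i using I(2)[OF that] by (simp add: extreme_point_of_def)
  have val': "a \<bullet> v i + c = 0 \<or> a \<bullet> v i + c = 1" if "i \<in> I" "u i \<noteq> 0" for i
  proof -
    have "v i \<in> F"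
      by (rule convex_combination_in_face[OF F T I(1) vT u0 I(4)]) (use z that u0[OF that(1)] in auto)
    then show ?thesis using val extreme_point_of_face[OF F] I(2)[OF that(1)] by blast
  qed
  have eq: "a \<bullet> z + c = (\<Sum>i\<in>I. u i * (a \<bullet> v i + c))"
  proof -
    have "a \<bullet> z + c = (\<Sum>i\<in>I. u i * (a \<bullet> v i)) + (\<Sum>i\<in>I. u i) * c"
      using I(4) by (simp add: z inner_sum_right)
    then show ?thesis by (simp add: sum.distrib distrib_left sum_distrib_right)
  qed
  have nonneg: "0 \<le> u i * (a \<bullet> v i + c)" if "i \<in> I" for i
    using val'[OF that] u0[OF that] by (cases "u i = 0") auto
  show ?thesis
  proof (cases "\<exists>i\<in>I. u i \<noteq> 0 \<and> a \<bullet> v i + c = 1")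
    case True
    then obtain i where i: "i \<in> I" "u i \<noteq> 0" "a \<bullet> v i + c = 1" by blast
    have "\<kappa> \<le> u i * (a \<bullet> v i + c)" using I(3)[OF i(1)] i by auto
    also have "\<dots> \<le> a \<bullet> z + c" unfolding eq by (rule member_le_sum[OF i(1)]) (use nonneg I(1) in auto)
    finally show ?thesis by simp
  next
    case False
    then have "a \<bullet> z + c = 0" unfolding eq using val' by (intro sum.neutral) force
    then show ?thesis by simp
  qed
qed

subsection \<open>Nodes and the gauge of a star\<close>

text \<open>In each coordinate, an end of an interval is a proper average of two points of the
  interval only if both are that end.\<close>

lemma extreme_point_of_cbox_corner:
  fixes a b v :: "real^'n"
  assumes ab: "\<And>i. a $ i < b $ i" and v: "\<And>i. v $ i = a $ i \<or> v $ i = b $ i"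
  shows "v extreme_point_of cbox a b"
  unfolding extreme_point_of_def
proof (intro conjI ballI notI)
  show "v \<in> cbox a b" unfolding mem_box_cart using v ab by (metis less_imp_le order_refl)
  fix x y assume x: "x \<in> cbox a b" and y: "y \<in> cbox a b" and "v \<in> open_segment x y"
  then obtain u where u: "x \<noteq> y" "0 < u" "u < 1" "v = (1 - u) *\<^sub>R x + u *\<^sub>R y"
    by (auto simp: in_segment)
  have "x $ i = y $ i" for i
  proof -
    have vi: "v $ i = (1 - u) * x $ i + u * y $ i" using u by simp
    have bd: "a $ i \<le> x $ i" "x $ i \<le> b $ i" "a $ i \<le> y $ i" "y $ i \<le> b $ i"
      using x y by (auto simp: mem_box_cart)
    from v[of i] show ?thesis
    proof
      assume va: "v $ i = a $ i"
      have "(1 - u) * (x $ i - a $ i) + u * (y $ i - a $ i) = 0" using vi va by (simp add: algebra_simps)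
      then have "(1 - u) * (x $ i - a $ i) = 0 \<and> u * (y $ i - a $ i) = 0"
        using bd u by (subst (asm) add_nonneg_eq_0_iff) auto
      then show ?thesis using u by simp
    next
      assume vb: "v $ i = b $ i"
      have "(1 - u) * (b $ i - x $ i) + u * (b $ i - y $ i) = 0" using vi vb by (simp add: algebra_simps)
      then have "(1 - u) * (b $ i - x $ i) = 0 \<and> u * (b $ i - y $ i) = 0"
        using bd u by (subst (asm) add_nonneg_eq_0_iff) auto
      then show ?thesis using u by simp
    qed
  qed
  then show False using u(1) by (simp add: vec_eq_iff)
qed

text \<open>A Lagrange node is an average of \<open>k = max m 1\<close> vertices, repetitions allowed.\<close>
lemma lagrange_node_gap:
  fixes T :: "(real^'n) set"
  assumes T: "is_simplex T \<or> is_rectangle T" and z: "z \<in> lagrange_nodes m T"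
  shows "z \<in> T"
    and "\<And>F a c. F face_of T \<Longrightarrow> z \<in> F \<Longrightarrow> (\<And>v. v extreme_point_of F \<Longrightarrow> a \<bullet> v + c = 0 \<or> a \<bullet> v + c = 1) \<Longrightarrow>
       a \<bullet> z + c = 0 \<or> 1 / real (max m 1) \<le> a \<bullet> z + c"
proof -
  define k where "k = max m 1"
  have k: "k \<ge> 1" by (simp add: k_def)
  obtain J where "cell T J" using T simplex_cell rectangle_cell by blast
  then have conv: "convex T" by (rule cell_convex)
  have "z \<in> T \<and> (\<forall>F a c. F face_of T \<longrightarrow> z \<in> F \<longrightarrow> (\<forall>v. v extreme_point_of F \<longrightarrow> a \<bullet> v + c = 0 \<or> a \<bullet> v + c = 1) \<longrightarrow>
       a \<bullet> z + c = 0 \<or> 1 / real k \<le> a \<bullet> z + c)"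
  proof (cases "is_simplex T")
    case True
    then obtain c where c: "(\<Sum>v | v extreme_point_of T. c v) = k" and
      zc: "z = (\<Sum>v | v extreme_point_of T. (real (c v) / real k) *\<^sub>R v)"
      using z by (auto simp: lagrange_nodes_def simplex_nodes_def k_def)
    define I where "I = {v. v extreme_point_of T}"
    \<comment> \<open>A sum over an infinite set is 0 by default, whereas this one is
      \<open>k \<ge> 1\<close>.\<close>
    have fin: "finite I"
    proof (rule ccontr)
      assume "\<not> finite I"
      then have "sum c I = 0" by simp
      then show False using c k by (simp add: I_def)
    qed
    have sum1: "(\<Sum>v\<in>I. real (c v) / real k) = 1"
      using c k unfolding sum_divide_distrib[symmetric] of_nat_sum[symmetric] I_def by simp
    have ext: "v extreme_point_of T" if "v \<in> I" for v using that by (simp add: I_def)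
    have vT: "v \<in> T" if "v \<in> I" for v using ext[OF that] by (simp add: extreme_point_of_def)
    have gap: "real (c v) / real k = 0 \<or> 1 / real k \<le> real (c v) / real k" for v
      using k by (cases "c v = 0") (auto intro!: divide_right_mono)
    have zI: "z = (\<Sum>v\<in>I. (real (c v) / real k) *\<^sub>R v)" using zc by (simp add: I_def)
    have "z \<in> T" unfolding zI by (intro convex_sum[OF fin conv]) (use sum1 vT in auto)
    moreover have "a \<bullet> z + b = 0 \<or> 1 / real k \<le> a \<bullet> z + b"
      if "F face_of T" "z \<in> F" "\<And>v. v extreme_point_of F \<Longrightarrow> a \<bullet> v + b = 0 \<or> a \<bullet> v + b = 1" for F a b
      by (rule convex_combination_vertex_gap[OF that(1) conv fin ext gap sum1 _ zI that(2,3)]) (use k in auto)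
    ultimately show ?thesis by blast
  next
    case False
    then obtain a b c where T: "T = cbox a b" and ne: "box a b \<noteq> {}"
      and c: "\<And>i. c i \<le> k" and zc: "\<And>i. z $ i = a $ i + real (c i) / real k * (b $ i - a $ i)"
      using z by (auto simp: lagrange_nodes_def rectangle_nodes_def k_def)
    have ab: "a $ i < b $ i" for i using ne by (force simp: box_ne_empty Basis_vec_def inner_axis)
    \<comment> \<open>Corner \<open>l\<close> has the upper end in coordinate \<open>i\<close> iff
      \<open>l \<le> c i\<close>, so exactly \<open>c i\<close> of the \<open>k\<close> corners do,
      and the mean of the corners is the node.\<close>
    define v where "v l = (\<chi> i. if l \<le> c i then b $ i else a $ i)" for l
    have ext: "v l extreme_point_of T" for l
      unfolding T by (rule extreme_point_of_cbox_corner[OF ab]) (simp add: v_def)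
    have vT: "v l \<in> T" for l using ext[of l] by (simp add: extreme_point_of_def)
    have sum1: "(\<Sum>l\<in>{1..k}. 1 / real k) = 1" using k by simp
    have zI: "z = (\<Sum>l\<in>{1..k}. (1 / real k) *\<^sub>R v l)"
    proof -
      have "z $ i = (\<Sum>l\<in>{1..k}. (1 / real k) *\<^sub>R v l) $ i" for i
      proof -
        have "(\<Sum>l\<in>{1..k}. v l $ i) = (\<Sum>l\<in>{1..k}. if l \<le> c i then b $ i else a $ i)" by (simp add: v_def)
        also have "\<dots> = (\<Sum>l\<in>{1..k} \<inter> {l. l \<le> c i}. b $ i) + (\<Sum>l\<in>{1..k} \<inter> - {l. l \<le> c i}. a $ i)"
          by (rule sum.If_cases) simp
        also have "{1..k} \<inter> {l. l \<le> c i} = {1..c i}" using c[of i] by auto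
        also have "{1..k} \<inter> - {l. l \<le> c i} = {c i + 1..k}" by auto
        also have "(\<Sum>l\<in>{1..c i}. b $ i) + (\<Sum>l\<in>{c i + 1..k}. a $ i) = real (c i) * b $ i + (real k - real (c i)) * a $ i"
          using c[of i] by (simp add: of_nat_diff)
        finally have "(\<Sum>l\<in>{1..k}. v l $ i) = real (c i) * b $ i + (real k - real (c i)) * a $ i" .
        then show ?thesis using k by (simp add: zc sum_divide_distrib[symmetric] field_simps)
      qed
      then show ?thesis by (simp add: vec_eq_iff)
    qed
    have "z \<in> T" unfolding zI by (intro convex_sum[OF _ conv]) (use sum1 vT in auto)
    moreover have "a' \<bullet> z + b' = 0 \<or> 1 / real k \<le> a' \<bullet> z + b'"
      if "F face_of T" "z \<in> F" "\<And>v. v extreme_point_of F \<Longrightarrow> a' \<bullet> v + b' = 0 \<or> a' \<bullet> v + b' = 1" for F a' b'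
      by (rule convex_combination_vertex_gap[OF that(1) conv _ ext _ sum1 _ zI that(2,3)]) (use k in auto)
    ultimately show ?thesis by blast
  qed
  then show "z \<in> T"
    and "\<And>F a c. F face_of T \<Longrightarrow> z \<in> F \<Longrightarrow> (\<And>v. v extreme_point_of F \<Longrightarrow> a \<bullet> v + c = 0 \<or> a \<bullet> v + c = 1) \<Longrightarrow>
       a \<bullet> z + c = 0 \<or> 1 / real (max m 1) \<le> a \<bullet> z + c"
    unfolding k_def by blast+
qed

text \<open>On the tangent cone this is the Minkowski functional of the element seen from
  \<open>z\<close>. Facets through \<open>z\<close> restrict only the direction of a step, not its
  length, and are left to \<open>tangent_cone\<close>. The inserted 0 keeps the set nonempty and the
  maximum nonnegative.\<close>

definition cell_gauge :: "((real^'n) \<times> real) set \<Rightarrow> real^'n \<Rightarrow> real^'n \<Rightarrow> real" where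
  "cell_gauge J z u = Max (insert 0 ((\<lambda>(a, c). - (a \<bullet> u) / (a \<bullet> z + c)) ` {(a, c)\<in>J. 0 < a \<bullet> z + c}))"

definition tangent_cone :: "((real^'n) \<times> real) set \<Rightarrow> real^'n \<Rightarrow> (real^'n) set" where
  "tangent_cone J z = {u. \<forall>(a, c)\<in>J. a \<bullet> z + c = 0 \<longrightarrow> 0 \<le> a \<bullet> u}"

lemma cell_gauge_le_iff:
  assumes "finite J"
  shows "cell_gauge J z u \<le> r \<longleftrightarrow> 0 \<le> r \<and> (\<forall>(a, c)\<in>J. 0 < a \<bullet> z + c \<longrightarrow> - (a \<bullet> u) \<le> r * (a \<bullet> z + c))"
proof -
  have "finite {(a, c)\<in>J. 0 < a \<bullet> z + c}" by (rule finite_subset[OF _ assms]) auto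
  then have "cell_gauge J z u \<le> r \<longleftrightarrow> 0 \<le> r \<and> (\<forall>(a, c)\<in>J. 0 < a \<bullet> z + c \<longrightarrow> - (a \<bullet> u) / (a \<bullet> z + c) \<le> r)"
    unfolding cell_gauge_def by (subst Max_le_iff) auto
  moreover have "- (a \<bullet> u) / (a \<bullet> z + c) \<le> r \<longleftrightarrow> - (a \<bullet> u) \<le> r * (a \<bullet> z + c)" if "0 < a \<bullet> z + c" for a c
    using that by (rule pos_divide_le_eq)
  ultimately show ?thesis by fast
qed

lemma cell_gauge_nonneg: "finite J \<Longrightarrow> 0 \<le> cell_gauge J z u"
  using cell_gauge_le_iff[of J z u "cell_gauge J z u"] by simp

lemma mem_cell_iff_gauge:
  assumes T: "cell T J" and z: "z \<in> T"
  shows "0 < t \<Longrightarrow> z + t *\<^sub>R u \<in> T \<Longrightarrow> u \<in> tangent_cone J z"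
    and "0 < t \<Longrightarrow> u \<in> tangent_cone J z \<Longrightarrow> z + t *\<^sub>R u \<in> T \<longleftrightarrow> t * cell_gauge J z u \<le> 1"
proof -
  note fin = cellD(1)[OF T] and mem = cellD(4)[OF T]
  have z0: "0 \<le> a \<bullet> z + c" if "(a, c) \<in> J" for a c using mem[of z] z that by auto
  show "u \<in> tangent_cone J z" if t: "0 < t" and u: "z + t *\<^sub>R u \<in> T"
  proof -
    have "0 \<le> a \<bullet> u" if "(a, c) \<in> J" "a \<bullet> z + c = 0" for a c
    proof -
      have "0 \<le> a \<bullet> (z + t *\<^sub>R u) + c" using mem[of "z + t *\<^sub>R u"] u that(1) by auto
      also have "\<dots> = t * (a \<bullet> u)" using that(2) by (simp add: inner_add_right)
      finally show ?thesis using t by (simp add: zero_le_mult_iff)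
    qed
    then show ?thesis by (auto simp: tangent_cone_def)
  qed
  show "z + t *\<^sub>R u \<in> T \<longleftrightarrow> t * cell_gauge J z u \<le> 1" if t: "0 < t" and u: "u \<in> tangent_cone J z"
  proof -
    have "z + t *\<^sub>R u \<in> T \<longleftrightarrow> (\<forall>(a, c)\<in>J. 0 < a \<bullet> z + c \<longrightarrow> - (a \<bullet> u) \<le> (1 / t) * (a \<bullet> z + c))"
    proof -
      have "(0 \<le> a \<bullet> (z + t *\<^sub>R u) + c) = (0 < a \<bullet> z + c \<longrightarrow> - (a \<bullet> u) \<le> (1 / t) * (a \<bullet> z + c))"
        if ac: "(a, c) \<in> J" for a c
      proof (cases "a \<bullet> z + c = 0")
        case True
        then have "0 \<le> a \<bullet> u" using u ac by (auto simp: tangent_cone_def)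
        then have "0 \<le> t * (a \<bullet> u)" using t by simp
        moreover have "a \<bullet> (z + t *\<^sub>R u) + c = t * (a \<bullet> u)" using True by (simp add: inner_add_right)
        ultimately show ?thesis using True by simp
      next
        case False
        then have pos: "0 < a \<bullet> z + c" using z0[OF ac] by simp
        have "a \<bullet> (z + t *\<^sub>R u) + c = (a \<bullet> z + c) + t * (a \<bullet> u)" by (simp add: inner_add_right)
        moreover have "(- (a \<bullet> u) \<le> (1 / t) * (a \<bullet> z + c)) = (0 \<le> (a \<bullet> z + c) + t * (a \<bullet> u))"
          using t by (auto simp: field_simps)
        ultimately show ?thesis using pos by (simp add: add_ac)
      qed
      then show ?thesis unfolding mem by auto
    qed
    also have "\<dots> \<longleftrightarrow> cell_gauge J z u \<le> 1 / t" unfolding cell_gauge_le_iff[OF fin] using t by simp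
    also have "\<dots> \<longleftrightarrow> t * cell_gauge J z u \<le> 1" using t by (simp add: field_simps)
    finally show ?thesis .
  qed
qed

text \<open>Each quotient in the maximum is linear in \<open>u\<close>, with a gradient of norm at
  most \<open>g / \<kappa>\<close>.\<close>

lemma cell_gauge_lipschitz:
  assumes J: "finite J" and \<kappa>: "0 < \<kappa>" "\<And>a c. (a, c) \<in> J \<Longrightarrow> a \<bullet> z + c = 0 \<or> \<kappa> \<le> a \<bullet> z + c"
    and g: "\<And>a c. (a, c) \<in> J \<Longrightarrow> norm a \<le> g" "0 \<le> g"
  shows "cell_gauge J z u \<le> cell_gauge J z u' + g / \<kappa> * norm (u - u')"
  unfolding cell_gauge_le_iff[OF J]
proof (intro conjI ballI)
  show "0 \<le> cell_gauge J z u' + g / \<kappa> * norm (u - u')"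
    using cell_gauge_nonneg[OF J] g \<kappa> by simp
  fix ac assume "ac \<in> J"
  then obtain a c where ac: "(a, c) \<in> J" "ac = (a, c)" by (cases ac) auto
  have "- (a \<bullet> u) \<le> (cell_gauge J z u' + g / \<kappa> * norm (u - u')) * (a \<bullet> z + c)" if pos: "0 < a \<bullet> z + c"
  proof -
    have "- (a \<bullet> u') \<le> cell_gauge J z u' * (a \<bullet> z + c)"
      using cell_gauge_le_iff[OF J, of z u' "cell_gauge J z u'"] ac pos by auto
    moreover have "- (a \<bullet> u) + a \<bullet> u' \<le> (g / \<kappa> * norm (u - u')) * (a \<bullet> z + c)"
    proof -
      have "- (a \<bullet> u) + a \<bullet> u' = a \<bullet> (u' - u)" by (simp add: inner_diff_right)
      also have "\<dots> \<le> norm a * norm (u' - u)" by (rule norm_cauchy_schwarz)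
      also have "\<dots> \<le> g * norm (u - u')" using g ac by (simp add: norm_minus_commute mult_right_mono)
      also have "\<dots> = (g / \<kappa> * norm (u - u')) * \<kappa>" using \<kappa> by simp
      also have "\<dots> \<le> (g / \<kappa> * norm (u - u')) * (a \<bullet> z + c)"
        using \<kappa>(1) \<kappa>(2)[OF ac(1)] pos g(2) by (intro mult_left_mono) auto
      finally show ?thesis .
    qed
    ultimately show ?thesis by (simp add: distrib_right)
  qed
  then show "case ac of (a, c) \<Rightarrow> 0 < a \<bullet> z + c \<longrightarrow> - (a \<bullet> u) \<le> (cell_gauge J z u' + g / \<kappa> * norm (u - u')) * (a \<bullet> z + c)"
    using ac by simp
qed

lemma cell_gauge_scale_le:
  assumes "finite J" "0 \<le> s"
  shows "cell_gauge J z (s *\<^sub>R u) \<le> s * cell_gauge J z u"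
proof -
  have "- (a \<bullet> u) \<le> cell_gauge J z u * (a \<bullet> z + c)" if "(a, c) \<in> J" "0 < a \<bullet> z + c" for a c
    using cell_gauge_le_iff[OF assms(1), of z u "cell_gauge J z u"] that by auto
  then have "s * (- (a \<bullet> u)) \<le> s * (cell_gauge J z u * (a \<bullet> z + c))" if "(a, c) \<in> J" "0 < a \<bullet> z + c" for a c
    using that assms(2) by (intro mult_left_mono) auto
  then show ?thesis
    unfolding cell_gauge_le_iff[OF assms(1)] using assms(2) cell_gauge_nonneg[OF assms(1)]
    by (auto simp: mult.assoc)
qed

lemma tangent_cone_scale: "u \<in> tangent_cone J z \<Longrightarrow> 0 \<le> s \<Longrightarrow> s *\<^sub>R u \<in> tangent_cone J z"
  by (auto simp: tangent_cone_def)

text \<open>Supplies the closed pieces of a segment on which the gauge of the star is the gauge of a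
  single element.\<close>

lemma closed_tangent_cone:
  assumes "continuous_on UNIV f"
  shows "closed {t. f t \<in> tangent_cone J z}"
proof -
  have "{t. f t \<in> tangent_cone J z} = (\<Inter>(a, c)\<in>{(a, c)\<in>J. a \<bullet> z + c = 0}. {t. 0 \<le> a \<bullet> f t})"
    by (auto simp: tangent_cone_def)
  also have "closed \<dots>"
    using assms by (intro closed_INT ballI) (auto intro!: closed_Collect_le continuous_intros simp: split_def)
  finally show ?thesis .
qed

text \<open>Otherwise the ray in direction \<open>u\<close> leaves \<open>T'\<close> at a point from
  which it continues inside \<open>T\<close>. This point lies in the common face and inside a
  segment of \<open>T\<close>, so the face, and with it \<open>T'\<close>, contains the rest of the
  segment.\<close>

lemma cell_gauge_consistent_le:
  assumes T: "cell T J" "z \<in> T" and T': "cell T' J'" "z \<in> T'" and F: "(T \<inter> T') face_of T"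
    and u: "u \<in> tangent_cone J z" "u \<in> tangent_cone J' z"
  shows "cell_gauge J' z u \<le> cell_gauge J z u"
proof (rule ccontr)
  let ?g = "cell_gauge J z u" and ?g' = "cell_gauge J' z u"
  assume "\<not> ?g' \<le> ?g"
  then have less: "?g < ?g'" by simp
  have nn: "0 \<le> ?g" by (rule cell_gauge_nonneg[OF cellD(1)[OF T(1)]])
  \<comment> \<open>The reciprocal of the mean of both gauges satisfies
    \<open>t * ?g \<le> 1 < t * ?g'\<close>, also if \<open>?g = 0\<close>.\<close>
  define t where "t = 2 / (?g + ?g')"
  have t: "t > 0" "t * ?g \<le> 1" "t * ?g' > 1" using less nn by (auto simp: t_def field_simps)
  define t0 where "t0 = 1 / ?g'"
  have t0: "0 < t0" "t0 < t" "t0 * ?g' \<le> 1" using less nn t by (auto simp: t0_def field_simps)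
  have "t0 * ?g \<le> 1" using t0 t nn by (meson less_imp_le mult_right_mono order_trans)
  then have "z + t0 *\<^sub>R u \<in> T" using mem_cell_iff_gauge(2)[OF T t0(1) u(1)] by simp
  moreover have "z + t0 *\<^sub>R u \<in> T'" using mem_cell_iff_gauge(2)[OF T' t0(1) u(2)] t0 by simp
  ultimately have in_F: "z + t0 *\<^sub>R u \<in> T \<inter> T'" by simp
  have far: "z + t *\<^sub>R u \<in> T" using mem_cell_iff_gauge(2)[OF T t(1) u(1)] t by simp
  have "u \<noteq> 0"
  proof
    assume "u = 0"
    then have "z + t *\<^sub>R u \<in> T'" using T' by simp
    then show False using mem_cell_iff_gauge(2)[OF T' t(1) u(2)] t by simp
  qed
  then have "z + t0 *\<^sub>R u \<in> open_segment z (z + t *\<^sub>R u)"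
    using t t0 unfolding in_segment
    by (intro conjI exI[of _ "t0 / t"]) (auto simp: algebra_simps)
  then have "z + t *\<^sub>R u \<in> T \<inter> T'" using F T(2) far in_F unfolding face_of_def by blast
  then show False using mem_cell_iff_gauge(2)[OF T' t(1) u(2)] t by simp
qed

text \<open>The gauges of the elements around \<open>z\<close> fit together to a Lipschitz gauge of the star;
  a positively homogeneous function with Lipschitz constant \<open>L\<close> is at most \<open>1\<close> on every
  segment from a point of its unit sublevel set to a point of the ball of radius \<open>1 / L\<close>.\<close>
lemma star_shaped_union_cells:
  fixes J :: "(real^'n) set \<Rightarrow> ((real^'n) \<times> real) set"
  assumes fin: "finite \<C>" and cell: "\<And>T. T \<in> \<C> \<Longrightarrow> cell T (J T)" and zT: "\<And>T. T \<in> \<C> \<Longrightarrow> z \<in> T"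
    and face: "\<And>T T'. T \<in> \<C> \<Longrightarrow> T' \<in> \<C> \<Longrightarrow> (T \<inter> T') face_of T"
    and e: "0 < e" "cball z e \<subseteq> \<Union>\<C>"
    and \<kappa>: "0 < \<kappa>" "\<And>T a c. T \<in> \<C> \<Longrightarrow> (a, c) \<in> J T \<Longrightarrow> a \<bullet> z + c = 0 \<or> \<kappa> \<le> a \<bullet> z + c"
    and g: "0 < g" "\<And>T a c. T \<in> \<C> \<Longrightarrow> (a, c) \<in> J T \<Longrightarrow> norm a \<le> g"
    and w: "w \<in> cball z (\<kappa> / g)" and x: "x \<in> \<Union>\<C>" and s: "s \<in> {0..1}"
  shows "w + s *\<^sub>R (x - w) \<in> \<Union>\<C>"
proof -
  define L where "L = g / \<kappa>"
  have L: "L > 0" using g \<kappa> by (simp add: L_def)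
  have fJ: "finite (J T)" if "T \<in> \<C>" for T using cellD(1)[OF cell[OF that]] .
  \<comment> \<open>A short step from \<open>z\<close> in any direction stays in the ball and so
    ends in some element.\<close>
  have cover: "\<exists>T\<in>\<C>. u \<in> tangent_cone (J T) z" for u
  proof -
    define t where "t = e / (norm u + 1)"
    have "norm u + 1 > 0" by (simp add: add_nonneg_pos)
    then have t: "t > 0" "t * norm u \<le> e" using e by (auto simp: t_def field_simps)
    then have "z + t *\<^sub>R u \<in> cball z e" by (simp add: dist_norm)
    then obtain T where "T \<in> \<C>" "z + t *\<^sub>R u \<in> T" using e by blast
    then show ?thesis using mem_cell_iff_gauge(1)[OF cell zT t(1)] by blast
  qed
  define sel where "sel u = (SOME T. T \<in> \<C> \<and> u \<in> tangent_cone (J T) z)" for u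
  have sel: "sel u \<in> \<C>" "u \<in> tangent_cone (J (sel u)) z" for u
    using someI_ex[of "\<lambda>T. T \<in> \<C> \<and> u \<in> tangent_cone (J T) z"] cover[of u] unfolding sel_def by auto
  define G where "G u = cell_gauge (J (sel u)) z u" for u
  \<comment> \<open>The choice made by \<open>sel\<close> is immaterial, since the gauges of two
    elements agree where their cones meet.\<close>
  have G: "G u = cell_gauge (J T) z u" if "T \<in> \<C>" "u \<in> tangent_cone (J T) z" for T u
    unfolding G_def
    by (intro antisym cell_gauge_consistent_le[OF cell zT cell zT face] that sel)
  have mem: "z + u \<in> \<Union>\<C> \<longleftrightarrow> G u \<le> 1" for u
  proof
    assume "z + u \<in> \<Union>\<C>"
    then obtain T where T: "T \<in> \<C>" "z + 1 *\<^sub>R u \<in> T" by auto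
    then have "u \<in> tangent_cone (J T) z" using mem_cell_iff_gauge(1)[OF cell zT, of T 1 u] by simp
    then show "G u \<le> 1" using mem_cell_iff_gauge(2)[OF cell zT, of T 1 u] T G by simp
  next
    assume "G u \<le> 1"
    then have "z + 1 *\<^sub>R u \<in> sel u"
      using mem_cell_iff_gauge(2)[OF cell zT, of "sel u" 1 u] sel[of u] by (simp add: G_def)
    then show "z + u \<in> \<Union>\<C>" using sel(1)[of u] by auto
  qed
  \<comment> \<open>The segment is covered by finitely many closed pieces, each in one cone. On each
    of them \<open>G\<close> is the gauge of one element and has the Lipschitz constant
    \<open>L\<close>; such bounds on closed pieces of an interval can be glued.\<close>
  have lip: "G b \<le> G a + L * norm (b - a)" for a b
  proof -
    define X where "X t = a + t *\<^sub>R (b - a)" for t :: real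
    have Xc: "continuous_on UNIV X" unfolding X_def by (intro continuous_intros)
    have "(L * norm (b - a))-lipschitz_on {0..1} (\<lambda>t. G (X t))"
    proof (rule lipschitz_on_closed_Union[where I = \<C> and U = "\<lambda>T. {t. X t \<in> tangent_cone (J T) z}"])
      fix T assume T: "T \<in> \<C>"
      show "closed {t. X t \<in> tangent_cone (J T) z}" using Xc by (rule closed_tangent_cone)
      show "(L * norm (b - a))-lipschitz_on {t. X t \<in> tangent_cone (J T) z} (\<lambda>t. G (X t))"
      proof (rule lipschitz_onI)
        have le: "G (X t) - G (X t') \<le> L * norm (b - a) * \<bar>t - t'\<bar>"
          if "t \<in> {t. X t \<in> tangent_cone (J T) z}" "t' \<in> {t. X t \<in> tangent_cone (J T) z}" for t t'
        proof -
          have "X t - X t' = (t - t') *\<^sub>R (b - a)" by (simp add: X_def algebra_simps)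
          then have "norm (X t - X t') = \<bar>t - t'\<bar> * norm (b - a)" by simp
          moreover have "cell_gauge (J T) z (X t) \<le> cell_gauge (J T) z (X t') + L * norm (X t - X t')"
            unfolding L_def by (rule cell_gauge_lipschitz[OF fJ[OF T] \<kappa>(1) \<kappa>(2)[OF T] g(2)[OF T]]) (use g in auto)
          ultimately show ?thesis using that G[OF T] by (simp add: ac_simps)
        qed
        fix t t' assume tt: "t \<in> {t. X t \<in> tangent_cone (J T) z}" "t' \<in> {t. X t \<in> tangent_cone (J T) z}"
        show "dist (G (X t)) (G (X t')) \<le> L * norm (b - a) * dist t t'"
          using le[OF tt] le[OF tt(2,1)] by (simp add: dist_real_def abs_minus_commute abs_le_iff)
      qed (use L in simp)
    next
      show "{0..1} \<subseteq> (\<Union>T\<in>\<C>. {t. X t \<in> tangent_cone (J T) z})" using cover by blast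
    qed (use fin L in auto)
    from lipschitz_onD[OF this, of 0 1] have "\<bar>G b - G a\<bar> \<le> L * norm (b - a)"
      by (simp add: X_def dist_real_def abs_minus_commute)
    then show ?thesis by linarith
  qed
  have scale: "G (r *\<^sub>R u) \<le> r * G u" if "0 \<le> r" for r u
    using cell_gauge_scale_le[OF fJ[OF sel(1)[of u]] that, of z u] G[OF sel(1)[of u] tangent_cone_scale[OF sel(2) that]]
    by (simp add: G_def)
  define a where "a = w - z"
  define b where "b = x - z"
  have "L * norm a \<le> 1"
  proof -
    have "norm a \<le> \<kappa> / g" using w by (simp add: a_def dist_norm norm_minus_commute)
    then have "L * norm a \<le> L * (\<kappa> / g)" using L by (intro mult_left_mono) auto
    then show ?thesis using g \<kappa> by (simp add: L_def)
  qed
  moreover have "G b \<le> 1" using mem[of b] x by (simp add: b_def)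
  ultimately have "s * G b + (1 - s) * (L * norm a) \<le> s * 1 + (1 - s) * 1"
    using s by (intro add_mono mult_left_mono) auto
  moreover have "G (s *\<^sub>R b + (1 - s) *\<^sub>R a) \<le> s * G b + (1 - s) * (L * norm a)"
  proof -
    have "G (s *\<^sub>R b + (1 - s) *\<^sub>R a) \<le> G (s *\<^sub>R b) + L * norm ((1 - s) *\<^sub>R a)"
      using lip[of "s *\<^sub>R b + (1 - s) *\<^sub>R a" "s *\<^sub>R b"] by simp
    also have "\<dots> \<le> s * G b + L * norm ((1 - s) *\<^sub>R a)" using s by (intro add_right_mono scale) auto
    also have "L * norm ((1 - s) *\<^sub>R a) = (1 - s) * (L * norm a)" using s by simp
    finally show ?thesis .
  qed
  ultimately have "G (s *\<^sub>R b + (1 - s) *\<^sub>R a) \<le> 1" by simp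
  then have "z + (s *\<^sub>R b + (1 - s) *\<^sub>R a) \<in> \<Union>\<C>" using mem by blast
  moreover have "z + (s *\<^sub>R b + (1 - s) *\<^sub>R a) = w + s *\<^sub>R (x - w)"
    by (simp add: a_def b_def algebra_simps)
  ultimately show ?thesis by simp
qed

subsection \<open>Geometry of stars\<close>

text \<open>A small sphere around \<open>z\<close> is connected, so the closed sets that cover it cannot be split into two
  classes without common points.\<close>
lemma chain_of_adjacent_cells:
  fixes \<C> :: "(real^'n) set set"
  assumes n: "2 \<le> CARD('n)" and fin: "finite \<C>" and T: "\<And>T. T \<in> \<C> \<Longrightarrow> convex T" "\<And>T. T \<in> \<C> \<Longrightarrow> closed T"
      "\<And>T. T \<in> \<C> \<Longrightarrow> z \<in> T" "\<And>T. T \<in> \<C> \<Longrightarrow> \<exists>x\<in>T. x \<noteq> z"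
    and e: "0 < e" "cball z e \<subseteq> \<Union>\<C>" and T1: "T1 \<in> \<C>" and T2: "T2 \<in> \<C>"
  shows "(T1, T2) \<in> {(T, T'). T \<in> \<C> \<and> T' \<in> \<C> \<and> (\<exists>x\<in>T \<inter> T'. x \<noteq> z)}\<^sup>*"
    (is "_ \<in> ?R\<^sup>*")
proof (rule ccontr)
  assume n12: "(T1, T2) \<notin> ?R\<^sup>*"
  obtain pt where pt: "\<And>T. T \<in> \<C> \<Longrightarrow> pt T \<in> T \<and> pt T \<noteq> z" using T(4) by metis
  \<comment> \<open>Every element has a point at distance at least \<open>r\<close> from
    \<open>z\<close> and is convex, so it meets the sphere of radius \<open>r\<close>.\<close>
  define r where "r = Min (insert e ((\<lambda>T. dist z (pt T)) ` \<C>))"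
  have r: "r > 0" "r \<le> e" "\<And>T. T \<in> \<C> \<Longrightarrow> r \<le> dist z (pt T)"
    using fin e pt by (auto simp: r_def)
  have meets: "T \<inter> sphere z r \<noteq> {}" if TC: "T \<in> \<C>" for T
  proof -
    define t where "t = r / dist z (pt T)"
    have d: "dist z (pt T) > 0" using pt[OF TC] by (metis zero_less_dist_iff)
    have t: "0 \<le> t" "t \<le> 1" using r(1) r(3)[OF TC] d by (auto simp: t_def)
    have "(1 - t) *\<^sub>R z + t *\<^sub>R pt T \<in> T"
      using T(1,3)[OF TC] pt[OF TC] t by (intro convexD) auto
    moreover have "dist z ((1 - t) *\<^sub>R z + t *\<^sub>R pt T) = r"
    proof -
      have "z - ((1 - t) *\<^sub>R z + t *\<^sub>R pt T) = t *\<^sub>R (z - pt T)" by (simp add: algebra_simps)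
      then show ?thesis using t d r(1) by (simp add: dist_norm t_def)
    qed
    ultimately show ?thesis by auto
  qed
  \<comment> \<open>\<open>A\<close> collects the elements linked to \<open>T1\<close>,
    \<open>B\<close> the others. A common point on the sphere would differ from \<open>z\<close> and
    link them.\<close>
  define A where "A = \<Union>{T \<in> \<C>. (T1, T) \<in> ?R\<^sup>*}"
  define B where "B = \<Union>{T \<in> \<C>. (T1, T) \<notin> ?R\<^sup>*}"
  have "closed A" "closed B" unfolding A_def B_def using fin T(2) by (auto intro!: closed_Union)
  moreover have "sphere z r \<subseteq> A \<union> B"
  proof
    fix x assume "x \<in> sphere z r"
    then have "x \<in> cball z e" using r by simp
    then show "x \<in> A \<union> B" using e(2) unfolding A_def B_def by blast
  qed
  moreover have "A \<inter> B \<inter> sphere z r = {}"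
  proof (rule ccontr)
    assume "A \<inter> B \<inter> sphere z r \<noteq> {}"
    then obtain x T T' where x: "x \<in> sphere z r" "T \<in> \<C>" "(T1, T) \<in> ?R\<^sup>*" "x \<in> T" "T' \<in> \<C>" "(T1, T') \<notin> ?R\<^sup>*" "x \<in> T'"
      unfolding A_def B_def by blast
    have "x \<noteq> z" using x(1) r(1) by auto
    then have "(T, T') \<in> ?R" using x by blast
    then have "(T1, T') \<in> ?R\<^sup>*" using x(3) by (rule rtrancl_into_rtrancl[rotated])
    then show False using x by blast
  qed
  moreover have "A \<inter> sphere z r \<noteq> {}" using meets[OF T1] T1 unfolding A_def by blast
  moreover have "B \<inter> sphere z r \<noteq> {}" using meets[OF T2] T2 n12 unfolding B_def by blast
  moreover have "connected (sphere z r)" using n by (intro connected_sphere) simp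
  ultimately show False unfolding connected_closed by blast
qed

text \<open>The intersection is a proper face of at least one of the two sets, and a proper face
  misses the interior.\<close>

lemma face_of_disjoint_interiors:
  fixes T T' :: "'a::euclidean_space set"
  assumes "(T \<inter> T') face_of T" "(T \<inter> T') face_of T'" "T \<noteq> T'"
  shows "interior T \<inter> interior T' = {}"
proof (cases "T \<inter> T' = T")
  case True
  then have "T \<inter> T' \<noteq> T'" using assms(3) by blast
  then have "(T \<inter> T') \<inter> interior T' = {}" using face_of_disjoint_interior[OF assms(2)] by blast
  then show ?thesis using interior_subset[of T] interior_subset[of T'] by blast
next
  case False
  then have "(T \<inter> T') \<inter> interior T = {}" using face_of_disjoint_interior[OF assms(1)] by blast
  then show ?thesis using interior_subset[of T] interior_subset[of T'] by blast
qed

text \<open>Each element contains a ball of radius \<open>h / (4 \<sigma>)\<close> within distance \<open>h\<close> of \<open>z\<close>, and these balls are disjoint.\<close>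
lemma card_cells_around_point:
  fixes \<C> :: "(real^'n) set set"
  assumes fin: "finite \<C>" and cell: "\<And>T. T \<in> \<C> \<Longrightarrow> cell T (J T)" and z: "\<And>T. T \<in> \<C> \<Longrightarrow> z \<in> T"
    and \<sigma>: "\<And>T. T \<in> \<C> \<Longrightarrow> diameter T / inball_diameter T \<le> \<sigma>" and \<sigma>0: "0 < \<sigma>"
    and face: "\<And>T T'. T \<in> \<C> \<Longrightarrow> T' \<in> \<C> \<Longrightarrow> (T \<inter> T') face_of T \<and> (T \<inter> T') face_of T'"
    and h: "0 < h" "\<And>T. T \<in> \<C> \<Longrightarrow> h \<le> diameter T"
  shows "real (card \<C>) \<le> (4 * \<sigma>) ^ CARD('n)"
proof -
  define \<rho> where "\<rho> = h / (4 * \<sigma>)"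
  have \<rho>: "\<rho> > 0" using h \<sigma>0 by (simp add: \<rho>_def)
  have "\<exists>c. ball c \<rho> \<subseteq> T \<inter> cball z h" if TC: "T \<in> \<C>" for T
  proof -
    obtain y s where s: "0 < s" "cball y s \<subseteq> T" "diameter T < 4 * \<sigma> * s" "2 * s \<le> diameter T"
      using inscribed_ball[OF cell[OF TC] \<sigma>[OF TC]] .
    have D: "diameter T > 0" using h TC by force
    \<comment> \<open>The contraction towards \<open>z\<close> by the factor \<open>t\<close> maps
      \<open>T\<close> into \<open>T \<inter> cball z h\<close>, and the inscribed ball to one of
      radius \<open>t * s \<ge> \<rho>\<close>.\<close>
    define t where "t = h / diameter T"
    have t: "0 < t" "t \<le> 1" using h(1) h(2)[OF TC] D by (auto simp: t_def)
    have "\<rho> \<le> t * s" using s D h \<sigma>0 by (simp add: \<rho>_def t_def field_simps)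
    have "ball (z + t *\<^sub>R (y - z)) \<rho> \<subseteq> T \<inter> cball z h"
    proof
      fix x assume x: "x \<in> ball (z + t *\<^sub>R (y - z)) \<rho>"
      define x0 where "x0 = z + (1 / t) *\<^sub>R (x - z)"
      have xx: "x = (1 - t) *\<^sub>R z + t *\<^sub>R x0" using t by (simp add: x0_def algebra_simps)
      have "y - x0 = (1 / t) *\<^sub>R (z + t *\<^sub>R (y - z) - x)" using t by (simp add: x0_def algebra_simps)
      then have "dist y x0 = dist (z + t *\<^sub>R (y - z)) x / t" using t by (simp add: dist_norm)
      also have "\<dots> \<le> s" using x \<open>\<rho> \<le> t * s\<close> t by (simp add: field_simps)
      finally have x0: "x0 \<in> T" using s by auto
      then have "x \<in> T" unfolding xx using cell_convex[OF cell[OF TC]] z[OF TC] t by (intro convexD) auto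
      moreover have "dist z x = t * dist z x0"
      proof -
        have "z - x = t *\<^sub>R (z - x0)" unfolding xx by (simp add: algebra_simps)
        then show ?thesis using t by (simp add: dist_norm)
      qed
      moreover have "dist z x0 \<le> diameter T"
        using diameter_bounded_bound[OF compact_imp_bounded[OF cellD(2)[OF cell[OF TC]]] z[OF TC] x0] .
      then have "t * dist z x0 \<le> t * diameter T" using t by (intro mult_left_mono) auto
      moreover have "t * diameter T = h" using D by (simp add: t_def)
      ultimately show "x \<in> T \<inter> cball z h" by simp
    qed
    then show ?thesis by blast
  qed
  then obtain cen where cen: "\<And>T. T \<in> \<C> \<Longrightarrow> ball (cen T) \<rho> \<subseteq> T \<inter> cball z h" by metis
  have disj: "disjoint_family_on (\<lambda>T. ball (cen T) \<rho>) \<C>"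
    unfolding disjoint_family_on_def
  proof (intro ballI impI)
    fix T T' assume TT: "T \<in> \<C>" "T' \<in> \<C>" "T \<noteq> T'"
    have "ball (cen T) \<rho> \<subseteq> interior T" "ball (cen T') \<rho> \<subseteq> interior T'"
      using cen[OF TT(1)] cen[OF TT(2)] by (meson Int_subset_iff interior_maximal open_ball)+
    then show "ball (cen T) \<rho> \<inter> ball (cen T') \<rho> = {}"
      using face_of_disjoint_interiors[of T T'] face[OF TT(1,2)] TT(3) by blast
  qed
  define V where "V = unit_ball_vol (real CARD('n))"
  have V: "V > 0" by (simp add: V_def unit_ball_vol_pos)
  have vol: "emeasure lborel (ball c r) = ennreal (V * r ^ CARD('n))" if "r > 0" for c :: "real^'n" and r
    using that by (simp add: emeasure_ball V_def)
  have "ennreal (real (card \<C>) * (V * \<rho> ^ CARD('n))) = (\<Sum>T\<in>\<C>. emeasure lborel (ball (cen T) \<rho>))"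
    using V \<rho> by (simp add: vol ennreal_of_nat_eq_real_of_nat ennreal_mult)
  also have "\<dots> = emeasure lborel (\<Union>T\<in>\<C>. ball (cen T) \<rho>)"
    by (rule sum_emeasure) (use disj fin in auto)
  also have "\<dots> \<le> emeasure lborel (cball z h)"
    using cen by (intro emeasure_mono) auto
  also have "\<dots> = ennreal (V * h ^ CARD('n))"
    using h by (simp add: emeasure_cball V_def)
  finally have "real (card \<C>) * (V * \<rho> ^ CARD('n)) \<le> V * h ^ CARD('n)"
    using V h by (subst (asm) ennreal_le_iff) auto
  then have "real (card \<C>) * \<rho> ^ CARD('n) \<le> h ^ CARD('n)" using V by simp
  also have "h = (4 * \<sigma>) * \<rho>" using \<sigma>0 by (simp add: \<rho>_def)
  finally show ?thesis using \<rho> by (simp add: power_mult_distrib)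
qed

text \<open>Weak derivatives are determined on the interior of the star, whereas the norms are taken
  over the closed star; a null frontier makes the difference immaterial.\<close>

lemma negligible_frontier_Union_convex:
  assumes "finite \<C>" "\<And>T. T \<in> \<C> \<Longrightarrow> convex T"
  shows "negligible (frontier (\<Union>\<C>))"
  using assms
proof (induction rule: finite_induct)
  case (insert T \<C>)
  have "negligible (frontier T)" by (rule negligible_convex_frontier) (use insert.prems in auto)
  moreover have "negligible (frontier (\<Union>\<C>))" by (rule insert.IH) (use insert.prems in auto)
  ultimately have "negligible (frontier T \<union> frontier (\<Union>\<C>))" by (rule negligible_Un)
  then show ?case by (rule negligible_subset) (simp add: frontier_Un_subset)
qed simp

text \<open>At most \<open>(4 * \<sigma>) ^ n\<close> elements meet at a node, and the square of this number bounds the length of a chain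
  of adjacent ones, along which the diameter changes at most by the factor \<open>2 * \<sigma>\<close> in each step.\<close>
definition size_ratio :: "nat \<Rightarrow> real \<Rightarrow> real" where
  "size_ratio n \<sigma> = (2 * \<sigma>) ^ ((nat \<lceil>(4 * \<sigma>) ^ n\<rceil>)\<^sup>2 + 1)"

text \<open>All that is used about the mesh. The radius of the ball is \<open>\<kappa> / g\<close>,
  with the lower bound \<open>\<kappa> = 1 / max m 1\<close> for nonzero coordinates at
  \<open>z\<close> and the bound \<open>g = 2 * \<sigma> / h\<close> for their gradients.\<close>

lemma star_geometry:
  fixes z :: "real^'n" and \<T> :: "(real^'n) set set"
  assumes \<sigma>: "1 < \<sigma>" and \<Omega>: "open \<Omega>" and mesh: "conforming_mesh \<Omega> \<T>" and sr: "shape_regular \<sigma> \<T>"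
    and one: "CARD('n) = 1 \<Longrightarrow> \<forall>T\<in>\<T>. \<forall>T'\<in>\<T>. T \<inter> T' \<noteq> {} \<longrightarrow> diameter T \<le> \<sigma> * diameter T'"
    and z: "z \<in> interior_nodes m \<Omega> \<T>"
  defines "S \<equiv> star \<T> z" and "h \<equiv> node_size \<T> z"
  shows "0 < h" "compact S" "S \<subseteq> cball z (size_ratio CARD('n) \<sigma> * h)" "negligible (frontier S)"
    "\<And>w x s. w \<in> cball z (h / (2 * \<sigma> * real (max m 1))) \<Longrightarrow> x \<in> S \<Longrightarrow> s \<in> {0..1} \<Longrightarrow> w + s *\<^sub>R (x - w) \<in> S"
proof -
  define \<C> where "\<C> = {T \<in> \<T>. z \<in> T}"
  have SC: "S = \<Union>\<C>" by (simp add: S_def star_def \<C>_def)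
  have finT: "finite \<T>" and shapes: "\<And>T. T \<in> \<T> \<Longrightarrow> is_simplex T \<or> is_rectangle T" and un: "\<Union>\<T> = closure \<Omega>"
    and faces: "\<And>T T'. T \<in> \<T> \<Longrightarrow> T' \<in> \<T> \<Longrightarrow> (T \<inter> T') face_of T \<and> (T \<inter> T') face_of T'"
    using mesh by (auto simp: conforming_mesh_def)
  have fin: "finite \<C>" using finT by (simp add: \<C>_def)
  have sub: "T \<in> \<T>" "z \<in> T" if "T \<in> \<C>" for T using that by (auto simp: \<C>_def)
  have "\<exists>J. cell T J" if "T \<in> \<T>" for T using shapes[OF that] simplex_cell rectangle_cell by blast
  then obtain J where J: "\<And>T. T \<in> \<T> \<Longrightarrow> cell T (J T)" by metis
  have conv: "convex T" and cpt: "compact T" if "T \<in> \<T>" for T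
    using cell_convex[OF J[OF that]] cellD(2)[OF J[OF that]] .
  have reg: "diameter T / inball_diameter T \<le> \<sigma>" if "T \<in> \<T>" for T using sr that by (simp add: shape_regular_def)
  have pos: "0 < diameter T" if TT: "T \<in> \<T>" for T
  proof -
    obtain y s where "0 < s" "cball y s \<subseteq> T" "diameter T < 4 * \<sigma> * s" "2 * s \<le> diameter T"
      using inscribed_ball[OF J[OF TT] reg[OF TT]] .
    then show ?thesis by linarith
  qed
  obtain T0 where T0: "T0 \<in> \<T>" "z \<in> lagrange_nodes m T0" and zf: "z \<notin> frontier \<Omega>"
    using z by (auto simp: interior_nodes_def)
  note gap = lagrange_node_gap[OF shapes[OF T0(1)] T0(2)]
  have T0C: "T0 \<in> \<C>" using T0 gap(1) by (simp add: \<C>_def)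
  then have ne: "\<C> \<noteq> {}" by blast
  have h_le: "h \<le> diameter T" if "T \<in> \<C>" for T
    unfolding h_def node_size_def using fin that by (intro Min_le) (auto simp: \<C>_def)
  obtain Tm where Tm: "Tm \<in> \<C>" "h = diameter Tm"
  proof -
    have "h \<in> diameter ` \<C>" unfolding h_def node_size_def \<C>_def[symmetric] using fin ne by (intro Min_in) auto
    then show ?thesis using that by blast
  qed
  show h0: "0 < h" using Tm pos sub by simp
  show "compact S" unfolding SC using fin cpt sub by (intro compact_Union) auto
  show "negligible (frontier S)" unfolding SC using fin conv sub by (intro negligible_frontier_Union_convex) auto
  have "z \<in> \<Omega>"
  proof -
    have "z \<in> closure \<Omega>" using T0 gap(1) un by blast
    then show ?thesis using zf interior_open[OF \<Omega>] by (simp add: frontier_def)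
  qed
  \<comment> \<open>The elements that avoid \<open>z\<close> form a closed set, so a small ball
    about \<open>z\<close> inside the domain meets only elements of the star.\<close>
  obtain e where e: "0 < e" "cball z e \<subseteq> \<Union>\<C>"
  proof -
    have "closed (\<Union>{T \<in> \<T>. z \<notin> T})" using finT cpt by (intro closed_Union) (auto intro: compact_imp_closed)
    then have "open (\<Omega> - \<Union>{T \<in> \<T>. z \<notin> T})" using \<Omega> by (rule open_Diff[rotated])
    moreover have "z \<in> \<Omega> - \<Union>{T \<in> \<T>. z \<notin> T}" using \<open>z \<in> \<Omega>\<close> by blast
    ultimately obtain e where e: "e > 0" "cball z e \<subseteq> \<Omega> - \<Union>{T \<in> \<T>. z \<notin> T}"
      by (meson open_contains_cball)
    have "\<Omega> - \<Union>{T \<in> \<T>. z \<notin> T} \<subseteq> \<Union>\<C>"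
      using un closure_subset[of \<Omega>] unfolding \<C>_def by blast
    then show ?thesis using that e by blast
  qed
  show "w + s *\<^sub>R (x - w) \<in> S"
    if wxs: "w \<in> cball z (h / (2 * \<sigma> * real (max m 1)))" "x \<in> S" "s \<in> {0..1}" for w x s
    unfolding SC
  proof (rule star_shaped_union_cells[where J = J and \<kappa> = "1 / real (max m 1)" and g = "2 * \<sigma> / h" and e = e])
    \<comment> \<open>\<open>z\<close> is given as a Lagrange node of \<open>T0\<close>, which may
      differ from \<open>T\<close>. The gap lemma is therefore applied on the common face, whose
      vertices are vertices of \<open>T\<close> too.\<close>
    show "a \<bullet> z + c = 0 \<or> 1 / real (max m 1) \<le> a \<bullet> z + c" if TC: "T \<in> \<C>" and ac: "(a, c) \<in> J T" for T a c
    proof (rule gap(2))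
      show "(T0 \<inter> T) face_of T0" using faces T0(1) sub(1)[OF TC] by blast
      show "z \<in> T0 \<inter> T" using gap(1) sub(2)[OF TC] by blast
      fix v assume v: "v extreme_point_of (T0 \<inter> T)"
      have "(T0 \<inter> T) face_of T" using faces T0(1) sub(1)[OF TC] by blast
      then have "v extreme_point_of T" using v extreme_point_of_face by blast
      then show "a \<bullet> v + c = 0 \<or> a \<bullet> v + c = 1" using cellD(6)[OF J[OF sub(1)[OF TC]]] ac by blast
    qed
    show "norm a \<le> 2 * \<sigma> / h" if TC: "T \<in> \<C>" and ac: "(a, c) \<in> J T" for T a c
    proof -
      have "norm a * h \<le> norm a * diameter T" using h_le[OF TC] by (intro mult_left_mono) auto
      also have "\<dots> \<le> 2 * \<sigma>" using cell_gradient_diameter_bound(2)[OF J[OF sub(1)[OF TC]] ac reg[OF sub(1)[OF TC]]] .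
      finally show ?thesis using h0 by (simp add: pos_le_divide_eq)
    qed
    show "w \<in> cball z (1 / real (max m 1) / (2 * \<sigma> / h))" using wxs(1) by (simp add: field_simps)
    show "x \<in> \<Union>\<C>" using wxs(2) by (simp add: SC)
    show "0 < 1 / real (max m 1)" by (simp add: max_def)
  qed (use fin J sub faces e h0 \<sigma> wxs in auto)
  have ratio: "diameter T \<le> size_ratio CARD('n) \<sigma> * h" if TC: "T \<in> \<C>" for T
  proof (cases "CARD('n) = 1")
    case True
    have "T \<inter> Tm \<noteq> {}" using sub(2)[OF TC] sub(2)[OF Tm(1)] by blast
    then have "diameter T \<le> \<sigma> * h" using one[OF True] sub(1)[OF TC] sub(1)[OF Tm(1)] Tm(2) by blast
    also have "\<dots> \<le> size_ratio CARD('n) \<sigma> * h"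
    proof (rule mult_right_mono)
      \<comment> \<open>Here the exponent in \<open>size_ratio\<close> has to be positive, which its
        summand 1 ensures.\<close>
      have "\<sigma> \<le> (2 * \<sigma>) ^ 1" using \<sigma> by simp
      also have "\<dots> \<le> size_ratio CARD('n) \<sigma>" unfolding size_ratio_def using \<sigma> by (intro power_increasing) auto
      finally show "\<sigma> \<le> size_ratio CARD('n) \<sigma>" .
    qed (use h0 in simp)
    finally show ?thesis .
  next
    case False
    moreover have "CARD('n) > 0" by simp
    ultimately have n2: "2 \<le> CARD('n)" by linarith
    define R where "R = {(T, T'). T \<in> \<C> \<and> T' \<in> \<C> \<and> (\<exists>x\<in>T \<inter> T'. x \<noteq> z)}"
    have other: "\<exists>x\<in>T. x \<noteq> z" if "T \<in> \<C>" for T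
    proof (rule ccontr)
      assume "\<not> ?thesis"
      then have "T = {z}" using sub(2)[OF that] by blast
      then show False using pos[OF sub(1)[OF that]] by simp
    qed
    \<comment> \<open>Over a finite relation a chain can be taken with at most \<open>card R\<close>
      links, and \<open>R\<close> has at most \<open>(card \<C>)\<^sup>2\<close> elements.\<close>
    have "(T, Tm) \<in> R\<^sup>*"
      unfolding R_def
      by (rule chain_of_adjacent_cells[OF n2 fin _ _ _ other e TC Tm(1)])
        (use conv cpt sub in \<open>auto intro: compact_imp_closed\<close>)
    moreover have Rsub: "R \<subseteq> \<C> \<times> \<C>" by (auto simp: R_def)
    then have finR: "finite R" using fin by (meson finite_SigmaI finite_subset)
    ultimately obtain j where j: "j \<le> card R" "(T, Tm) \<in> R ^^ j"
      by (auto simp: rtrancl_finite_eq_relpow)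
    have step: "diameter T1 \<le> 2 * \<sigma> * diameter T2" if "(T1, T2) \<in> R" for T1 T2
    proof -
      obtain x where TT: "T1 \<in> \<C>" "T2 \<in> \<C>" "x \<in> T1 \<inter> T2" "x \<noteq> z" using \<open>(T1, T2) \<in> R\<close> by (auto simp: R_def)
      show ?thesis
        by (rule adjacent_cells_comparable[OF J[OF sub(1)[OF TT(1)]] reg[OF sub(1)[OF TT(1)]] cpt[OF sub(1)[OF TT(2)]] _ TT(3) _ TT(4)])
          (use faces sub TT in auto)
    qed
    have chain: "diameter T1 \<le> (2 * \<sigma>) ^ j * diameter T2" if "(T1, T2) \<in> R ^^ j" for T1 T2 j
      using that
    proof (induction j arbitrary: T2)
      case (Suc j)
      then obtain T3 where T3: "(T1, T3) \<in> R ^^ j" "(T3, T2) \<in> R" by auto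
      have "diameter T1 \<le> (2 * \<sigma>) ^ j * diameter T3" by (rule Suc.IH[OF T3(1)])
      also have "\<dots> \<le> (2 * \<sigma>) ^ j * (2 * \<sigma> * diameter T2)" using \<sigma> step[OF T3(2)] by (intro mult_left_mono) auto
      finally show ?case by (simp add: ac_simps)
    qed simp
    have "card R \<le> card (\<C> \<times> \<C>)" using Rsub fin by (intro card_mono) auto
    also have "\<dots> = (card \<C>)\<^sup>2" by (simp add: card_cartesian_product power2_eq_square)
    also have "\<dots> \<le> (nat \<lceil>(4 * \<sigma>) ^ CARD('n)\<rceil>)\<^sup>2"
    proof (rule power_mono)
      have "real (card \<C>) \<le> (4 * \<sigma>) ^ CARD('n)"
        by (rule card_cells_around_point[where J = J and z = z and h = h])
          (use fin J sub reg faces \<sigma> h0 h_le in auto)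
      then show "card \<C> \<le> nat \<lceil>(4 * \<sigma>) ^ CARD('n)\<rceil>" by linarith
    qed simp
    finally have "j \<le> (nat \<lceil>(4 * \<sigma>) ^ CARD('n)\<rceil>)\<^sup>2 + 1" using j by linarith
    then have "(2 * \<sigma>) ^ j \<le> size_ratio CARD('n) \<sigma>"
      unfolding size_ratio_def using \<sigma> by (intro power_increasing) auto
    then have "(2 * \<sigma>) ^ j * h \<le> size_ratio CARD('n) \<sigma> * h" using h0 by (intro mult_right_mono) auto
    then show ?thesis using chain[OF j(2)] unfolding Tm(2) by (rule order_trans[rotated])
  qed
  show "S \<subseteq> cball z (size_ratio CARD('n) \<sigma> * h)"
  proof
    fix x assume "x \<in> S"
    then obtain T where T: "T \<in> \<C>" "x \<in> T" by (auto simp: SC)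
    have "dist z x \<le> diameter T"
      using diameter_bounded_bound[OF compact_imp_bounded[OF cpt[OF sub(1)[OF T(1)]]] sub(2)[OF T(1)] T(2)] .
    then show "x \<in> cball z (size_ratio CARD('n) \<sigma> * h)" using ratio[OF T(1)] by simp
  qed
qed

subsection \<open>Averages along segments in weighted spaces\<close>

definition epowr :: "real \<Rightarrow> ennreal \<Rightarrow> ennreal" where
  "epowr q x = (if x = top then top else ennreal (enn2real x powr q))"

lemma epowr_ennreal: "0 \<le> x \<Longrightarrow> epowr q (ennreal x) = ennreal (x powr q)"
  by (simp add: epowr_def)

lemma epowr_top [simp]: "epowr q top = top"
  by (simp add: epowr_def)

lemma epowr_0 [simp]: "epowr q 0 = 0"
  by (simp add: epowr_def)

lemma epowr_1 [simp]: "epowr q 1 = 1"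
  by (simp add: epowr_def)

lemma epowr_eq_0_iff [simp]: "epowr q x = 0 \<longleftrightarrow> x = 0"
  by (cases x) (auto simp: epowr_ennreal)

lemma epowr_eq_top_iff [simp]: "epowr q x = top \<longleftrightarrow> x = top"
  by (cases x) (auto simp: epowr_ennreal)

lemma epowr_mono: "0 \<le> q \<Longrightarrow> x \<le> y \<Longrightarrow> epowr q x \<le> epowr q y"
  by (cases x; cases y) (auto simp: epowr_ennreal top_unique intro!: ennreal_leI powr_mono2)

text \<open>\<open>epowr\<close> maps 0 to 0 and \<open>top\<close> to \<open>top\<close> for every
  exponent, so that products such as \<open>0 * top\<close> are no exception.\<close>

lemma epowr_mult: "epowr q (x * y) = epowr q x * epowr q y"
proof (cases x; cases y)
  fix r s assume "0 \<le> r" "x = ennreal r" "0 \<le> s" "y = ennreal s"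
  thus ?thesis
    by (simp add: ennreal_mult'[symmetric] epowr_ennreal powr_mult)
qed (auto simp: ennreal_mult_top ennreal_top_mult epowr_ennreal)

lemma measurable_epowr [measurable (raw)]:
  assumes [measurable]: "f \<in> borel_measurable M"
  shows "(\<lambda>x. epowr q (f x)) \<in> borel_measurable M"
  unfolding epowr_def by measurable

lemma Young_ennreal:
  assumes "1 < p"
  shows "a * b \<le> ennreal (1 / p) * epowr p a + ennreal (1 - 1 / p) * epowr (p / (p - 1)) b"
proof (cases "a = 0 \<or> b = 0")
  case False
  have pp: "1 / p > 0" "1 - 1 / p > 0" using assms by (auto simp: field_simps)
  show ?thesis
  proof (cases "a = top \<or> b = top")
    case True
    then have "ennreal (1 / p) * epowr p a + ennreal (1 - 1 / p) * epowr (p / (p - 1)) b = top"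
      using pp by (auto simp: ennreal_mult_top)
    then show ?thesis by (metis top_greatest)
  next
    case False
    then obtain r s where rs: "0 \<le> r" "a = ennreal r" "0 \<le> s" "b = ennreal s"
      by (metis ennreal_cases)
    have "r * s \<le> r powr p / p + s powr (p / (p - 1)) / (p / (p - 1))"
      using rs assms by (intro Youngs_inequality) (auto simp: field_simps)
    also have "\<dots> = (1 / p) * r powr p + (1 - 1 / p) * s powr (p / (p - 1))"
      using assms by (auto simp: field_simps)
    finally show ?thesis
      using rs pp by (simp add: epowr_ennreal flip: ennreal_mult' ennreal_plus)
  qed
qed auto

text \<open>Taking the p-th power of the usual inequality avoids a root on the left and keeps
  infinite integrals meaningful. If both integrals on the right are positive and finite,
  \<open>a\<close> and \<open>b\<close> normalize the factors and Young's inequality is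
  integrated.\<close>

lemma nn_integral_Holder:
  fixes f g :: "'a \<Rightarrow> ennreal"
  assumes p: "1 < p" and [measurable]: "f \<in> borel_measurable M" "g \<in> borel_measurable M"
  shows "epowr p (\<integral>\<^sup>+x. f x * g x \<partial>M)
           \<le> (\<integral>\<^sup>+x. epowr p (f x) \<partial>M) * epowr (p - 1) (\<integral>\<^sup>+x. epowr (p / (p - 1)) (g x) \<partial>M)"
    (is "_ \<le> ?I * epowr (p - 1) ?J")
proof -
  consider "?I = 0" | "?J = 0" | "?I \<noteq> 0" "?J \<noteq> 0" "?I = top \<or> ?J = top"
    | "?I \<noteq> 0" "?J \<noteq> 0" "?I \<noteq> top" "?J \<noteq> top" by blast
  then show ?thesis
  proof cases
    case 1
    then have "AE x in M. f x = 0" by (subst (asm) nn_integral_0_iff_AE) auto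
    then have "(\<integral>\<^sup>+x. f x * g x \<partial>M) = 0" by (subst nn_integral_0_iff_AE) auto
    then show ?thesis by simp
  next
    case 2
    then have "AE x in M. g x = 0" by (subst (asm) nn_integral_0_iff_AE) auto
    then have "(\<integral>\<^sup>+x. f x * g x \<partial>M) = 0" by (subst nn_integral_0_iff_AE) auto
    then show ?thesis by simp
  next
    case 3
    then have "?I * epowr (p - 1) ?J = top" by (auto simp: ennreal_mult_eq_top_iff)
    then show ?thesis by simp
  next
    case 4
    then obtain i j where ij: "?I = ennreal i" "?J = ennreal j" "0 < i" "0 < j"
      by (metis ennreal_cases ennreal_0 order_le_less)
    define q where "q = p / (p - 1)"
    have q: "q > 0" using p by (simp add: q_def)
    define a where "a = i powr (- (1 / p))"
    define b where "b = j powr (- (1 / q))"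
    have ab: "a > 0" "b > 0" "a powr p = 1 / i" "b powr q = 1 / j"
      using ij p q by (auto simp: a_def b_def powr_powr powr_minus[of _ 1] inverse_eq_divide)
    have "ennreal (a * b) * (\<integral>\<^sup>+x. f x * g x \<partial>M) = (\<integral>\<^sup>+x. (ennreal a * f x) * (ennreal b * g x) \<partial>M)"
      using ab by (subst nn_integral_cmult[symmetric]) (auto simp: ennreal_mult' ac_simps)
    also have "\<dots> \<le> (\<integral>\<^sup>+x. ennreal (1 / p) * epowr p (ennreal a * f x)
        + ennreal (1 - 1 / p) * epowr (p / (p - 1)) (ennreal b * g x) \<partial>M)"
      by (intro nn_integral_mono Young_ennreal p)
    also have "\<dots> = (\<integral>\<^sup>+x. ennreal (1 / p) * (ennreal (1 / i) * epowr p (f x))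
        + ennreal (1 - 1 / p) * (ennreal (1 / j) * epowr q (g x)) \<partial>M)"
      using ab by (simp add: epowr_mult epowr_ennreal q_def[symmetric])
    also have "\<dots> = ennreal (1 / p) * (ennreal (1 / i) * ?I) + ennreal (1 - 1 / p) * (ennreal (1 / j) * ?J)"
      by (subst nn_integral_add) (auto simp: nn_integral_cmult q_def)
    also have "\<dots> = ennreal (1 / p) + ennreal (1 - 1 / p)"
      using ij by (simp flip: ennreal_mult')
    also have "\<dots> = 1" using p by (simp flip: ennreal_plus)
    finally have *: "ennreal (a * b) * (\<integral>\<^sup>+x. f x * g x \<partial>M) \<le> 1" .
    then have "epowr p (ennreal (a * b) * (\<integral>\<^sup>+x. f x * g x \<partial>M)) \<le> epowr p 1"
      using p by (intro epowr_mono) auto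
    then have **: "ennreal ((a * b) powr p) * epowr p (\<integral>\<^sup>+x. f x * g x \<partial>M) \<le> 1"
      using ab by (simp add: epowr_mult epowr_ennreal)
    have bp: "b powr p = 1 / j powr (p - 1)"
    proof -
      have "b powr p = j powr (- (p - 1))"
        using p by (simp add: b_def q_def powr_powr divide_simps)
      then show ?thesis by (simp only: powr_minus_divide)
    qed
    have e: "(a * b) powr p = 1 / (i * j powr (p - 1))"
      using ab bp by (simp add: powr_mult)
    define c where "c = i * j powr (p - 1)"
    have c: "c > 0" using ij by (simp add: c_def)
    have "epowr p (\<integral>\<^sup>+x. f x * g x \<partial>M) = ennreal c * (ennreal (1 / c) * epowr p (\<integral>\<^sup>+x. f x * g x \<partial>M))"
      using c by (simp add: mult.assoc[symmetric] flip: ennreal_mult')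
    also have "\<dots> \<le> ennreal c * 1"
      using ** unfolding e c_def[symmetric] by (intro mult_left_mono) auto
    also have "\<dots> = ?I * epowr (p - 1) ?J"
      using ij by (simp add: c_def epowr_ennreal ennreal_mult')
    finally show ?thesis .
  qed
qed


section \<open>Muckenhoupt weights and averages at a fixed relative position\<close>

lemma nn_integral_lborel_affine:
  fixes g :: "'a::euclidean_space \<Rightarrow> ennreal"
  assumes [measurable]: "g \<in> borel_measurable borel" and "c \<noteq> 0"
  shows "(\<integral>\<^sup>+x. g x \<partial>lborel) = ennreal (\<bar>c\<bar> ^ DIM('a)) * (\<integral>\<^sup>+x. g (t + c *\<^sub>R x) \<partial>lborel)"
  by (subst lborel_affine[OF assms(2), of t]) (simp add: nn_integral_density nn_integral_distr nn_integral_cmult)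

lemma measurable_indicator_ball [measurable (raw)]:
  fixes f :: "'a \<Rightarrow> 'b::euclidean_space"
  assumes [measurable]: "f \<in> borel_measurable M"
  shows "(\<lambda>x. indicator (ball z d) (f x) :: ennreal) \<in> borel_measurable M"
proof -
  have "(\<lambda>x. indicator (ball z d) (f x) :: ennreal) = (\<lambda>x. if dist z (f x) < d then 1 else 0)"
    by (auto simp: indicator_def)
  then show ?thesis by simp
qed

lemma measurable_indicator_unit [measurable (raw)]:
  fixes f :: "'a \<Rightarrow> real"
  assumes [measurable]: "f \<in> borel_measurable M"
  shows "(\<lambda>x. indicator {0<..<1} (f x) :: ennreal) \<in> borel_measurable M"
proof -
  have "(\<lambda>x. indicator {0<..<1} (f x) :: ennreal) = (\<lambda>x. if 0 < f x \<and> f x < 1 then 1 else 0)"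
    by (auto simp: indicator_def)
  then show ?thesis by simp
qed

text \<open>The Muckenhoupt condition for a Borel weight that is positive everywhere, multiplied by
  the p-th power of the volume of the ball. With extended integrals and no quotients it carries no
  integrability conditions.\<close>

definition Ap_bound :: "real \<Rightarrow> real \<Rightarrow> (real^'n \<Rightarrow> real) \<Rightarrow> bool" where
  "Ap_bound p A w \<longleftrightarrow> w \<in> borel_measurable borel \<and> (\<forall>x. w x > 0) \<and>
     (\<forall>c s. s > 0 \<longrightarrow> (\<integral>\<^sup>+x\<in>ball c s. w x \<partial>lborel) *
        epowr (p - 1) (\<integral>\<^sup>+x\<in>ball c s. ennreal (w x powr (1 / (1 - p))) \<partial>lborel)
        \<le> ennreal A * epowr p (emeasure lborel (ball c s)))"

lemma Ap_boundD:
  assumes "Ap_bound p A w"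
  shows "w \<in> borel_measurable borel" "w x > 0"
    "s > 0 \<Longrightarrow> (\<integral>\<^sup>+x\<in>ball c s. w x \<partial>lborel) *
        epowr (p - 1) (\<integral>\<^sup>+x\<in>ball c s. ennreal (w x powr (1 / (1 - p))) \<partial>lborel)
        \<le> ennreal A * epowr p (emeasure lborel (ball c s))"
  using assms unfolding Ap_bound_def by auto

text \<open>The weight is inserted by \<open>f = (f * w powr (1 / p)) * w powr (- (1 / p))\<close>;
  the conjugate exponent \<open>p / (p - 1)\<close> turns the second factor into the dual
  weight.\<close>

lemma weighted_Holder:
  fixes w :: "real^'n \<Rightarrow> real" and f :: "real^'n \<Rightarrow> ennreal"
  assumes p: "1 < p" and w: "Ap_bound p A w" and [measurable]: "f \<in> borel_measurable borel" "E \<in> sets borel"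
  shows "epowr p (\<integral>\<^sup>+x\<in>E. f x \<partial>lborel)
    \<le> (\<integral>\<^sup>+x\<in>E. epowr p (f x) * w x \<partial>lborel) *
       epowr (p - 1) (\<integral>\<^sup>+x\<in>E. ennreal (w x powr (1 / (1 - p))) \<partial>lborel)"
proof -
  note [measurable] = Ap_boundD(1)[OF w]
  have w0: "w x > 0" for x by (rule Ap_boundD(2)[OF w])
  have a: "f x * indicator E x = (f x * ennreal (w x powr (1 / p)) * indicator E x) *
      (ennreal (w x powr (- (1 / p))) * indicator E x)" for x
    using w0[of x] by (auto simp: indicator_def mult.assoc powr_minus simp flip: ennreal_mult')
  have q: "- (1 / p) * (p / (p - 1)) = 1 / (1 - p)"
    using p by (simp add: divide_simps)
  have "epowr p (\<integral>\<^sup>+x\<in>E. f x \<partial>lborel) \<le>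
    (\<integral>\<^sup>+x. epowr p (f x * ennreal (w x powr (1 / p)) * indicator E x) \<partial>lborel) *
    epowr (p - 1) (\<integral>\<^sup>+x. epowr (p / (p - 1)) (ennreal (w x powr (- (1 / p))) * indicator E x) \<partial>lborel)"
    unfolding a by (rule nn_integral_Holder[OF p]) measurable
  also have "(\<lambda>x. epowr p (f x * ennreal (w x powr (1 / p)) * indicator E x)) =
      (\<lambda>x. epowr p (f x) * w x * indicator E x)"
    using p w0 by (auto simp: fun_eq_iff indicator_def epowr_mult epowr_ennreal powr_powr less_imp_le)
  also have "(\<lambda>x. epowr (p / (p - 1)) (ennreal (w x powr (- (1 / p))) * indicator E x)) =
      (\<lambda>x. ennreal (w x powr (1 / (1 - p))) * indicator E x)"
    using q by (auto simp: fun_eq_iff indicator_def epowr_mult epowr_ennreal powr_powr)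
  finally show ?thesis .
qed

text \<open>For fixed \<open>s\<close> the points on the segments from \<open>y\<close> fill a ball
  \<open>E y\<close> of radius \<open>s * \<delta>\<close>. Hoelder's inequality on
  \<open>E y\<close> and Tonelli's theorem leave, at each \<open>x\<close>, the product of the dual
  integral and the integral of \<open>w\<close> over one and the same ball \<open>ball x R\<close>,
  to which the Muckenhoupt condition applies. It yields the p-th power of the volume of that ball;
  as \<open>R\<close> is proportional to \<open>s\<close>, this cancels the p-th power of the
  Jacobian \<open>1 / s ^ n\<close>, and the bound is uniform in \<open>s\<close>.\<close>

lemma weighted_average_bound:
  fixes w :: "real^'n \<Rightarrow> real" and f :: "real^'n \<Rightarrow> ennreal"
  assumes p: "1 < p" and w: "Ap_bound p A w" and A: "0 \<le> A" and f [measurable]: "f \<in> borel_measurable borel"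
    and s: "0 < s" "s \<le> 1" and d: "0 < \<delta>" "\<delta> \<le> d" and S: "S \<subseteq> cball z d" and [measurable]: "S \<in> sets borel"
  shows "(\<integral>\<^sup>+y\<in>S. epowr p (\<integral>\<^sup>+x\<in>ball z \<delta>. f (y + s *\<^sub>R (x - y)) \<partial>lborel) * w y \<partial>lborel)
    \<le> ennreal (A * measure lborel (ball z (2 * d)) powr p) * (\<integral>\<^sup>+x. epowr p (f x) * w x \<partial>lborel)"
proof -
  note [measurable] = Ap_boundD(1)[OF w]
  have w0: "w x > 0" for x by (rule Ap_boundD(2)[OF w])
  \<comment> \<open>The centre of \<open>E y\<close> is at most \<open>s * d\<close> away from
    \<open>y\<close>, and the radius is at most \<open>s * d\<close>; so \<open>ball x R\<close>
    contains \<open>y\<close> and all of \<open>E y\<close> for each \<open>x\<close> in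
    \<open>E y\<close>.\<close>
  define R where "R = 2 * s * d"
  define E where "E y = ball ((1 - s) *\<^sub>R y + s *\<^sub>R z) (s * \<delta>)" for y
  define N where "N x = epowr (p - 1) (\<integral>\<^sup>+x'\<in>ball x R. ennreal (w x' powr (1 / (1 - p))) \<partial>lborel)" for x
  define sn where "sn = s ^ CARD('n)"
  have sn: "sn > 0" using s by (simp add: sn_def)
  have R: "R > 0" using s d by (simp add: R_def)
  have [measurable]: "E y \<in> sets borel" for y by (simp add: E_def)
  have N[measurable]: "N \<in> borel_measurable borel"
  proof -
    have "N = (\<lambda>x. epowr (p - 1) (\<integral>\<^sup>+x'. ennreal (w x' powr (1 / (1 - p))) * (if dist x x' < R then 1 else 0) \<partial>lborel))"
      by (auto simp: N_def fun_eq_iff indicator_def intro!: nn_integral_cong arg_cong[of _ _ "epowr (p - 1)"])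
    also have "\<dots> \<in> borel_measurable borel" by measurable
    finally show ?thesis .
  qed
  have sub: "(\<integral>\<^sup>+x\<in>ball z \<delta>. f (y + s *\<^sub>R (x - y)) \<partial>lborel) =
     ennreal (1 / sn) * (\<integral>\<^sup>+x\<in>E y. f x \<partial>lborel)" for y
  proof -
    have "(\<integral>\<^sup>+x\<in>E y. f x \<partial>lborel) = ennreal (\<bar>s\<bar> ^ DIM(real^'n)) *
       (\<integral>\<^sup>+x. f ((1 - s) *\<^sub>R y + s *\<^sub>R x) * indicator (E y) ((1 - s) *\<^sub>R y + s *\<^sub>R x) \<partial>lborel)"
      using s by (intro nn_integral_lborel_affine) auto
    also have "(\<lambda>x. f ((1 - s) *\<^sub>R y + s *\<^sub>R x) * indicator (E y) ((1 - s) *\<^sub>R y + s *\<^sub>R x)) =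
       (\<lambda>x. f (y + s *\<^sub>R (x - y)) * indicator (ball z \<delta>) x)"
    proof (rule ext)
      fix x
      have "dist ((1 - s) *\<^sub>R y + s *\<^sub>R z) ((1 - s) *\<^sub>R y + s *\<^sub>R x) = s * dist z x"
        using s by (simp add: dist_norm flip: scaleR_diff_right)
      then have "(1 - s) *\<^sub>R y + s *\<^sub>R x \<in> E y \<longleftrightarrow> x \<in> ball z \<delta>"
        using s by (simp add: E_def)
      moreover have "(1 - s) *\<^sub>R y + s *\<^sub>R x = y + s *\<^sub>R (x - y)" by (simp add: algebra_simps)
      ultimately show "f ((1 - s) *\<^sub>R y + s *\<^sub>R x) * indicator (E y) ((1 - s) *\<^sub>R y + s *\<^sub>R x) =
         f (y + s *\<^sub>R (x - y)) * indicator (ball z \<delta>) x"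
        by (simp add: indicator_def)
    qed
    finally show ?thesis
      using s sn by (simp add: sn_def mult.assoc[symmetric] flip: ennreal_mult')
  qed
  \<comment> \<open>Enlarging \<open>E y\<close> to \<open>ball x R\<close> turns the dual integral
    into the function \<open>N\<close> of \<open>x\<close> alone, as the exchange of the integrals
    requires.\<close>
  have pt: "epowr p (\<integral>\<^sup>+x\<in>E y. f x \<partial>lborel)
     \<le> (\<integral>\<^sup>+x. epowr p (f x) * w x * N x * (if dist x y < R then 1 else 0) \<partial>lborel)" if y: "y \<in> S" for y
  proof -
    have "epowr p (\<integral>\<^sup>+x\<in>E y. f x \<partial>lborel) \<le>
       (\<integral>\<^sup>+x\<in>E y. epowr p (f x) * w x \<partial>lborel) *
       epowr (p - 1) (\<integral>\<^sup>+x\<in>E y. ennreal (w x powr (1 / (1 - p))) \<partial>lborel)"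
      by (rule weighted_Holder[OF p w]) auto
    also have "\<dots> = (\<integral>\<^sup>+x. epowr p (f x) * w x * indicator (E y) x *
       epowr (p - 1) (\<integral>\<^sup>+x\<in>E y. ennreal (w x powr (1 / (1 - p))) \<partial>lborel) \<partial>lborel)"
      by (subst nn_integral_multc) auto
    also have "\<dots> \<le> (\<integral>\<^sup>+x. epowr p (f x) * w x * N x * (if dist x y < R then 1 else 0) \<partial>lborel)"
    proof (intro nn_integral_mono)
      fix x
      show "epowr p (f x) * w x * indicator (E y) x *
         epowr (p - 1) (\<integral>\<^sup>+x\<in>E y. ennreal (w x powr (1 / (1 - p))) \<partial>lborel)
         \<le> epowr p (f x) * w x * N x * (if dist x y < R then 1 else 0)"
      proof (cases "x \<in> E y")
        case True
        have yz: "dist y z \<le> d" using y S by (auto simp: dist_commute)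
        have "dist ((1 - s) *\<^sub>R y + s *\<^sub>R z) y = s * dist y z"
        proof -
          have "(1 - s) *\<^sub>R y + s *\<^sub>R z - y = s *\<^sub>R (z - y)" by (simp add: algebra_simps)
          then show ?thesis using s by (simp add: dist_norm norm_minus_commute)
        qed
        also have "\<dots> \<le> s * d" using s yz by simp
        finally have 1: "dist ((1 - s) *\<^sub>R y + s *\<^sub>R z) y \<le> s * d" .
        have 2: "dist ((1 - s) *\<^sub>R y + s *\<^sub>R z) x < s * \<delta>" using True by (simp add: E_def)
        have 3: "s * \<delta> \<le> s * d" using s d by simp
        have "dist x y < R"
          using dist_triangle[of x y "(1 - s) *\<^sub>R y + s *\<^sub>R z"] 1 2 3 by (simp add: R_def dist_commute)
        moreover have "E y \<subseteq> ball x R"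
        proof
          fix x' assume "x' \<in> E y"
          then have "dist ((1 - s) *\<^sub>R y + s *\<^sub>R z) x' < s * \<delta>" by (simp add: E_def)
          then show "x' \<in> ball x R"
            using dist_triangle[of x x' "(1 - s) *\<^sub>R y + s *\<^sub>R z"] 2 3 by (simp add: R_def dist_commute)
        qed
        then have "epowr (p - 1) (\<integral>\<^sup>+x\<in>E y. ennreal (w x powr (1 / (1 - p))) \<partial>lborel) \<le> N x"
          unfolding N_def using p
          by (intro epowr_mono nn_integral_mono) (auto simp: indicator_def)
        ultimately show ?thesis using True by (auto intro!: mult_left_mono)
      qed auto
    qed
    finally show ?thesis .
  qed
  have "(\<integral>\<^sup>+y\<in>S. epowr p (\<integral>\<^sup>+x\<in>ball z \<delta>. f (y + s *\<^sub>R (x - y)) \<partial>lborel) * w y \<partial>lborel)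
    \<le> (\<integral>\<^sup>+y. ennreal (1 / sn powr p) *
       ((\<integral>\<^sup>+x. epowr p (f x) * w x * N x * (if dist x y < R then 1 else 0) \<partial>lborel) * w y) \<partial>lborel)"
  proof (intro nn_integral_mono)
    fix y
    show "epowr p (\<integral>\<^sup>+x\<in>ball z \<delta>. f (y + s *\<^sub>R (x - y)) \<partial>lborel) * w y * indicator S y \<le>
      ennreal (1 / sn powr p) *
       ((\<integral>\<^sup>+x. epowr p (f x) * w x * N x * (if dist x y < R then 1 else 0) \<partial>lborel) * w y)"
    proof (cases "y \<in> S")
      case True
      have "1 / sn powr p = (1 / sn) powr p" using sn by (simp add: powr_divide)
      then show ?thesis
        using pt[OF True] True sn unfolding sub epowr_mult
        by (simp add: epowr_ennreal mult.assoc mult_left_mono mult_right_mono)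
    qed simp
  qed
  also have "\<dots> = ennreal (1 / sn powr p) * (\<integral>\<^sup>+y. \<integral>\<^sup>+x.
      epowr p (f x) * w x * N x * (if dist x y < R then 1 else 0) * w y \<partial>lborel \<partial>lborel)"
    by (subst nn_integral_cmult) (auto simp: nn_integral_multc)
  also have "(\<integral>\<^sup>+y. \<integral>\<^sup>+x. epowr p (f x) * w x * N x * (if dist x y < R then 1 else 0) * w y \<partial>lborel \<partial>lborel)
     = (\<integral>\<^sup>+x. \<integral>\<^sup>+y. epowr p (f x) * w x * N x * (if dist x y < R then 1 else 0) * w y \<partial>lborel \<partial>lborel)"
    by (rule lborel_pair.Fubini') measurable
  also have "\<dots> = (\<integral>\<^sup>+x. epowr p (f x) * w x * (N x * (\<integral>\<^sup>+y\<in>ball x R. w y \<partial>lborel)) \<partial>lborel)"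
  proof (intro nn_integral_cong)
    fix x
    have "(\<integral>\<^sup>+y. epowr p (f x) * w x * N x * (if dist x y < R then 1 else 0) * w y \<partial>lborel)
      = (\<integral>\<^sup>+y. (epowr p (f x) * w x * N x) * (ennreal (w y) * indicator (ball x R) y) \<partial>lborel)"
      by (intro nn_integral_cong) (auto simp: indicator_def)
    also have "\<dots> = (epowr p (f x) * w x * N x) * (\<integral>\<^sup>+y\<in>ball x R. w y \<partial>lborel)"
      by (intro nn_integral_cmult borel_measurable_times_ennreal measurable_indicator_ball) measurable
    finally show "(\<integral>\<^sup>+y. epowr p (f x) * w x * N x * (if dist x y < R then 1 else 0) * w y \<partial>lborel) =
      epowr p (f x) * w x * (N x * (\<integral>\<^sup>+y\<in>ball x R. w y \<partial>lborel))" by (simp add: mult.assoc)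
  qed
  also have "\<dots> \<le> (\<integral>\<^sup>+x. epowr p (f x) * w x * ennreal (A * (sn * measure lborel (ball z (2 * d))) powr p) \<partial>lborel)"
  proof (intro nn_integral_mono mult_left_mono)
    fix x :: "real^'n"
    have c: "measure lborel (ball x R) = sn * measure lborel (ball z (2 * d))"
      using s d by (simp add: content_ball R_def sn_def power_mult_distrib ac_simps)
    have "N x * (\<integral>\<^sup>+y\<in>ball x R. w y \<partial>lborel) \<le> ennreal A * epowr p (emeasure lborel (ball x R))"
      using Ap_boundD(3)[OF w R, of x] by (simp add: N_def mult.commute)
    also have "emeasure lborel (ball x R) = ennreal (measure lborel (ball x R))"
      by (rule emeasure_eq_ennreal_measure) (metis emeasure_lborel_ball_finite infinity_ennreal_def less_irrefl)
    also have "ennreal A * epowr p \<dots> = ennreal (A * (sn * measure lborel (ball z (2 * d))) powr p)"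
      using A unfolding c by (subst epowr_ennreal) (use sn in \<open>auto simp: ennreal_mult'\<close>)
    finally show "N x * (\<integral>\<^sup>+y\<in>ball x R. w y \<partial>lborel) \<le> ennreal (A * (sn * measure lborel (ball z (2 * d))) powr p)" .
  qed auto
  also have "\<dots> = ennreal (A * (sn * measure lborel (ball z (2 * d))) powr p) * (\<integral>\<^sup>+x. epowr p (f x) * w x \<partial>lborel)"
    by (subst nn_integral_multc) (auto simp: mult.commute)
  finally have "(\<integral>\<^sup>+y\<in>S. epowr p (\<integral>\<^sup>+x\<in>ball z \<delta>. f (y + s *\<^sub>R (x - y)) \<partial>lborel) * w y \<partial>lborel)
    \<le> ennreal (1 / sn powr p) * (ennreal (A * (sn * measure lborel (ball z (2 * d))) powr p) *
       (\<integral>\<^sup>+x. epowr p (f x) * w x \<partial>lborel))" by (simp add: mult_left_mono)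
  also have "\<dots> = ennreal (A * measure lborel (ball z (2 * d)) powr p) * (\<integral>\<^sup>+x. epowr p (f x) * w x \<partial>lborel)"
    using sn A by (simp add: mult.assoc[symmetric] powr_mult flip: ennreal_mult')
  finally show ?thesis .
qed


text \<open>The function \<open>F\<close> of the overview, not normalized by the volume of the ball.
  The integral over \<open>s\<close> is the outer one because the weighted bound holds for each
  \<open>s\<close> separately.\<close>

definition seg_avg :: "'a \<Rightarrow> real \<Rightarrow> ('a \<Rightarrow> ennreal) \<Rightarrow> 'a::euclidean_space \<Rightarrow> ennreal" where
  "seg_avg z \<delta> f y = (\<integral>\<^sup>+s\<in>{0<..<1}. (\<integral>\<^sup>+x\<in>ball z \<delta>. f (y + s *\<^sub>R (x - y)) \<partial>lborel) \<partial>lborel)"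

lemma measurable_seg_avg [measurable]:
  assumes [measurable]: "f \<in> borel_measurable borel"
  shows "seg_avg z \<delta> f \<in> borel_measurable borel"
  unfolding seg_avg_def by measurable

lemma seg_avg_mono: "(\<And>x. f x \<le> g x) \<Longrightarrow> seg_avg z \<delta> f y \<le> seg_avg z \<delta> g y"
  unfolding seg_avg_def by (intro nn_integral_mono mult_right_mono) auto

lemma seg_avg_add:
  assumes [measurable]: "f \<in> borel_measurable borel" "g \<in> borel_measurable borel"
  shows "seg_avg z \<delta> (\<lambda>x. f x + g x) y = seg_avg z \<delta> f y + seg_avg z \<delta> g y"
  unfolding seg_avg_def by (simp add: distrib_right nn_integral_add)

text \<open>Hoelder's inequality on the unit interval, which has length 1, moves the power inside
  the integral over \<open>s\<close>; then the bound for fixed \<open>s\<close> is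
  integrated.\<close>

lemma seg_avg_weighted_bound:
  fixes w :: "real^'n \<Rightarrow> real" and f :: "real^'n \<Rightarrow> ennreal"
  assumes p: "1 < p" and w: "Ap_bound p A w" and A: "0 \<le> A" and f [measurable]: "f \<in> borel_measurable borel"
    and d: "0 < \<delta>" "\<delta> \<le> d" and S: "S \<subseteq> cball z d" and [measurable]: "S \<in> sets borel"
  shows "(\<integral>\<^sup>+y\<in>S. epowr p (seg_avg z \<delta> f y) * w y \<partial>lborel)
    \<le> ennreal (A * measure lborel (ball z (2 * d)) powr p) * (\<integral>\<^sup>+x. epowr p (f x) * w x \<partial>lborel)"
    (is "_ \<le> ?K")
proof -
  note [measurable] = Ap_boundD(1)[OF w]
  define T where "T s y = (\<integral>\<^sup>+x\<in>ball z \<delta>. f (y + s *\<^sub>R (x - y)) \<partial>lborel)" for s y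
  have T [measurable]: "case_prod T \<in> borel_measurable (lborel \<Otimes>\<^sub>M lborel)"
    unfolding T_def case_prod_unfold by measurable
  have "(\<integral>\<^sup>+y\<in>S. epowr p (seg_avg z \<delta> f y) * w y \<partial>lborel)
    \<le> (\<integral>\<^sup>+y. \<integral>\<^sup>+s. epowr p (T s y) * w y * indicator S y * indicator {0<..<1} s \<partial>lborel \<partial>lborel)"
  proof (intro nn_integral_mono)
    fix y
    have "epowr p (seg_avg z \<delta> f y) =
        epowr p (\<integral>\<^sup>+s. (T s y * indicator {0<..<1} s) * indicator {0<..<1::real} s \<partial>lborel)"
      unfolding seg_avg_def T_def[symmetric]
      by (intro arg_cong[of _ _ "epowr p"] nn_integral_cong) (auto simp: indicator_def)
    also have "\<dots> \<le> (\<integral>\<^sup>+s. epowr p (T s y * indicator {0<..<1} s) \<partial>lborel) *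
       epowr (p - 1) (\<integral>\<^sup>+s. epowr (p / (p - 1)) (indicator {0<..<1::real} s) \<partial>lborel)"
      by (rule nn_integral_Holder[OF p]) measurable
    also have "(\<lambda>s. epowr (p / (p - 1)) (indicator {0<..<1::real} s)) = indicator {0<..<1}"
      by (auto simp: indicator_def fun_eq_iff)
    also have "(\<lambda>s. epowr p (T s y * indicator {0<..<1} s)) = (\<lambda>s. epowr p (T s y) * indicator {0<..<1} s)"
      by (auto simp: indicator_def fun_eq_iff)
    finally have "epowr p (seg_avg z \<delta> f y) \<le> (\<integral>\<^sup>+s. epowr p (T s y) * indicator {0<..<1} s \<partial>lborel)" by simp
    then have "epowr p (seg_avg z \<delta> f y) * (ennreal (w y) * indicator S y) \<le>
       (\<integral>\<^sup>+s. epowr p (T s y) * indicator {0<..<1} s \<partial>lborel) * (ennreal (w y) * indicator S y)"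
      by (rule mult_right_mono) simp
    also have "\<dots> = (\<integral>\<^sup>+s. epowr p (T s y) * indicator {0<..<1} s * (ennreal (w y) * indicator S y) \<partial>lborel)"
      by (rule nn_integral_multc[symmetric]) measurable
    finally show "epowr p (seg_avg z \<delta> f y) * w y * indicator S y \<le>
        (\<integral>\<^sup>+s. epowr p (T s y) * w y * indicator S y * indicator {0<..<1} s \<partial>lborel)"
      by (simp add: ac_simps indicator_def split: if_splits)
  qed
  also have "\<dots> = (\<integral>\<^sup>+s. \<integral>\<^sup>+y. epowr p (T s y) * w y * indicator S y * indicator {0<..<1} s \<partial>lborel \<partial>lborel)"
    by (rule lborel_pair.Fubini') measurable
  also have "\<dots> \<le> (\<integral>\<^sup>+s. ?K * indicator {0<..<1::real} s \<partial>lborel)"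
  proof (intro nn_integral_mono)
    fix s :: real
    show "(\<integral>\<^sup>+y. epowr p (T s y) * w y * indicator S y * indicator {0<..<1} s \<partial>lborel) \<le> ?K * indicator {0<..<1} s"
      using weighted_average_bound[OF p w A f _ _ d S, of s]
      by (auto simp: indicator_def T_def)
  qed
  also have "\<dots> = ?K" by (simp add: nn_integral_cmult)
  finally show ?thesis .
qed

text \<open>Serves to control mollification errors. For \<open>s \<ge> 1 / 2\<close> the
  substitution is made in \<open>x\<close>, with factor \<open>s\<close>, and for smaller
  \<open>s\<close> in \<open>y\<close>, with factor \<open>1 - s\<close>; either way the Jacobian is
  at most \<open>2 ^ DIM('a)\<close>.\<close>

lemma seg_avg_L1_bound:
  fixes f :: "'a::euclidean_space \<Rightarrow> ennreal"
  assumes f [measurable]: "f \<in> borel_measurable borel" and [measurable]: "S \<in> sets borel"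
  shows "(\<integral>\<^sup>+y\<in>S. seg_avg z \<delta> f y \<partial>lborel) \<le>
     ennreal (2 ^ DIM('a)) * (emeasure lborel S + emeasure lborel (ball z \<delta>)) * (\<integral>\<^sup>+x. f x \<partial>lborel)"
     (is "_ \<le> ?K")
proof -
  let ?B = "ball z \<delta>"
  define I where "I = (\<integral>\<^sup>+x. f x \<partial>lborel)"
  have scale: "(\<integral>\<^sup>+x. f (t + c *\<^sub>R x) \<partial>lborel) \<le> ennreal (2 ^ DIM('a)) * I" if "c \<ge> 1 / 2" for c t
  proof -
    have "(1::real) \<le> (2 * \<bar>c\<bar>) ^ DIM('a)" using that by (intro one_le_power) auto
    then have "1 * (\<integral>\<^sup>+x. f (t + c *\<^sub>R x) \<partial>lborel) \<le>
        ennreal ((2 * \<bar>c\<bar>) ^ DIM('a)) * (\<integral>\<^sup>+x. f (t + c *\<^sub>R x) \<partial>lborel)"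
      by (intro mult_right_mono) auto
    also have "\<dots> = ennreal (2 ^ DIM('a)) * (ennreal (\<bar>c\<bar> ^ DIM('a)) * (\<integral>\<^sup>+x. f (t + c *\<^sub>R x) \<partial>lborel))"
      by (simp add: power_mult_distrib ennreal_mult' mult.assoc)
    also have "\<dots> = ennreal (2 ^ DIM('a)) * I"
      unfolding I_def using that by (subst nn_integral_lborel_affine[of f c t]) auto
    finally show ?thesis by simp
  qed
  have "(\<integral>\<^sup>+y\<in>S. seg_avg z \<delta> f y \<partial>lborel) =
    (\<integral>\<^sup>+y. \<integral>\<^sup>+s. indicator S y * indicator {0<..<1} s * (\<integral>\<^sup>+x\<in>?B. f (y + s *\<^sub>R (x - y)) \<partial>lborel) \<partial>lborel \<partial>lborel)"
  proof (intro nn_integral_cong)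
    fix y
    have "seg_avg z \<delta> f y * indicator S y = indicator S y * seg_avg z \<delta> f y" by (rule mult.commute)
    also have "\<dots> = (\<integral>\<^sup>+s. indicator S y *
       ((\<integral>\<^sup>+x\<in>?B. f (y + s *\<^sub>R (x - y)) \<partial>lborel) * indicator {0<..<1} s) \<partial>lborel)"
      unfolding seg_avg_def by (rule nn_integral_cmult[symmetric]) measurable
    finally show "seg_avg z \<delta> f y * indicator S y = (\<integral>\<^sup>+s. indicator S y * indicator {0<..<1} s *
       (\<integral>\<^sup>+x\<in>?B. f (y + s *\<^sub>R (x - y)) \<partial>lborel) \<partial>lborel)"
      by (simp add: ac_simps)
  qed
  also have "\<dots> =
    (\<integral>\<^sup>+s. \<integral>\<^sup>+y. indicator S y * indicator {0<..<1} s * (\<integral>\<^sup>+x\<in>?B. f (y + s *\<^sub>R (x - y)) \<partial>lborel) \<partial>lborel \<partial>lborel)"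
    by (rule lborel_pair.Fubini') measurable
  also have "\<dots> \<le> (\<integral>\<^sup>+s. ?K * indicator {0<..<1::real} s \<partial>lborel)"
  proof (intro nn_integral_mono)
    fix s :: real
    show "(\<integral>\<^sup>+y. indicator S y * indicator {0<..<1} s * (\<integral>\<^sup>+x\<in>?B. f (y + s *\<^sub>R (x - y)) \<partial>lborel) \<partial>lborel)
      \<le> ?K * indicator {0<..<1} s"
    proof (cases "s \<in> {0<..<1}")
      case s: True
      show ?thesis
      proof (cases "s \<ge> 1 / 2")
        case True
        have "(\<integral>\<^sup>+y. indicator S y * indicator {0<..<1} s * (\<integral>\<^sup>+x\<in>?B. f (y + s *\<^sub>R (x - y)) \<partial>lborel) \<partial>lborel)
          \<le> (\<integral>\<^sup>+y. indicator S y * (ennreal (2 ^ DIM('a)) * I) \<partial>lborel)"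
        proof (intro nn_integral_mono)
          fix y
          have "(\<integral>\<^sup>+x\<in>?B. f (y + s *\<^sub>R (x - y)) \<partial>lborel) \<le> (\<integral>\<^sup>+x. f ((y - s *\<^sub>R y) + s *\<^sub>R x) \<partial>lborel)"
            by (intro nn_integral_mono) (auto simp: indicator_def algebra_simps)
          also have "\<dots> \<le> ennreal (2 ^ DIM('a)) * I" by (rule scale) (use True in auto)
          finally show "indicator S y * indicator {0<..<1} s * (\<integral>\<^sup>+x\<in>?B. f (y + s *\<^sub>R (x - y)) \<partial>lborel)
             \<le> indicator S y * (ennreal (2 ^ DIM('a)) * I)"
            using s by (auto simp: indicator_def)
        qed
        also have "\<dots> = ennreal (2 ^ DIM('a)) * emeasure lborel S * I"
          by (subst nn_integral_multc) (auto simp: ac_simps)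
        also have "\<dots> \<le> ?K" unfolding I_def by (intro mult_mono) auto
        finally show ?thesis using s by simp
      next
        case False
        have "(\<integral>\<^sup>+y. indicator S y * indicator {0<..<1} s * (\<integral>\<^sup>+x\<in>?B. f (y + s *\<^sub>R (x - y)) \<partial>lborel) \<partial>lborel)
          \<le> (\<integral>\<^sup>+y. (\<integral>\<^sup>+x\<in>?B. f (y + s *\<^sub>R (x - y)) \<partial>lborel) \<partial>lborel)"
          using s by (intro nn_integral_mono) (auto simp: indicator_def)
        also have "\<dots> = (\<integral>\<^sup>+x. \<integral>\<^sup>+y. f (y + s *\<^sub>R (x - y)) * indicator ?B x \<partial>lborel \<partial>lborel)"
          by (rule lborel_pair.Fubini') measurable
        also have "\<dots> \<le> (\<integral>\<^sup>+x. indicator ?B x * (ennreal (2 ^ DIM('a)) * I) \<partial>lborel)"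
        proof (intro nn_integral_mono)
          fix x
          have "(\<integral>\<^sup>+y. f (y + s *\<^sub>R (x - y)) * indicator ?B x \<partial>lborel) =
             (\<integral>\<^sup>+y. f (s *\<^sub>R x + (1 - s) *\<^sub>R y) \<partial>lborel) * indicator ?B x"
            by (subst nn_integral_multc[symmetric]) (auto simp: algebra_simps)
          also have "\<dots> \<le> (ennreal (2 ^ DIM('a)) * I) * indicator ?B x"
            by (intro mult_right_mono scale) (use False in auto)
          finally show "(\<integral>\<^sup>+y. f (y + s *\<^sub>R (x - y)) * indicator ?B x \<partial>lborel) \<le>
             indicator ?B x * (ennreal (2 ^ DIM('a)) * I)" by (simp add: mult.commute)
        qed
        also have "\<dots> = ennreal (2 ^ DIM('a)) * emeasure lborel ?B * I"
          by (subst nn_integral_multc) (auto simp: ac_simps)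
        also have "\<dots> \<le> ?K" unfolding I_def by (intro mult_mono) auto
        finally show ?thesis using s by simp
      qed
    qed simp
  qed
  also have "\<dots> = ?K" by (simp add: nn_integral_cmult)
  finally show ?thesis .
qed

subsection \<open>Smooth functions and convolutions\<close>

lemma differentiable_has_derivative_partial:
  fixes f :: "real^'n \<Rightarrow> real"
  assumes "f differentiable (at x)"
  shows "(f has_derivative (\<lambda>h. \<Sum>i\<in>UNIV. h $ i * partial_deriv i f x)) (at x)"
proof -
  define L where "L = frechet_derivative f (at x)"
  have L: "(f has_derivative L) (at x)"
    using assms by (simp add: L_def frechet_derivative_works)
  interpret bounded_linear L using L by (rule has_derivative_bounded_linear)
  have "L h = (\<Sum>i\<in>UNIV. h $ i * partial_deriv i f x)" for h
  proof -
    have "L h = L (\<Sum>i\<in>UNIV. h $ i *\<^sub>R axis i 1)"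
      by (simp add: basis_expansion scalar_mult_eq_scaleR[symmetric])
    also have "\<dots> = (\<Sum>i\<in>UNIV. h $ i * L (axis i 1))" by (simp add: sum scaleR)
    finally show ?thesis by (simp add: partial_deriv_def L_def)
  qed
  then show ?thesis using L by (metis (no_types, lifting) ext)
qed

lemma partial_derivI:
  fixes f :: "real^'n \<Rightarrow> real"
  assumes "(f has_derivative L) (at x)"
  shows "partial_deriv i f x = L (axis i 1)"
  using assms by (metis partial_deriv_def frechet_derivative_at)

lemma smooth_partial_derivs: "smooth f \<Longrightarrow> smooth (foldr partial_deriv is f)"
  unfolding smooth_def by (metis foldr_append comp_apply)

lemma smooth_partial_deriv: "smooth f \<Longrightarrow> smooth (partial_deriv i f)"
  using smooth_partial_derivs[of f "[i]"] by simp

lemma smooth_has_derivative: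
  assumes "smooth f"
  shows "(f has_derivative (\<lambda>h. \<Sum>i\<in>UNIV. h $ i * partial_deriv i f x)) (at x)"
proof -
  have "foldr partial_deriv [] f differentiable_on UNIV" using assms unfolding smooth_def by blast
  then have "f differentiable (at x)" by (simp add: differentiable_on_def)
  then show ?thesis by (rule differentiable_has_derivative_partial)
qed

lemma smooth_continuous_on: "smooth f \<Longrightarrow> continuous_on A f"
  by (meson continuous_at_imp_continuous_on has_derivative_continuous smooth_has_derivative)

lemma smooth_borel_measurable: "smooth f \<Longrightarrow> f \<in> borel_measurable borel"
  by (intro borel_measurable_continuous_onI smooth_continuous_on)

lemma smooth_DERIV:
  assumes "smooth f"
  shows "((\<lambda>s. f (a + s *\<^sub>R axis i 1)) has_real_derivative partial_deriv i f (a + s *\<^sub>R axis i 1)) (at s)"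
proof -
  have "((\<lambda>s. f (a + s *\<^sub>R axis i 1)) has_derivative
     (\<lambda>h. \<Sum>j\<in>UNIV. (h *\<^sub>R axis i 1) $ j * partial_deriv j f (a + s *\<^sub>R axis i 1))) (at s)"
    by (rule has_derivative_compose[OF _ smooth_has_derivative[OF assms]])
       (auto intro!: derivative_eq_intros)
  also have "(\<lambda>h. \<Sum>j\<in>UNIV. (h *\<^sub>R axis i 1) $ j * partial_deriv j f (a + s *\<^sub>R axis i 1)) =
     (\<lambda>h. h * partial_deriv i f (a + s *\<^sub>R axis i 1))"
    by (simp add: fun_eq_iff axis_def if_distrib if_distribR sum.delta cong: if_cong)
  finally show ?thesis by (simp add: has_field_derivative_def mult_commute_abs)
qed

text \<open>The left-hand side of the equation is symmetric in \<open>i\<close> and \<open>j\<close>, the right-hand side is not.\<close>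
lemma second_difference:
  assumes f: "smooth f" and t: "0 < t"
  shows "\<exists>a b. 0 < a \<and> a < t \<and> 0 < b \<and> b < t \<and>
    f (x + t *\<^sub>R axis i 1 + t *\<^sub>R axis j 1) - f (x + t *\<^sub>R axis i 1) - f (x + t *\<^sub>R axis j 1) + f x =
    t * t * partial_deriv j (partial_deriv i f) (x + a *\<^sub>R axis i 1 + b *\<^sub>R axis j 1)"
proof -
  define g where "g s = f ((x + t *\<^sub>R axis j 1) + s *\<^sub>R axis i 1) - f (x + s *\<^sub>R axis i 1)" for s
  have "\<exists>a>0. a < t \<and> g t - g 0 = (t - 0) *
     (partial_deriv i f ((x + t *\<^sub>R axis j 1) + a *\<^sub>R axis i 1) - partial_deriv i f (x + a *\<^sub>R axis i 1))"
    using t unfolding g_def by (intro MVT2 DERIV_diff smooth_DERIV f) auto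
  then obtain a where a: "0 < a" "a < t" "g t - g 0 = t *
     (partial_deriv i f ((x + t *\<^sub>R axis j 1) + a *\<^sub>R axis i 1) - partial_deriv i f (x + a *\<^sub>R axis i 1))" by auto
  define y where "y = x + a *\<^sub>R axis i 1"
  have "\<exists>b>0. b < t \<and> partial_deriv i f (y + t *\<^sub>R axis j 1) - partial_deriv i f (y + 0 *\<^sub>R axis j 1)
     = (t - 0) * partial_deriv j (partial_deriv i f) (y + b *\<^sub>R axis j 1)"
    using t by (intro MVT2 smooth_DERIV smooth_partial_deriv f) auto
  then obtain b where "0 < b" "b < t" "partial_deriv i f (y + t *\<^sub>R axis j 1) - partial_deriv i f y
     = t * partial_deriv j (partial_deriv i f) (y + b *\<^sub>R axis j 1)" by auto
  with a show ?thesis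
    by (intro exI[of _ a] exI[of _ b]) (auto simp: g_def y_def algebra_simps)
qed

text \<open>The second difference equals \<open>t * t\<close> times either mixed derivative, each
  taken at some point within \<open>2 * t\<close> of \<open>x\<close>; continuity of both does the
  rest.\<close>

lemma partial_deriv_commute:
  fixes f :: "real^'n \<Rightarrow> real"
  assumes f: "smooth f"
  shows "partial_deriv i (partial_deriv j f) = partial_deriv j (partial_deriv i f)"
proof
  fix x :: "real^'n"
  let ?p = "partial_deriv i (partial_deriv j f)" and ?q = "partial_deriv j (partial_deriv i f)"
  have near: "\<exists>d>0. \<forall>y. dist y x < d \<longrightarrow> \<bar>g y - g x\<bar> < e" if "smooth g" "e > 0" for g e
    using smooth_continuous_on[OF that(1), of UNIV] that(2)
    unfolding continuous_on_iff by (auto simp: dist_real_def)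
  have "\<bar>?p x - ?q x\<bar> \<le> 2 * e" if e: "e > 0" for e
  proof -
    obtain d1 where d1: "d1 > 0" "\<And>y. dist y x < d1 \<Longrightarrow> \<bar>?p y - ?p x\<bar> < e"
      using near[OF smooth_partial_deriv[OF smooth_partial_deriv[OF f]] e] by blast
    obtain d2 where d2: "d2 > 0" "\<And>y. dist y x < d2 \<Longrightarrow> \<bar>?q y - ?q x\<bar> < e"
      using near[OF smooth_partial_deriv[OF smooth_partial_deriv[OF f]] e] by blast
    define t where "t = min d1 d2 / 2"
    have t: "0 < t" "2 * t \<le> d1" "2 * t \<le> d2" using d1 d2 by (auto simp: t_def)
    have dist: "dist (x + a *\<^sub>R axis k 1 + b *\<^sub>R axis l 1) x < 2 * t"
      if "0 < a" "a < t" "0 < b" "b < t" for a b k l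
    proof -
      have "norm (a *\<^sub>R axis k (1::real) + b *\<^sub>R axis l 1) \<le> \<bar>a\<bar> + \<bar>b\<bar>"
        by (rule norm_triangle_le) simp
      then show ?thesis using that by (simp add: dist_norm)
    qed
    obtain a b where ab: "0 < a" "a < t" "0 < b" "b < t" and eq1:
      "f (x + t *\<^sub>R axis i 1 + t *\<^sub>R axis j 1) - f (x + t *\<^sub>R axis i 1) - f (x + t *\<^sub>R axis j 1) + f x =
       t * t * ?q (x + a *\<^sub>R axis i 1 + b *\<^sub>R axis j 1)"
      using second_difference[OF f t(1), of x i j] by blast
    obtain a' b' where ab': "0 < a'" "a' < t" "0 < b'" "b' < t" and eq2:
      "f (x + t *\<^sub>R axis j 1 + t *\<^sub>R axis i 1) - f (x + t *\<^sub>R axis j 1) - f (x + t *\<^sub>R axis i 1) + f x =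
       t * t * ?p (x + a' *\<^sub>R axis j 1 + b' *\<^sub>R axis i 1)"
      using second_difference[OF f t(1), of x j i] by blast
    have "f (x + t *\<^sub>R axis j 1 + t *\<^sub>R axis i 1) = f (x + t *\<^sub>R axis i 1 + t *\<^sub>R axis j 1)"
      by (simp add: algebra_simps)
    with eq1 eq2 have "t * t * ?q (x + a *\<^sub>R axis i 1 + b *\<^sub>R axis j 1) =
       t * t * ?p (x + a' *\<^sub>R axis j 1 + b' *\<^sub>R axis i 1)" by linarith
    then have "?q (x + a *\<^sub>R axis i 1 + b *\<^sub>R axis j 1) = ?p (x + a' *\<^sub>R axis j 1 + b' *\<^sub>R axis i 1)"
      using t by simp
    moreover have "\<bar>?q (x + a *\<^sub>R axis i 1 + b *\<^sub>R axis j 1) - ?q x\<bar> < e"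
      using dist[OF ab, of i j] t by (intro d2) simp
    moreover have "\<bar>?p (x + a' *\<^sub>R axis j 1 + b' *\<^sub>R axis i 1) - ?p x\<bar> < e"
      using dist[OF ab', of j i] t by (intro d1) simp
    ultimately show ?thesis by linarith
  qed
  \<comment> \<open>With \<open>e\<close> a quarter of the difference, the bound makes the
    difference at most half of itself.\<close>
  from this[of "\<bar>?p x - ?q x\<bar> / 4"] show "?p x = ?q x" by (cases "?p x = ?q x") auto
qed

lemma foldr_partial_deriv_move:
  "smooth f \<Longrightarrow> foldr partial_deriv (js @ i # ks) f = partial_deriv i (foldr partial_deriv (js @ ks) f)"
  by (induction js) (auto simp: partial_deriv_commute smooth_partial_derivs simp flip: foldr_append)

lemma foldr_partial_deriv_perm:
  assumes f: "smooth f" and "mset is = mset js"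
  shows "foldr partial_deriv is f = foldr partial_deriv js f"
  using assms(2)
proof (induction "is" arbitrary: js)
  case (Cons i "is")
  then have "i \<in> set js" by (metis list.set_intros(1) mset_eq_setD)
  then obtain js1 js2 where js: "js = js1 @ i # js2" by (meson split_list)
  then have "mset is = mset (js1 @ js2)" using Cons.prems by simp
  then have "foldr partial_deriv is f = foldr partial_deriv (js1 @ js2) f" by (rule Cons.IH)
  then show ?case unfolding js foldr_partial_deriv_move[OF f] by simp
qed simp

text \<open>Makes the choice of a list in \<open>mi_deriv\<close> irrelevant: lists with the same
  counts are permutations of each other.\<close>

lemma mi_deriv_eq:
  assumes "smooth f" "count_list is = \<alpha>"
  shows "mi_deriv \<alpha> f = foldr partial_deriv is f"
proof -
  have "count_list (SOME is. count_list is = \<alpha>) = \<alpha>" using assms(2) by (rule someI)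
  then have "mset (SOME is. count_list is = \<alpha>) = mset is"
    using assms(2) by (intro multiset_eqI) (metis count_mset)
  then show ?thesis unfolding mi_deriv_def by (rule foldr_partial_deriv_perm[OF assms(1)])
qed

lemma ex_count_list: "\<exists>is. count_list is = (\<alpha> :: 'n::finite \<Rightarrow> nat)"
proof -
  obtain "is" where "mset is = Abs_multiset \<alpha>" using ex_mset by blast
  moreover have "count (Abs_multiset \<alpha>) = \<alpha>" by (rule count_Abs_multiset) simp
  ultimately show ?thesis by (metis count_mset ext)
qed

text \<open>The new direction is put last in the list and hence applied first, so that
  \<open>partial_deriv i f\<close> can serve as a test function for the order
  \<open>\<alpha>\<close>.\<close>

lemma mi_deriv_Suc:
  fixes \<alpha> :: "'n::finite \<Rightarrow> nat"
  assumes "smooth f"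
  shows "mi_deriv (\<alpha>(i := Suc (\<alpha> i))) f = mi_deriv \<alpha> (partial_deriv i f)"
proof -
  obtain "is" where "is": "count_list is = \<alpha>" using ex_count_list by blast
  have "count_list (is @ [i]) = \<alpha>(i := Suc (\<alpha> i))" using "is" by (auto simp: fun_eq_iff)
  then show ?thesis
    using mi_deriv_eq[OF assms] mi_deriv_eq[OF smooth_partial_deriv[OF assms] "is"] by fastforce
qed

lemma mi_deriv_0: "smooth f \<Longrightarrow> mi_deriv (\<lambda>_. 0) f = f"
  using mi_deriv_eq[of f "[]" "\<lambda>_. 0"] by (simp add: fun_eq_iff)

lemma foldr_partial_deriv_affine:
  assumes f: "smooth f"
  shows "foldr partial_deriv is (\<lambda>x. f (b + c *\<^sub>R x)) = (\<lambda>x. c ^ length is * foldr partial_deriv is f (b + c *\<^sub>R x))"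
proof (induction "is")
  case (Cons i "is")
  show ?case
  proof
    fix x
    let ?g = "foldr partial_deriv is f"
    have "((\<lambda>x. c ^ length is * ?g (b + c *\<^sub>R x)) has_derivative
      (\<lambda>h. c ^ length is * (\<Sum>i\<in>UNIV. (c *\<^sub>R h) $ i * partial_deriv i ?g (b + c *\<^sub>R x)))) (at x)"
      by (intro has_derivative_mult_right has_derivative_compose[OF _ smooth_has_derivative] smooth_partial_derivs f)
        (auto intro!: derivative_eq_intros)
    from partial_derivI[OF this, of i]
    show "foldr partial_deriv (i # is) (\<lambda>x. f (b + c *\<^sub>R x)) x =
        c ^ length (i # is) * foldr partial_deriv (i # is) f (b + c *\<^sub>R x)"
      by (simp add: Cons.IH axis_def if_distrib if_distribR sum.delta cong: if_cong)
  qed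
qed simp

lemma smooth_affine:
  assumes "smooth f" shows "smooth (\<lambda>x. f (b + c *\<^sub>R x))"
  unfolding smooth_def foldr_partial_deriv_affine[OF assms]
proof (intro allI, unfold differentiable_on_def, intro ballI)
  fix "is" x
  have "((\<lambda>x. c ^ length is * foldr partial_deriv is f (b + c *\<^sub>R x)) has_derivative
      (\<lambda>h. c ^ length is * (\<Sum>i\<in>UNIV. (c *\<^sub>R h) $ i * partial_deriv i (foldr partial_deriv is f) (b + c *\<^sub>R x)))) (at x)"
    by (intro has_derivative_mult_right has_derivative_compose[OF _ smooth_has_derivative] smooth_partial_derivs assms)
      (auto intro!: derivative_eq_intros)
  then show "(\<lambda>x. c ^ length is * foldr partial_deriv is f (b + c *\<^sub>R x)) differentiable at x within UNIV"
    by (auto simp: differentiable_def)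
qed

section \<open>Supports and test functions\<close>

lemma partial_deriv_outside_supp:
  assumes "x \<notin> supp f" shows "partial_deriv i f x = 0"
proof -
  have "((\<lambda>x. 0) has_derivative (\<lambda>h. 0)) (at x)" by simp
  then have "(f has_derivative (\<lambda>h. 0)) (at x)"
  proof (rule has_derivative_transform_within_open)
    show "open (- supp f)" by (simp add: supp_def open_Compl)
    show "x \<in> - supp f" using assms by simp
    fix y assume "y \<in> - supp f"
    then show "0 = f y" using closure_subset by (force simp: supp_def)
  qed
  then show ?thesis by (rule partial_derivI)
qed

lemma supp_partial_deriv: "supp (partial_deriv i f) \<subseteq> supp f"
proof -
  have "{x. partial_deriv i f x \<noteq> 0} \<subseteq> supp f" using partial_deriv_outside_supp by blast
  then show ?thesis unfolding supp_def by (metis closure_closure closure_mono)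
qed

lemma not_in_supp: "x \<notin> supp f \<Longrightarrow> f x = 0"
  using closure_subset by (force simp: supp_def)

lemma test_function_partial_deriv:
  assumes "test_function D \<phi>" shows "test_function D (partial_deriv i \<phi>)"
proof -
  have "compact (supp (partial_deriv i \<phi>))"
    using assms supp_partial_deriv[of i \<phi>]
    by (auto simp: test_function_def compact_eq_bounded_closed supp_def intro: bounded_subset)
  then show ?thesis
    using assms supp_partial_deriv[of i \<phi>] by (auto simp: test_function_def smooth_partial_deriv)
qed

text \<open>These are the mollification kernels, seen as functions of the integration variable
  \<open>x\<close>.\<close>

lemma test_function_scaled:
  fixes \<psi> :: "real^'n \<Rightarrow> real"
  assumes "smooth \<psi>" "supp \<psi> \<subseteq> cball 0 r" "0 < c" "cball y (r / c) \<subseteq> interior D"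
  shows "test_function D (\<lambda>x. \<psi> (c *\<^sub>R (y - x)))"
proof -
  have "smooth (\<lambda>x. \<psi> (c *\<^sub>R y + (- c) *\<^sub>R x))" by (rule smooth_affine) fact
  then have 1: "smooth (\<lambda>x. \<psi> (c *\<^sub>R (y - x)))" by (simp add: scaleR_diff_right)
  have "{x. \<psi> (c *\<^sub>R (y - x)) \<noteq> 0} \<subseteq> cball y (r / c)"
  proof
    fix x assume "x \<in> {x. \<psi> (c *\<^sub>R (y - x)) \<noteq> 0}"
    then have "c *\<^sub>R (y - x) \<in> cball 0 r" using assms(2) not_in_supp by blast
    then show "x \<in> cball y (r / c)" using assms(3) by (simp add: dist_norm pos_le_divide_eq mult.commute)
  qed
  then have 2: "supp (\<lambda>x. \<psi> (c *\<^sub>R (y - x))) \<subseteq> cball y (r / c)"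
    unfolding supp_def by (intro closure_minimal) auto
  then have "compact (supp (\<lambda>x. \<psi> (c *\<^sub>R (y - x))))"
    by (metis bounded_cball bounded_subset closed_closure compact_eq_bounded_closed supp_def)
  then show ?thesis using 1 2 assms(4) by (auto simp: test_function_def)
qed

lemma smooth_compact_supp_bounded:
  assumes "smooth \<phi>" "compact (supp \<phi>)"
  obtains K where "0 \<le> K" "\<And>x. \<bar>\<phi> x\<bar> \<le> K"
proof -
  have "compact (\<phi> ` supp \<phi>)" using assms by (intro compact_continuous_image smooth_continuous_on)
  then obtain K where "\<And>x. x \<in> supp \<phi> \<Longrightarrow> \<bar>\<phi> x\<bar> \<le> K"
    using compact_imp_bounded[of "\<phi> ` supp \<phi>"] unfolding bounded_iff by fastforce
  then have "\<bar>\<phi> x\<bar> \<le> max K 0" for x by (cases "x \<in> supp \<phi>") (force simp: not_in_supp)+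
  then show ?thesis using that[of "max K 0"] by simp
qed

lemma smooth_compact_supp_uniformly_continuous:
  assumes f: "smooth \<phi>" and c: "compact (supp \<phi>)"
  shows "uniformly_continuous_on UNIV \<phi>"
  unfolding uniformly_continuous_on_def
proof (intro allI impI)
  fix e :: real assume e: "e > 0"
  \<comment> \<open>For points at distance less than 1, either both lie in this compact
    neighbourhood of the support, or \<open>\<phi>\<close> vanishes at both.\<close>
  define S where "S = (\<Union>x\<in>supp \<phi>. cball x 1)"
  have "compact S" unfolding S_def using compact_minkowski_sum_cball[OF c] by (simp add: Union_eq)
  then have "uniformly_continuous_on S \<phi>" by (intro compact_uniformly_continuous smooth_continuous_on f)
  then obtain d where d: "d > 0" "\<And>x y. x \<in> S \<Longrightarrow> y \<in> S \<Longrightarrow> dist y x < d \<Longrightarrow> dist (\<phi> y) (\<phi> x) < e"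
    unfolding uniformly_continuous_on_def using e by meson
  have "dist (\<phi> y) (\<phi> x) < e" if "dist y x < min d 1" for x y
  proof (cases "x \<in> supp \<phi> \<or> y \<in> supp \<phi>")
    case True
    then have "x \<in> S \<and> y \<in> S" using that unfolding S_def by (force simp: dist_commute)
    then show ?thesis using d that by simp
  qed (simp add: not_in_supp e)
  then show "\<exists>d>0. \<forall>x\<in>UNIV. \<forall>x'\<in>UNIV. dist x' x < d \<longrightarrow> dist (\<phi> x') (\<phi> x) < e"
    using d by (intro exI[of _ "min d 1"]) auto
qed


section \<open>Derivatives of convolutions\<close>

lemma bounded_mult_integrable:
  fixes u :: "'a \<Rightarrow> real"
  assumes "integrable M u" "g \<in> borel_measurable M" "\<And>x. \<bar>g x\<bar> \<le> K"
  shows "integrable M (\<lambda>x. u x * g x)"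
proof (rule Bochner_Integration.integrable_bound)
  show "integrable M (\<lambda>x. K * u x)" using assms(1) by simp
  show "(\<lambda>x. u x * g x) \<in> borel_measurable M" using assms by measurable
  have "\<bar>g x\<bar> \<le> \<bar>K\<bar>" for x using assms(3)[of x] by linarith
  then show "AE x in M. norm (u x * g x) \<le> norm (K * u x)"
    by (auto simp: abs_mult mult.commute[of "\<bar>K\<bar>"] intro!: mult_left_mono)
qed

lemma convolution_integrable:
  fixes u :: "real^'n \<Rightarrow> real"
  assumes u: "integrable lborel u" and f: "smooth \<phi>" and c: "compact (supp \<phi>)"
  shows "integrable lborel (\<lambda>x. u x * \<phi> (y - x))"
proof -
  obtain K where "\<And>x. \<bar>\<phi> x\<bar> \<le> K" using smooth_compact_supp_bounded[OF f c] by metis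
  moreover note [measurable] = smooth_borel_measurable[OF f]
  ultimately show ?thesis by (intro bounded_mult_integrable[OF u, where K = K]) auto
qed

lemma compact_supp_partial_deriv:
  assumes "compact (supp \<phi>)" shows "compact (supp (partial_deriv i \<phi>))"
  using assms supp_partial_deriv[of i \<phi>]
  by (auto simp: compact_eq_bounded_closed supp_def intro: bounded_subset)

text \<open>The partial derivatives are uniformly continuous, so \<open>d\<close> does not depend on
  \<open>a\<close> and the error can be integrated against an integrable function.\<close>

lemma smooth_uniform_linearization:
  fixes \<phi> :: "real^'n \<Rightarrow> real"
  assumes f: "smooth \<phi>" and c: "compact (supp \<phi>)" and e: "e > 0"
  obtains d where "d > 0"
    "\<And>a b. norm (b - a) < d \<Longrightarrow> \<bar>\<phi> b - \<phi> a - (\<Sum>i\<in>UNIV. (b - a) $ i * partial_deriv i \<phi> a)\<bar> \<le> e * norm (b - a)"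
proof -
  define e' where "e' = e / CARD('n)"
  have e': "e' > 0" using e by (simp add: e'_def)
  have "\<exists>d>0. \<forall>x y. dist y x < d \<longrightarrow> \<bar>partial_deriv i \<phi> y - partial_deriv i \<phi> x\<bar> < e'" for i
    using smooth_compact_supp_uniformly_continuous[OF smooth_partial_deriv[OF f] compact_supp_partial_deriv[OF c], of i] e'
    unfolding uniformly_continuous_on_def dist_real_def by blast
  then obtain D where D: "\<And>i. D i > 0"
    "\<And>i x y. dist y x < D i \<Longrightarrow> \<bar>partial_deriv i \<phi> y - partial_deriv i \<phi> x\<bar> < e'" by metis
  define d where "d = Min (range D)"
  have d: "d > 0" "d \<le> D i" for i using D by (auto simp: d_def)
  show thesis
  proof (rule that[OF d(1)])
    fix a b :: "real^'n" assume ab: "norm (b - a) < d"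
    let ?L = "\<lambda>x h. \<Sum>i\<in>UNIV. h $ i * partial_deriv i \<phi> x"
    have "norm (\<phi> b - \<phi> a - ?L a (b - a)) \<le> norm (b - a) * e"
    proof (rule differentiable_bound_linearization[where S = "ball a d" and f' = ?L])
      fix t :: real assume t: "t \<in> {0..1}"
      have "norm (t *\<^sub>R (b - a)) \<le> norm (b - a)" using t by (simp add: mult_left_le_one_le)
      then show "a + t *\<^sub>R (b - a) \<in> ball a d" using ab by (simp add: dist_norm)
    next
      fix x assume x: "x \<in> ball a d"
      show "(\<phi> has_derivative ?L x) (at x within ball a d)"
        by (rule has_derivative_at_withinI[OF smooth_has_derivative[OF f]])
      show "onorm (?L x - ?L a) \<le> e"
      proof (rule onorm_le)
        fix h :: "real^'n"
        have "norm ((?L x - ?L a) h) = \<bar>\<Sum>i\<in>UNIV. h $ i * (partial_deriv i \<phi> x - partial_deriv i \<phi> a)\<bar>"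
          by (simp add: sum_subtractf algebra_simps)
        also have "\<dots> \<le> (\<Sum>i\<in>UNIV. \<bar>h $ i * (partial_deriv i \<phi> x - partial_deriv i \<phi> a)\<bar>)" by (rule sum_abs)
        also have "\<dots> \<le> (\<Sum>i\<in>(UNIV::'n set). norm h * e')"
        proof (rule sum_mono)
          fix i
          have "dist x a < D i" using x d(2)[of i] by (auto simp: dist_commute)
          then have "\<bar>partial_deriv i \<phi> x - partial_deriv i \<phi> a\<bar> \<le> e'" using D(2) by (simp add: less_imp_le)
          then show "\<bar>h $ i * (partial_deriv i \<phi> x - partial_deriv i \<phi> a)\<bar> \<le> norm h * e'"
            unfolding abs_mult by (intro mult_mono component_le_norm_cart) auto
        qed
        also have "\<dots> = e * norm h" by (simp add: e'_def)
        finally show "norm ((?L x - ?L a) h) \<le> e * norm h" .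
      qed
    qed (use d in auto)
    then show "\<bar>\<phi> b - \<phi> a - ?L a (b - a)\<bar> \<le> e * norm (b - a)" by (simp add: mult.commute)
  qed
qed

text \<open>\<open>u\<close> is merely integrable, so the derivative falls on the kernel; the
  uniform linearization error is multiplied by the L1 norm \<open>I\<close> of
  \<open>u\<close>.\<close>

lemma convolution_has_derivative:
  fixes u :: "real^'n \<Rightarrow> real"
  assumes u: "integrable lborel u" and f: "smooth \<phi>" and c: "compact (supp \<phi>)"
  shows "((\<lambda>y. \<integral>x. u x * \<phi> (y - x) \<partial>lborel) has_derivative
     (\<lambda>h. \<Sum>i\<in>UNIV. h $ i * (\<integral>x. u x * partial_deriv i \<phi> (y - x) \<partial>lborel))) (at y)"
  unfolding has_derivative_at_alt
proof (intro conjI allI impI)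
  show "bounded_linear (\<lambda>h. \<Sum>i\<in>UNIV. h $ i * (\<integral>x. u x * partial_deriv i \<phi> (y - x) \<partial>lborel))"
    by (intro bounded_linear_sum bounded_linear_mult_const bounded_linear_vec_nth)
  fix e :: real assume e: "e > 0"
  define I where "I = (\<integral>x. \<bar>u x\<bar> \<partial>lborel)"
  have I: "I \<ge> 0" by (simp add: I_def)
  define e' where "e' = e / (I + 1)"
  have e': "e' > 0" using e I by (simp add: e'_def)
  obtain d where d: "d > 0"
    "\<And>a b. norm (b - a) < d \<Longrightarrow> \<bar>\<phi> b - \<phi> a - (\<Sum>i\<in>UNIV. (b - a) $ i * partial_deriv i \<phi> a)\<bar> \<le> e' * norm (b - a)"
    by (rule smooth_uniform_linearization[OF f c e']) blast
  note i1 = convolution_integrable[OF u f c]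
  note i2 = convolution_integrable[OF u smooth_partial_deriv[OF f] compact_supp_partial_deriv[OF c]]
  show "\<exists>d>0. \<forall>y'. norm (y' - y) < d \<longrightarrow>
     norm ((\<integral>x. u x * \<phi> (y' - x) \<partial>lborel) - (\<integral>x. u x * \<phi> (y - x) \<partial>lborel)
       - (\<Sum>i\<in>UNIV. (y' - y) $ i * (\<integral>x. u x * partial_deriv i \<phi> (y - x) \<partial>lborel))) \<le> e * norm (y' - y)"
  proof (intro exI[of _ d] conjI allI impI d(1))
    fix y' assume y': "norm (y' - y) < d"
    let ?R = "\<lambda>x. u x * (\<phi> (y' - x) - \<phi> (y - x) - (\<Sum>i\<in>UNIV. (y' - y) $ i * partial_deriv i \<phi> (y - x)))"
    have R: "?R = (\<lambda>x. u x * \<phi> (y' - x) - u x * \<phi> (y - x) - (\<Sum>i\<in>UNIV. (y' - y) $ i * (u x * partial_deriv i \<phi> (y - x))))"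
      by (simp add: fun_eq_iff algebra_simps sum_distrib_left)
    have iR: "integrable lborel ?R"
      unfolding R by (intro Bochner_Integration.integrable_diff Bochner_Integration.integrable_sum i1 i2
        Bochner_Integration.integrable_mult_right)
    have "(\<integral>x. u x * \<phi> (y' - x) \<partial>lborel) - (\<integral>x. u x * \<phi> (y - x) \<partial>lborel)
       - (\<Sum>i\<in>UNIV. (y' - y) $ i * (\<integral>x. u x * partial_deriv i \<phi> (y - x) \<partial>lborel)) = (\<integral>x. ?R x \<partial>lborel)"
      unfolding R by (simp add: i1 i2 Bochner_Integration.integrable_sum)
    also have "norm \<dots> \<le> (\<integral>x. e' * norm (y' - y) * \<bar>u x\<bar> \<partial>lborel)"
    proof (rule order_trans[OF integral_norm_bound], rule integral_mono)
      show "integrable lborel (\<lambda>x. norm (?R x))" using iR by (rule integrable_norm)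
      show "integrable lborel (\<lambda>x. e' * norm (y' - y) * \<bar>u x\<bar>)" using u by simp
      fix x
      have "\<bar>\<phi> (y' - x) - \<phi> (y - x) - (\<Sum>i\<in>UNIV. (y' - y) $ i * partial_deriv i \<phi> (y - x))\<bar> \<le> e' * norm (y' - y)"
        using d(2)[of "y' - x" "y - x"] y' by (simp add: algebra_simps)
      then show "norm (?R x) \<le> e' * norm (y' - y) * \<bar>u x\<bar>"
        by (simp add: abs_mult mult.commute mult_left_mono)
    qed
    also have "\<dots> = (e' * I) * norm (y' - y)" by (simp add: I_def ac_simps)
    also have "\<dots> \<le> e * norm (y' - y)"
      using e I by (intro mult_right_mono) (auto simp: e'_def field_simps)
    finally show "norm ((\<integral>x. u x * \<phi> (y' - x) \<partial>lborel) - (\<integral>x. u x * \<phi> (y - x) \<partial>lborel)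
       - (\<Sum>i\<in>UNIV. (y' - y) $ i * (\<integral>x. u x * partial_deriv i \<phi> (y - x) \<partial>lborel))) \<le> e * norm (y' - y)" .
  qed
qed

section \<open>Continuity of translations in L1\<close>

lemma nn_integral_lborel_translate:
  fixes g :: "'a::euclidean_space \<Rightarrow> ennreal"
  assumes "g \<in> borel_measurable borel"
  shows "(\<integral>\<^sup>+x. g (x + h) \<partial>lborel) = (\<integral>\<^sup>+x. g x \<partial>lborel)"
  using nn_integral_lborel_affine[OF assms, of 1 h] by (simp add: add.commute)

text \<open>A closed set that approximates \<open>A\<close> from inside is cut off by large balls;
  as the measure is finite, the part outside the balls tends to measure 0.\<close>

lemma lborel_inner_compact:
  fixes A :: "'a::euclidean_space set"
  assumes A [measurable]: "A \<in> sets borel" and fin: "emeasure lborel A < \<infinity>" and e: "e > (0::real)"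
  obtains K where "compact K" "K \<subseteq> A" "emeasure lborel (A - K) < ennreal e"
proof -
  have "A \<in> sets lebesgue" by simp
  then obtain T where T: "closed T" "T \<subseteq> A" "emeasure lebesgue (A - T) < ennreal (e / 2)"
    by (rule sets_lebesgue_inner_closed[of A "e / 2"]) (use e in auto)
  have [measurable]: "T \<in> sets borel" using T by simp
  have AT: "emeasure lborel (A - T) < ennreal (e / 2)" using T(3) by simp
  define F where "F n = T - cball 0 (real n)" for n
  have "(\<lambda>n. emeasure lborel (F n)) \<longlonglongrightarrow> emeasure lborel (\<Inter>n. F n)"
  proof (rule Lim_emeasure_decseq)
    show "range F \<subseteq> sets lborel" by (auto simp: F_def)
    show "decseq F" by (auto simp: decseq_def F_def)
    have "emeasure lborel (F n) \<le> emeasure lborel A" for n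
      using T by (intro emeasure_mono) (auto simp: F_def)
    then show "emeasure lborel (F n) \<noteq> \<infinity>" for n using fin by (metis infinity_ennreal_def leD)
  qed
  moreover have "(\<Inter>n. F n) = {}"
  proof -
    have "\<exists>n. x \<notin> F n" for x
      using real_arch_simple[of "norm x"] by (auto simp: F_def)
    then show ?thesis by blast
  qed
  ultimately have "(\<lambda>n. emeasure lborel (F n)) \<longlonglongrightarrow> 0" by simp
  then have "eventually (\<lambda>n. emeasure lborel (F n) < ennreal (e / 2)) sequentially"
    using e by (intro order_tendstoD) auto
  then obtain n where n: "emeasure lborel (F n) < ennreal (e / 2)" by (auto simp: eventually_sequentially)
  show thesis
  proof
    show "compact (T \<inter> cball 0 (real n))" using T by (simp add: closed_Int_compact)
    show "T \<inter> cball 0 (real n) \<subseteq> A" using T by auto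
    have "A - T \<inter> cball 0 (real n) = (A - T) \<union> F n" using T by (auto simp: F_def)
    also have "emeasure lborel \<dots> \<le> emeasure lborel (A - T) + emeasure lborel (F n)"
      by (intro emeasure_subadditive) (auto simp: F_def)
    also have "\<dots> < ennreal (e / 2) + ennreal (e / 2)"
      using AT n by (intro add_strict_mono) auto
    also have "\<dots> = ennreal e" using e by (simp flip: ennreal_plus)
    finally show "emeasure lborel (A - T \<inter> cball 0 (real n)) < ennreal e" .
  qed
qed

lemma continuous_translation_L1:
  fixes u :: "'a::euclidean_space \<Rightarrow> real"
  assumes "integrable lborel u"
  shows "\<forall>e>0. \<exists>d>0. \<forall>h. norm h < d \<longrightarrow> (\<integral>\<^sup>+y. ennreal \<bar>u (y + h) - u y\<bar> \<partial>lborel) \<le> ennreal e"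
  using assms
proof (induction u rule: integrable_induct)
  case (base A c)
  then have A [measurable]: "A \<in> sets borel" by simp
  show ?case
  proof (intro allI impI)
    fix e :: real assume e: "e > 0"
    \<comment> \<open>The 4 counts \<open>U - K\<close> and its translate, each of measure at most
      \<open>2 * e'\<close>; the 1 guards against \<open>c = 0\<close>.\<close>
    define e' where "e' = e / (4 * (\<bar>c\<bar> + 1))"
    have e': "e' > 0" using e by (simp add: e'_def)
    obtain U where U: "open U" "A \<subseteq> U" "emeasure lborel (U - A) < ennreal e'"
      using outer_regular_lborel[OF A e'] by blast
    obtain K where K: "compact K" "K \<subseteq> A" "emeasure lborel (A - K) < ennreal e'"
      using lborel_inner_compact[OF A _ e'] base by auto
    obtain d where d: "d > 0" "(\<Union>x\<in>K. cball x d) \<subseteq> U"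
      using compact_subset_open_imp_cball_epsilon_subset[OF K(1) U(1)] K U by (metis order_trans)
    have [measurable]: "U - K \<in> sets borel" using U K by (simp add: sets.Diff borel_open borel_compact)
    have UK: "emeasure lborel (U - K) \<le> ennreal (2 * e')"
    proof -
      have "U - K = (U - A) \<union> (A - K)" using U K by auto
      also have "emeasure lborel \<dots> \<le> emeasure lborel (U - A) + emeasure lborel (A - K)"
        using U K A by (intro emeasure_subadditive) (auto simp: borel_open borel_compact)
      also have "\<dots> \<le> ennreal e' + ennreal e'" using U K by (intro add_mono) auto
      finally show ?thesis using e' by (simp flip: ennreal_plus)
    qed
    show "\<exists>d>0. \<forall>h. norm h < d \<longrightarrow>
      (\<integral>\<^sup>+y. ennreal \<bar>indicator A (y + h) *\<^sub>R c - indicator A y *\<^sub>R c\<bar> \<partial>lborel) \<le> ennreal e"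
    proof (intro exI[of _ d] conjI allI impI d(1))
      fix h :: 'a assume h: "norm h < d"
      have "(\<integral>\<^sup>+y. ennreal \<bar>indicator A (y + h) *\<^sub>R c - indicator A y *\<^sub>R c\<bar> \<partial>lborel) \<le>
        (\<integral>\<^sup>+y. ennreal \<bar>c\<bar> * (indicator (U - K) y + indicator (U - K) (y + h)) \<partial>lborel)"
      proof (rule nn_integral_mono)
        fix y
        \<comment> \<open>A translation too short to lead from \<open>K\<close> out of
          \<open>U\<close> changes membership in \<open>A\<close> only for points that lie, or whose
          images lie, in \<open>U - K\<close>.\<close>
        have "y + h \<in> U" if "y \<in> K" using d(2) h that by (force simp: dist_norm)
        moreover have "y \<in> U" if "y + h \<in> K" using d(2) h that by (force simp: dist_norm)
        ultimately have in_diff: "y \<in> U - K \<or> y + h \<in> U - K" if "(y \<in> A) \<noteq> (y + h \<in> A)"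
          using K(2) U(2) that by blast
        show "ennreal \<bar>indicator A (y + h) *\<^sub>R c - indicator A y *\<^sub>R c\<bar> \<le>
          ennreal \<bar>c\<bar> * (indicator (U - K) y + indicator (U - K) (y + h))"
        proof (cases "(y \<in> A) = (y + h \<in> A)")
          case True
          then show ?thesis by (simp add: indicator_def)
        next
          case False
          then have "(1::ennreal) \<le> indicator (U - K) y + indicator (U - K) (y + h)"
            using in_diff by (auto simp: indicator_def)
          then have "ennreal \<bar>c\<bar> * 1 \<le> ennreal \<bar>c\<bar> * (indicator (U - K) y + indicator (U - K) (y + h))"
            by (rule mult_left_mono) simp
          then show ?thesis using False by (auto simp: indicator_def)
        qed
      qed
      also have "\<dots> = ennreal \<bar>c\<bar> * (emeasure lborel (U - K) + emeasure lborel (U - K))"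
        by (subst nn_integral_cmult, measurable, subst nn_integral_add, measurable,
            subst nn_integral_lborel_translate[of "indicator (U - K)" h]) auto
      also have "\<dots> \<le> ennreal \<bar>c\<bar> * (ennreal (2 * e') + ennreal (2 * e'))"
        by (intro mult_left_mono add_mono UK) auto
      also have "\<dots> = ennreal (\<bar>c\<bar> * (4 * e'))" proof -
        have "ennreal (2 * e') + ennreal (2 * e') = ennreal (4 * e')" using e' by (simp flip: ennreal_plus)
        then show ?thesis using e' by (simp only: ennreal_mult'[symmetric] abs_ge_zero)
      qed
      also have "\<dots> \<le> ennreal e" using e by (intro ennreal_leI) (auto simp: e'_def field_simps)
      finally show "(\<integral>\<^sup>+y. ennreal \<bar>indicator A (y + h) *\<^sub>R c - indicator A y *\<^sub>R c\<bar> \<partial>lborel) \<le> ennreal e" .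
    qed
  qed
next
  case (add f g)
  have [measurable]: "f \<in> borel_measurable borel" "g \<in> borel_measurable borel"
    using add.hyps by auto
  show ?case
  proof (intro allI impI)
    fix e :: real assume e: "e > 0"
    then have e2: "e / 2 > 0" by simp
    obtain d1 where d1: "d1 > 0"
      "\<And>h. norm h < d1 \<Longrightarrow> (\<integral>\<^sup>+y. ennreal \<bar>f (y + h) - f y\<bar> \<partial>lborel) \<le> ennreal (e / 2)"
      using add.IH(1)[rule_format, OF e2] by blast
    obtain d2 where d2: "d2 > 0"
      "\<And>h. norm h < d2 \<Longrightarrow> (\<integral>\<^sup>+y. ennreal \<bar>g (y + h) - g y\<bar> \<partial>lborel) \<le> ennreal (e / 2)"
      using add.IH(2)[rule_format, OF e2] by blast
    show "\<exists>d>0. \<forall>h. norm h < d \<longrightarrow> (\<integral>\<^sup>+y. ennreal \<bar>f (y + h) + g (y + h) - (f y + g y)\<bar> \<partial>lborel) \<le> ennreal e"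
    proof (intro exI[of _ "min d1 d2"] conjI allI impI)
      fix h :: 'a assume h: "norm h < min d1 d2"
      have "(\<integral>\<^sup>+y. ennreal \<bar>f (y + h) + g (y + h) - (f y + g y)\<bar> \<partial>lborel) \<le>
        (\<integral>\<^sup>+y. ennreal \<bar>f (y + h) - f y\<bar> + ennreal \<bar>g (y + h) - g y\<bar> \<partial>lborel)"
        by (intro nn_integral_mono) (auto simp flip: ennreal_plus intro!: ennreal_leI)
      also have "\<dots> \<le> ennreal (e / 2) + ennreal (e / 2)"
        using h by (subst nn_integral_add) (auto intro!: add_mono d1 d2)
      finally show "(\<integral>\<^sup>+y. ennreal \<bar>f (y + h) + g (y + h) - (f y + g y)\<bar> \<partial>lborel) \<le> ennreal e"
        using e by (simp flip: ennreal_plus)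
    qed (use d1 d2 in auto)
  qed
next
  case (lim f s)
  have [measurable]: "f \<in> borel_measurable borel" "s i \<in> borel_measurable borel" for i
    using lim.hyps by auto
  show ?case
  proof (intro allI impI)
    fix e :: real assume e: "e > 0"
    have "(\<lambda>i. \<integral>\<^sup>+x. ennreal (norm (f x - s i x)) \<partial>lborel) \<longlonglongrightarrow> 0"
    proof (rule nn_integral_dominated_convergence_norm[where w = "\<lambda>x. 2 * norm (f x)"])
      show "(\<integral>\<^sup>+x. ennreal (2 * norm (f x)) \<partial>lborel) < \<infinity>"
        using lim.hyps(4) by (simp add: integrable_iff_bounded ennreal_mult' nn_integral_cmult ennreal_mult_less_top)
    qed (use lim.hyps in auto)
    then have "eventually (\<lambda>i. (\<integral>\<^sup>+x. ennreal (norm (f x - s i x)) \<partial>lborel) < ennreal (e / 3)) sequentially"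
      using e by (intro order_tendstoD) auto
    then obtain i where i: "(\<integral>\<^sup>+x. ennreal \<bar>f x - s i x\<bar> \<partial>lborel) < ennreal (e / 3)"
      by (auto simp: eventually_sequentially)
    obtain d where d: "d > 0"
      "\<And>h. norm h < d \<Longrightarrow> (\<integral>\<^sup>+y. ennreal \<bar>s i (y + h) - s i y\<bar> \<partial>lborel) \<le> ennreal (e / 3)"
      using lim.IH[of i, rule_format, of "e / 3"] e by auto
    show "\<exists>d>0. \<forall>h. norm h < d \<longrightarrow> (\<integral>\<^sup>+y. ennreal \<bar>f (y + h) - f y\<bar> \<partial>lborel) \<le> ennreal e"
    proof (intro exI[of _ d] conjI allI impI d(1))
      fix h :: 'a assume h: "norm h < d"
      have "(\<integral>\<^sup>+y. ennreal \<bar>f (y + h) - f y\<bar> \<partial>lborel) \<le>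
        (\<integral>\<^sup>+y. ennreal \<bar>f (y + h) - s i (y + h)\<bar> + ennreal \<bar>s i (y + h) - s i y\<bar> + ennreal \<bar>f y - s i y\<bar> \<partial>lborel)"
        by (intro nn_integral_mono) (auto simp flip: ennreal_plus intro!: ennreal_leI)
      also have "\<dots> = (\<integral>\<^sup>+y. ennreal \<bar>f (y + h) - s i (y + h)\<bar> \<partial>lborel) +
         (\<integral>\<^sup>+y. ennreal \<bar>s i (y + h) - s i y\<bar> \<partial>lborel) + (\<integral>\<^sup>+y. ennreal \<bar>f y - s i y\<bar> \<partial>lborel)"
        by (simp add: nn_integral_add)
      also have "(\<integral>\<^sup>+y. ennreal \<bar>f (y + h) - s i (y + h)\<bar> \<partial>lborel) = (\<integral>\<^sup>+y. ennreal \<bar>f y - s i y\<bar> \<partial>lborel)"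
        by (rule nn_integral_lborel_translate) measurable
      also have "(\<integral>\<^sup>+y. ennreal \<bar>f y - s i y\<bar> \<partial>lborel) + (\<integral>\<^sup>+y. ennreal \<bar>s i (y + h) - s i y\<bar> \<partial>lborel)
         + (\<integral>\<^sup>+y. ennreal \<bar>f y - s i y\<bar> \<partial>lborel) \<le> ennreal (e / 3) + ennreal (e / 3) + ennreal (e / 3)"
        using i d(2)[OF h] by (intro add_mono) auto
      also have "\<dots> = ennreal e" using e by (simp flip: ennreal_plus)
      finally show "(\<integral>\<^sup>+y. ennreal \<bar>f (y + h) - f y\<bar> \<partial>lborel) \<le> ennreal e" .
    qed
  qed
qed

subsection \<open>Mollification and uniqueness of weak derivatives\<close>

lemma integral_lborel_affine:
  fixes g :: "'a::euclidean_space \<Rightarrow> real"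
  assumes [measurable]: "g \<in> borel_measurable borel" and "c \<noteq> 0"
  shows "(\<integral>x. g x \<partial>lborel) = \<bar>c\<bar> ^ DIM('a) * (\<integral>x. g (t + c *\<^sub>R x) \<partial>lborel)"
  by (subst lborel_affine[OF assms(2), of t]) (simp add: integral_density integral_distr)

text \<open>\<open>c\<close> is inverse to the mollification radius. \<open>\<psi>\<close> may
  change sign, so this is not a mean in the strict sense, and the error estimates involve
  \<open>\<bar>\<psi>\<bar>\<close>.\<close>

definition mollify :: "(real^'n \<Rightarrow> real) \<Rightarrow> real \<Rightarrow> (real^'n \<Rightarrow> real) \<Rightarrow> real^'n \<Rightarrow> real" where
  "mollify \<psi> c u y = (\<integral>x. u x * (c ^ CARD('n) * \<psi> (c *\<^sub>R (y - x))) \<partial>lborel)"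

lemma integral_one_integrable: "(\<integral>x. f x \<partial>M) = (1::real) \<Longrightarrow> integrable M f"
  by (metis not_integrable_integral_eq zero_neq_one)

lemma mollify_eq_average:
  fixes \<psi> :: "real^'n \<Rightarrow> real"
  assumes [measurable]: "\<psi> \<in> borel_measurable borel" "u \<in> borel_measurable borel" and c: "c > 0"
  shows "mollify \<psi> c u y = (\<integral>t. \<psi> t * u (y + (- 1 / c) *\<^sub>R t) \<partial>lborel)"
proof -
  have "mollify \<psi> c u y = \<bar>- 1 / c\<bar> ^ DIM(real^'n) * (\<integral>t. u (y + (- 1 / c) *\<^sub>R t) *
      (c ^ CARD('n) * \<psi> (c *\<^sub>R (y - (y + (- 1 / c) *\<^sub>R t)))) \<partial>lborel)"
    unfolding mollify_def by (rule integral_lborel_affine) (use c in auto)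
  also have "\<dots> = (\<integral>t. \<psi> t * u (y + (- 1 / c) *\<^sub>R t) \<partial>lborel)"
    unfolding integral_mult_right_zero[symmetric]
    using c by (intro Bochner_Integration.integral_cong) (auto simp: power_divide)
  finally show ?thesis .
qed

lemma measurable_mollify [measurable]:
  fixes \<psi> :: "real^'n \<Rightarrow> real"
  assumes [measurable]: "\<psi> \<in> borel_measurable borel" "u \<in> borel_measurable borel"
  shows "mollify \<psi> c u \<in> borel_measurable borel"
  unfolding mollify_def by measurable

lemma mollify_minus_bound:
  fixes \<psi> :: "real^'n \<Rightarrow> real"
  assumes \<psi>: "\<psi> \<in> borel_measurable borel" "(\<integral>x. \<psi> x \<partial>lborel) = 1" and K: "\<And>x. \<bar>\<psi> x\<bar> \<le> K"
    and u: "integrable lborel u" and c: "c > 0"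
  shows "ennreal \<bar>mollify \<psi> c u y - u y\<bar> \<le> (\<integral>\<^sup>+t. ennreal (\<bar>\<psi> t\<bar> * \<bar>u (y + (- 1 / c) *\<^sub>R t) - u y\<bar>) \<partial>lborel)"
proof -
  have [measurable]: "\<psi> \<in> borel_measurable borel" "u \<in> borel_measurable borel" using \<psi> u by auto
  have i: "integrable lborel \<psi>" by (rule integral_one_integrable) fact
  have "integrable lborel (\<lambda>t. u (y + (- 1 / c) *\<^sub>R t))"
    unfolding integrable_iff_bounded
  proof
    have "(\<integral>\<^sup>+t. ennreal (norm (u t)) \<partial>lborel) = ennreal (\<bar>- 1 / c\<bar> ^ DIM(real^'n)) *
        (\<integral>\<^sup>+t. ennreal (norm (u (y + (- 1 / c) *\<^sub>R t))) \<partial>lborel)"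
      by (rule nn_integral_lborel_affine) (use c in auto)
    moreover have "(\<integral>\<^sup>+t. ennreal (norm (u t)) \<partial>lborel) < \<infinity>" using u by (simp add: integrable_iff_bounded)
    ultimately show "(\<integral>\<^sup>+t. ennreal (norm (u (y + (- 1 / c) *\<^sub>R t))) \<partial>lborel) < \<infinity>"
      using c by (auto simp: ennreal_mult_less_top)
  qed measurable
  from bounded_mult_integrable[OF this, of \<psi> K] \<psi> K
  have i2: "integrable lborel (\<lambda>t. \<psi> t * u (y + (- 1 / c) *\<^sub>R t))" by (simp add: mult.commute)
  have "mollify \<psi> c u y - u y = (\<integral>t. \<psi> t * u (y + (- 1 / c) *\<^sub>R t) \<partial>lborel) - (\<integral>t. \<psi> t * u y \<partial>lborel)"
    using \<psi>(2) by (simp add: mollify_eq_average c)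
  also have "\<dots> = (\<integral>t. \<psi> t * u (y + (- 1 / c) *\<^sub>R t) - \<psi> t * u y \<partial>lborel)"
    by (rule Bochner_Integration.integral_diff[symmetric]) (use i i2 in auto)
  finally have "ennreal \<bar>mollify \<psi> c u y - u y\<bar> =
     ennreal (norm (\<integral>t. \<psi> t * u (y + (- 1 / c) *\<^sub>R t) - \<psi> t * u y \<partial>lborel))" by simp
  also have "\<dots> \<le> (\<integral>\<^sup>+t. ennreal (norm (\<psi> t * u (y + (- 1 / c) *\<^sub>R t) - \<psi> t * u y)) \<partial>lborel)"
    by (rule integral_norm_bound_ennreal) (use i i2 in auto)
  also have "\<dots> = (\<integral>\<^sup>+t. ennreal (\<bar>\<psi> t\<bar> * \<bar>u (y + (- 1 / c) *\<^sub>R t) - u y\<bar>) \<partial>lborel)"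
    by (intro nn_integral_cong) (auto simp flip: right_diff_distrib abs_mult)
  finally show ?thesis .
qed

text \<open>The error is dominated by an integral of translation errors against
  \<open>\<bar>\<psi>\<bar>\<close>; for \<open>c \<ge> c0\<close> all translations that occur are
  shorter than \<open>d\<close>.\<close>

lemma mollify_L1:
  fixes \<psi> :: "real^'n \<Rightarrow> real"
  assumes \<psi>: "\<psi> \<in> borel_measurable borel" "(\<integral>x. \<psi> x \<partial>lborel) = 1" and K: "\<And>x. \<bar>\<psi> x\<bar> \<le> K"
    and supp: "supp \<psi> \<subseteq> cball 0 r" and u: "integrable lborel u" and e: "e > 0"
  shows "\<exists>c0>0. \<forall>c\<ge>c0. (\<integral>\<^sup>+y. ennreal \<bar>mollify \<psi> c u y - u y\<bar> \<partial>lborel) \<le> ennreal e"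
proof -
  have [measurable]: "\<psi> \<in> borel_measurable borel" "u \<in> borel_measurable borel" using \<psi> u by auto
  define I where "I = (\<integral>x. \<bar>\<psi> x\<bar> \<partial>lborel)"
  have i: "integrable lborel \<psi>" by (rule integral_one_integrable) fact
  have I: "(\<integral>\<^sup>+x. ennreal \<bar>\<psi> x\<bar> \<partial>lborel) = ennreal I" "I \<ge> 0"
    unfolding I_def using i by (auto simp: nn_integral_eq_integral)
  define e' where "e' = e / (I + 1)"
  have e': "e' > 0" using e I by (simp add: e'_def)
  obtain d where d: "d > 0" "\<And>h. norm h < d \<Longrightarrow> (\<integral>\<^sup>+y. ennreal \<bar>u (y + h) - u y\<bar> \<partial>lborel) \<le> ennreal e'"
    using continuous_translation_L1[OF u] e' by blast
  define c0 where "c0 = (\<bar>r\<bar> + 1) / d"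
  have c0: "c0 > 0" using d by (simp add: c0_def)
  show ?thesis
  proof (intro exI[of _ c0] conjI allI impI c0)
    fix c assume cc: "c0 \<le> c"
    then have c: "c > 0" using c0 by linarith
    have small: "norm ((- 1 / c) *\<^sub>R t) < d" if "\<psi> t \<noteq> 0" for t
    proof -
      have "norm t \<le> \<bar>r\<bar>" using that not_in_supp supp by fastforce
      moreover have "\<bar>r\<bar> + 1 \<le> c * d" using cc d by (simp add: c0_def field_simps)
      ultimately show ?thesis using c by (simp add: field_simps)
    qed
    have "(\<integral>\<^sup>+y. ennreal \<bar>mollify \<psi> c u y - u y\<bar> \<partial>lborel) \<le>
       (\<integral>\<^sup>+y. \<integral>\<^sup>+t. ennreal (\<bar>\<psi> t\<bar> * \<bar>u (y + (- 1 / c) *\<^sub>R t) - u y\<bar>) \<partial>lborel \<partial>lborel)"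
      by (intro nn_integral_mono mollify_minus_bound[OF \<psi> K u c])
    also have "\<dots> = (\<integral>\<^sup>+t. \<integral>\<^sup>+y. ennreal (\<bar>\<psi> t\<bar> * \<bar>u (y + (- 1 / c) *\<^sub>R t) - u y\<bar>) \<partial>lborel \<partial>lborel)"
      by (rule lborel_pair.Fubini') measurable
    also have "\<dots> \<le> (\<integral>\<^sup>+t. ennreal \<bar>\<psi> t\<bar> * ennreal e' \<partial>lborel)"
    proof (rule nn_integral_mono)
      fix t
      have "(\<integral>\<^sup>+y. ennreal (\<bar>\<psi> t\<bar> * \<bar>u (y + (- 1 / c) *\<^sub>R t) - u y\<bar>) \<partial>lborel) =
        ennreal \<bar>\<psi> t\<bar> * (\<integral>\<^sup>+y. ennreal \<bar>u (y + (- 1 / c) *\<^sub>R t) - u y\<bar> \<partial>lborel)"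
        by (subst nn_integral_cmult[symmetric]) (auto simp: ennreal_mult')
      also have "\<dots> \<le> ennreal \<bar>\<psi> t\<bar> * ennreal e'"
        using d(2)[OF small[of t]] by (cases "\<psi> t = 0") (auto intro: mult_left_mono)
      finally show "(\<integral>\<^sup>+y. ennreal (\<bar>\<psi> t\<bar> * \<bar>u (y + (- 1 / c) *\<^sub>R t) - u y\<bar>) \<partial>lborel) \<le> ennreal \<bar>\<psi> t\<bar> * ennreal e'" .
    qed
    also have "\<dots> = ennreal (I * e')" using I by (simp add: nn_integral_multc ennreal_mult')
    also have "\<dots> \<le> ennreal e" using e I by (intro ennreal_leI) (auto simp: e'_def field_simps)
    finally show "(\<integral>\<^sup>+y. ennreal \<bar>mollify \<psi> c u y - u y\<bar> \<partial>lborel) \<le> ennreal e" .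
  qed
qed

section \<open>Uniqueness of weak derivatives\<close>

lemma lebesgue_integrable_Borel_version:
  fixes h :: "'a::euclidean_space \<Rightarrow> real"
  assumes "integrable lebesgue h"
  obtains h' where "integrable lborel h'" "AE x in lebesgue. h x = h' x"
proof -
  obtain h' where [measurable]: "h' \<in> borel_measurable lborel" and ae: "AE x in lborel. h x = h' x"
    using completion_ex_borel_measurable_real[of h lborel] assms by auto
  have ae': "AE x in lebesgue. h x = h' x" using ae by (rule AE_completion)
  have "integrable lebesgue h'"
    by (rule integrable_cong_AE_imp[OF assms measurable_completion ae']) measurable
  then have "integrable lborel h'" by (simp add: integrable_completion)
  then show thesis using ae' that by blast
qed

text \<open>Mollifying the difference of two weak derivatives gives zero, so the difference vanishes almost everywhere.\<close>
lemma weak_deriv_unique: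
  fixes \<psi> u g1 g2 :: "real^'n \<Rightarrow> real"
  assumes \<psi>: "smooth \<psi>" "(\<integral>x. \<psi> x \<partial>lborel) = 1" "supp \<psi> \<subseteq> cball 0 r"
    and g1: "has_weak_deriv D \<kappa> u g1" and g2: "has_weak_deriv D \<kappa> u g2"
  shows "AE x in lebesgue. x \<in> interior D \<longrightarrow> g1 x = g2 x"
proof -
  have csupp: "compact (supp \<psi>)"
    using \<psi>(3) by (metis bounded_cball bounded_subset closed_closure compact_eq_bounded_closed supp_def)
  obtain B where B: "\<And>x. \<bar>\<psi> x\<bar> \<le> B" using smooth_compact_supp_bounded[OF \<psi>(1) csupp] by metis
  note [measurable] = smooth_borel_measurable[OF \<psi>(1)]
  have local: "AE x in lebesgue. x \<in> K \<longrightarrow> g1 x = g2 x" if K: "compact K" "K \<subseteq> interior D" for K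
  proof -
    obtain \<epsilon> where \<epsilon>: "\<epsilon> > 0" "(\<Union>x\<in>K. cball x \<epsilon>) \<subseteq> interior D"
      using compact_subset_open_imp_cball_epsilon_subset[OF K(1) open_interior K(2)] by blast
    \<comment> \<open>On \<open>K'\<close> both functions are integrable, and the small kernels at
      points of \<open>K\<close> vanish outside \<open>K'\<close>; so the cut-off \<open>h\<close>
      can replace the difference.\<close>
    define K' where "K' = (\<Union>x\<in>K. cball x \<epsilon>)"
    have K': "compact K'" "K' \<subseteq> interior D" "\<And>x. x \<in> K \<Longrightarrow> cball x \<epsilon> \<subseteq> K'"
      unfolding K'_def using compact_minkowski_sum_cball[OF K(1)] \<epsilon> by (auto simp: Union_eq)
    define h where "h x = indicator K' x *\<^sub>R (g1 x - g2 x)" for x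
    have si: "set_integrable lebesgue K' g1" "set_integrable lebesgue K' g2"
      using g1 g2 K' by (auto simp: has_weak_deriv_def locally_integrable_def)
    then have "integrable lebesgue (\<lambda>x. indicator K' x *\<^sub>R g1 x - indicator K' x *\<^sub>R g2 x)"
      unfolding set_integrable_def by (rule Bochner_Integration.integrable_diff)
    also have "(\<lambda>x. indicator K' x *\<^sub>R g1 x - indicator K' x *\<^sub>R g2 x) = h"
      by (simp add: h_def fun_eq_iff right_diff_distrib)
    finally have "integrable lebesgue h" .
    then obtain h' where h': "integrable lborel h'" and hh': "AE x in lebesgue. h x = h' x"
      by (rule lebesgue_integrable_Borel_version)
    have [measurable]: "h' \<in> borel_measurable borel" using h' by simp
    have zero: "mollify \<psi> c h' y = 0" if y: "y \<in> K" and c: "c > 0" "r / c \<le> \<epsilon>" for y c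
    proof -
      let ?\<phi> = "\<lambda>x. \<psi> (c *\<^sub>R (y - x))"
      have yD: "cball y (r / c) \<subseteq> K'" using K'(3)[OF y] c by (meson order_trans subset_cball)
      have tf: "test_function D ?\<phi>"
        using yD K'(2) by (intro test_function_scaled[OF \<psi>(1,3) c(1)]) auto
      have out: "?\<phi> x = 0" if "x \<notin> K'" for x
      proof (rule not_in_supp)
        have "\<not> dist y x \<le> r / c" using that yD by auto
        then have "\<not> c * dist y x \<le> r" using c by (simp add: pos_le_divide_eq mult.commute)
        then have "\<not> norm (c *\<^sub>R (y - x)) \<le> r" using c by (simp add: dist_norm)
        then show "c *\<^sub>R (y - x) \<notin> supp \<psi>" using \<psi>(3) by auto
      qed
      have gi: "integrable lebesgue (\<lambda>x. (indicator K' x *\<^sub>R g x) * ?\<phi> x)"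
        if "set_integrable lebesgue K' g" for g
      proof (rule bounded_mult_integrable[OF that[unfolded set_integrable_def], where K = B])
        have "?\<phi> \<in> borel_measurable lborel" by measurable
        then show "?\<phi> \<in> borel_measurable lebesgue" by (rule measurable_completion)
        show "\<bar>?\<phi> x\<bar> \<le> B" for x by (rule B)
      qed
      have eq: "(LINT x:D|lebesgue. g x * ?\<phi> x) = (\<integral>x. (indicator K' x *\<^sub>R g x) * ?\<phi> x \<partial>lebesgue)" for g
        unfolding set_lebesgue_integral_def
        using out K'(2) interior_subset by (intro Bochner_Integration.integral_cong) (auto simp: indicator_def)
      have "(LINT x:D|lebesgue. g1 x * ?\<phi> x) = (LINT x:D|lebesgue. g2 x * ?\<phi> x)"
      proof -
        have "(-1) ^ mi_order \<kappa> * (LINT x:D|lebesgue. g1 x * ?\<phi> x) =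
            ((-1) ^ mi_order \<kappa> * (LINT x:D|lebesgue. g2 x * ?\<phi> x) :: real)"
          using g1[unfolded has_weak_deriv_def, THEN conjunct2, THEN conjunct2, rule_format, OF tf]
            g2[unfolded has_weak_deriv_def, THEN conjunct2, THEN conjunct2, rule_format, OF tf] by (rule trans[OF sym])
        then show ?thesis by simp
      qed
      then have "0 = (\<integral>x. (indicator K' x *\<^sub>R g1 x) * ?\<phi> x - (indicator K' x *\<^sub>R g2 x) * ?\<phi> x \<partial>lebesgue)"
        unfolding eq using gi[OF si(1)] gi[OF si(2)] by simp
      also have "\<dots> = (\<integral>x. h x * ?\<phi> x \<partial>lebesgue)"
        by (intro Bochner_Integration.integral_cong) (auto simp: h_def algebra_simps)
      also have "\<dots> = (\<integral>x. h' x * ?\<phi> x \<partial>lebesgue)"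
      proof (rule integral_cong_AE)
        have 1: "?\<phi> \<in> borel_measurable lebesgue" by (intro measurable_completion) measurable
        have 2: "h \<in> borel_measurable lebesgue" using \<open>integrable lebesgue h\<close> by simp
        have 3: "h' \<in> borel_measurable lebesgue" by (intro measurable_completion) measurable
        show "(\<lambda>x. h x * ?\<phi> x) \<in> borel_measurable lebesgue" using 1 2 by (rule borel_measurable_times[rotated])
        show "(\<lambda>x. h' x * ?\<phi> x) \<in> borel_measurable lebesgue" using 1 3 by (rule borel_measurable_times[rotated])
        show "AE x in lebesgue. h x * ?\<phi> x = h' x * ?\<phi> x" using hh' by eventually_elim simp
      qed
      also have "\<dots> = (\<integral>x. h' x * ?\<phi> x \<partial>lborel)" by (rule integral_completion) measurable
      also have "c ^ CARD('n) * \<dots> = mollify \<psi> c h' y"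
        unfolding mollify_def integral_mult_right_zero[symmetric]
        by (intro Bochner_Integration.integral_cong) auto
      finally show ?thesis by simp
    qed
    have Kb: "K \<in> sets borel" using K(1) by (rule borel_compact)
    \<comment> \<open>On \<open>K\<close> the mollification vanishes, so \<open>h'\<close> is there,
      up to sign, its own mollification error.\<close>
    have "(\<integral>\<^sup>+y. ennreal \<bar>h' y\<bar> * indicator K y \<partial>lborel) \<le> ennreal e" if e: "e > 0" for e
    proof -
      obtain c0 where c0: "c0 > 0" "\<And>c. c \<ge> c0 \<Longrightarrow> (\<integral>\<^sup>+y. ennreal \<bar>mollify \<psi> c h' y - h' y\<bar> \<partial>lborel) \<le> ennreal e"
        using mollify_L1[OF _ \<psi>(2) B \<psi>(3) h' e] by auto
      define c where "c = max c0 (\<bar>r\<bar> / \<epsilon>)"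
      have c: "c > 0" "c \<ge> c0" using c0 by (auto simp: c_def)
      have "\<bar>r\<bar> / \<epsilon> \<le> c" by (simp add: c_def)
      then have rc: "r / c \<le> \<epsilon>" using c \<epsilon> by (simp add: field_simps) 
      have "(\<integral>\<^sup>+y. ennreal \<bar>h' y\<bar> * indicator K y \<partial>lborel) \<le> (\<integral>\<^sup>+y. ennreal \<bar>mollify \<psi> c h' y - h' y\<bar> \<partial>lborel)"
        using zero[OF _ c(1) rc] by (intro nn_integral_mono) (auto simp: indicator_def)
      also have "\<dots> \<le> ennreal e" by (rule c0(2)[OF c(2)])
      finally show ?thesis .
    qed
    then have "(\<integral>\<^sup>+y. ennreal \<bar>h' y\<bar> * indicator K y \<partial>lborel) \<le> 0"
      by - (rule ennreal_le_epsilon, simp)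
    then have "(\<integral>\<^sup>+y. ennreal \<bar>h' y\<bar> * indicator K y \<partial>lborel) = 0" by simp
    then have "AE y in lborel. ennreal \<bar>h' y\<bar> * indicator K y = 0"
      using Kb by (subst (asm) nn_integral_0_iff_AE) auto
    then have "AE y in lebesgue. ennreal \<bar>h' y\<bar> * indicator K y = 0" by (rule AE_completion)
    with hh' show ?thesis
    proof eventually_elim
      case (elim x)
      have "x \<in> K \<Longrightarrow> x \<in> K'" using K'(3)[of x] \<epsilon>(1) by auto
      then show ?case using elim by (auto simp: h_def indicator_def split: if_splits)
    qed
  qed
  \<comment> \<open>Countably many compact sets exhaust the interior, so the exceptional null sets
    can be united.\<close>
  obtain C :: "nat \<Rightarrow> (real^'n) set"
    where C: "\<And>n. compact (C n)" "\<And>n. C n \<subseteq> interior D" "\<Union>(range C) = interior D"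
  proof (rule open_Union_compact_subsets[OF open_interior[of D]])
    fix C :: "nat \<Rightarrow> (real^'n) set"
    assume "\<And>n. compact (C n)" "\<And>n. C n \<subseteq> interior D" "\<Union>(range C) = interior D"
    then show thesis by (rule that)
  qed
  have "AE x in lebesgue. \<forall>n. x \<in> C n \<longrightarrow> g1 x = g2 x"
    unfolding AE_all_countable by (intro allI local C(1,2))
  then show ?thesis
  proof eventually_elim
    case (elim x)
    then show ?case unfolding C(3)[symmetric] by auto
  qed
qed

subsection \<open>The Taylor polynomial as a function of its centre\<close>

lemma finite_mi_le: "finite {\<alpha> :: 'n::finite \<Rightarrow> nat. mi_order \<alpha> \<le> k}"
proof (rule finite_subset)
  show "{\<alpha> :: 'n \<Rightarrow> nat. mi_order \<alpha> \<le> k} \<subseteq> PiE UNIV (\<lambda>_. {..k})"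
  proof
    fix \<alpha> :: "'n \<Rightarrow> nat" assume "\<alpha> \<in> {\<alpha>. mi_order \<alpha> \<le> k}"
    moreover have "\<alpha> i \<le> mi_order \<alpha>" for i unfolding mi_order_def by (rule member_le_sum) auto
    ultimately have "\<alpha> i \<le> k" for i by (metis mem_Collect_eq order_trans)
    then show "\<alpha> \<in> PiE UNIV (\<lambda>_. {..k})" by auto
  qed
qed (simp add: finite_PiE)

lemma finite_mi_eq: "finite {\<alpha> :: 'n::finite \<Rightarrow> nat. mi_order \<alpha> = k}"
  by (rule finite_subset[OF _ finite_mi_le[of k]]) auto

lemma mi_order_upd: "mi_order (\<alpha>(i := Suc (\<alpha> i))) = Suc (mi_order \<alpha>)"
proof -
  have "mi_order (\<alpha>(i := Suc (\<alpha> i))) = Suc (\<alpha> i) + (\<Sum>j\<in>UNIV - {i}. \<alpha> j)"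
    unfolding mi_order_def by (subst sum.remove[of _ i]) auto
  also have "\<dots> = Suc (mi_order \<alpha>)" unfolding mi_order_def by (subst (2) sum.remove[of _ i]) auto
  finally show ?thesis .
qed

lemma mi_fact_upd: "mi_fact (\<alpha>(i := Suc (\<alpha> i))) = real (Suc (\<alpha> i)) * mi_fact \<alpha>"
proof -
  have "mi_fact (\<alpha>(i := Suc (\<alpha> i))) = fact (Suc (\<alpha> i)) * (\<Prod>j\<in>UNIV - {i}. fact (\<alpha> j))"
    unfolding mi_fact_def by (subst prod.remove[of _ i]) auto
  also have "\<dots> = real (Suc (\<alpha> i)) * mi_fact \<alpha>"
    unfolding mi_fact_def by (subst (2) prod.remove[of _ i]) (auto simp: algebra_simps)
  finally show ?thesis .
qed

lemma mi_fact_ge_1: "1 \<le> mi_fact \<alpha>"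
  unfolding mi_fact_def by (rule prod_ge_1) (simp add: fact_ge_1)

lemma abs_mi_power_le: "\<bar>mi_power x \<alpha>\<bar> \<le> norm x ^ mi_order \<alpha>"
proof -
  have "\<bar>mi_power x \<alpha>\<bar> = (\<Prod>i\<in>UNIV. \<bar>x $ i\<bar> ^ \<alpha> i)" by (simp add: mi_power_def abs_prod power_abs)
  also have "\<dots> \<le> (\<Prod>i\<in>UNIV. norm x ^ \<alpha> i)"
    by (intro prod_mono conjI power_mono component_le_norm_cart) auto
  also have "\<dots> = norm x ^ mi_order \<alpha>" by (simp add: mi_order_def power_sum)
  finally show ?thesis .
qed

lemma mi_power_0: "mi_power 0 \<alpha> = (if \<alpha> = (\<lambda>_. 0) then 1 else 0)"
  by (auto simp: mi_power_def fun_eq_iff)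

text \<open>For \<open>\<gamma> i = 0\<close> the truncated difference \<open>\<gamma> i - 1\<close>
  is 0, but the factor \<open>real (\<gamma> i)\<close> removes the term.\<close>

lemma mi_power_diff_has_derivative:
  "((\<lambda>x. mi_power (y - x) \<gamma>) has_derivative
    (\<lambda>h. - (\<Sum>i\<in>UNIV. h $ i * (real (\<gamma> i) * mi_power (y - x) (\<gamma>(i := \<gamma> i - 1)))))) (at x)"
proof -
  have "((\<lambda>x. mi_power (y - x) \<gamma>) has_derivative
    (\<lambda>h. \<Sum>i\<in>UNIV. (- h $ i * (real (\<gamma> i) * (y - x) $ i ^ (\<gamma> i - 1))) * (\<Prod>j\<in>UNIV - {i}. (y - x) $ j ^ \<gamma> j))) (at x)"
    unfolding mi_power_def
    by (rule has_derivative_prod) (auto intro!: derivative_eq_intros bounded_linear.has_derivative[OF bounded_linear_vec_nth] simp: fun_eq_iff)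
  moreover have "mi_power (y - x) (\<gamma>(i := \<gamma> i - 1)) = (y - x) $ i ^ (\<gamma> i - 1) * (\<Prod>j\<in>UNIV - {i}. (y - x) $ j ^ \<gamma> j)" for i
    unfolding mi_power_def by (subst prod.remove[of _ i]) auto
  ultimately show ?thesis by (simp add: mult.assoc sum_negf)
qed

text \<open>\<open>G \<alpha>\<close> takes the place of the derivative of order
  \<open>\<alpha>\<close>, so that one formula covers weak derivatives and mollified ones.\<close>

definition jet_poly :: "nat \<Rightarrow> (('n::finite \<Rightarrow> nat) \<Rightarrow> real^'n \<Rightarrow> real) \<Rightarrow> real^'n \<Rightarrow> real^'n \<Rightarrow> real" where
  "jet_poly m G x y = (\<Sum>\<alpha> | mi_order \<alpha> \<le> m. 1 / mi_fact \<alpha> * G \<alpha> x * mi_power (y - x) \<alpha>)"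

lemma jet_poly_same:
  fixes G :: "('n::finite \<Rightarrow> nat) \<Rightarrow> real^'n \<Rightarrow> real"
  shows "jet_poly m G y y = G (\<lambda>_. 0) y"
proof -
  have "jet_poly m G y y = (\<Sum>\<alpha>\<in>{\<lambda>_. 0}. 1 / mi_fact \<alpha> * G \<alpha> y * mi_power (y - y) \<alpha>)"
    unfolding jet_poly_def
    using finite_mi_le[of m]
    by (intro sum.mono_neutral_right) (auto simp: mi_power_0 mi_order_def)
  then show ?thesis by (simp add: mi_power_0 mi_fact_def)
qed

text \<open>In the derivative with respect to the centre, all terms of order at most \<open>m\<close> telescope.\<close>
lemma jet_poly_has_derivative:
  fixes G :: "('n::finite \<Rightarrow> nat) \<Rightarrow> real^'n \<Rightarrow> real"
  assumes G: "\<And>\<gamma>. mi_order \<gamma> \<le> m \<Longrightarrow>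
    (G \<gamma> has_derivative (\<lambda>h. \<Sum>i\<in>UNIV. h $ i * G (\<gamma>(i := Suc (\<gamma> i))) x)) (at x)"
  shows "((\<lambda>x. jet_poly m G x y) has_derivative
    (\<lambda>h. \<Sum>\<gamma> | mi_order \<gamma> = m. \<Sum>i\<in>UNIV. h $ i * (1 / mi_fact \<gamma> * G (\<gamma>(i := Suc (\<gamma> i))) x * mi_power (y - x) \<gamma>))) (at x)"
proof -
  \<comment> \<open>\<open>a\<close> comes from differentiating the coefficient, \<open>b\<close>
    from differentiating the monomial.\<close>
  define a where "a h i \<gamma> = h $ i * (1 / mi_fact \<gamma> * G (\<gamma>(i := Suc (\<gamma> i))) x * mi_power (y - x) \<gamma>)" for h :: "real^'n" and i \<gamma>
  define b where "b h i \<gamma> = 1 / mi_fact \<gamma> * G \<gamma> x * (h $ i * (real (\<gamma> i) * mi_power (y - x) (\<gamma>(i := \<gamma> i - 1))))" for h :: "real^'n" and i \<gamma>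
  have "((\<lambda>x. jet_poly m G x y) has_derivative
    (\<lambda>h. \<Sum>\<gamma> | mi_order \<gamma> \<le> m. 1 / mi_fact \<gamma> * (G \<gamma> x * (- (\<Sum>i\<in>UNIV. h $ i * (real (\<gamma> i) * mi_power (y - x) (\<gamma>(i := \<gamma> i - 1)))))
      + (\<Sum>i\<in>UNIV. h $ i * G (\<gamma>(i := Suc (\<gamma> i))) x) * mi_power (y - x) \<gamma>))) (at x)"
    unfolding jet_poly_def mult.assoc
    by (intro has_derivative_sum has_derivative_mult_right has_derivative_mult mi_power_diff_has_derivative G) simp
  also have "(\<lambda>h. \<Sum>\<gamma> | mi_order \<gamma> \<le> m. 1 / mi_fact \<gamma> * (G \<gamma> x * (- (\<Sum>i\<in>UNIV. h $ i * (real (\<gamma> i) * mi_power (y - x) (\<gamma>(i := \<gamma> i - 1)))))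
      + (\<Sum>i\<in>UNIV. h $ i * G (\<gamma>(i := Suc (\<gamma> i))) x) * mi_power (y - x) \<gamma>)) =
    (\<lambda>h. \<Sum>\<gamma> | mi_order \<gamma> = m. \<Sum>i\<in>UNIV. a h i \<gamma>)"
  proof
    fix h :: "real^'n"
    \<comment> \<open>Lowering \<open>\<gamma> i\<close> by 1 matches the nonzero terms
      \<open>b\<close> with the terms \<open>a\<close> of order below \<open>m\<close>, because the
      factor \<open>\<gamma> i\<close> reduces the factorial accordingly. Only the terms
      \<open>a\<close> of order \<open>m\<close> survive.\<close>
    have shift: "(\<Sum>\<gamma> | mi_order \<gamma> \<le> m. b h i \<gamma>) = (\<Sum>\<gamma> | mi_order \<gamma> < m. a h i \<gamma>)" for i
    proof -
      have "(\<Sum>\<gamma> | mi_order \<gamma> \<le> m. b h i \<gamma>) = (\<Sum>\<gamma> | mi_order \<gamma> \<le> m \<and> \<gamma> i \<noteq> 0. b h i \<gamma>)"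
        by (rule sum.mono_neutral_right) (auto simp: finite_mi_le b_def)
      also have "\<dots> = (\<Sum>\<gamma> | mi_order \<gamma> < m. a h i \<gamma>)"
      proof (rule sum.reindex_bij_witness[where i = "\<lambda>\<gamma>. \<gamma>(i := Suc (\<gamma> i))" and j = "\<lambda>\<gamma>. \<gamma>(i := \<gamma> i - 1)"])
        fix \<gamma> :: "'n \<Rightarrow> nat" assume "\<gamma> \<in> {\<gamma>. mi_order \<gamma> \<le> m \<and> \<gamma> i \<noteq> 0}"
        then have g: "mi_order \<gamma> \<le> m" "\<gamma> i \<noteq> 0" by auto
        define \<gamma>' where "\<gamma>' = \<gamma>(i := \<gamma> i - 1)"
        have g': "\<gamma> = \<gamma>'(i := Suc (\<gamma>' i))" using g by (auto simp: \<gamma>'_def)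
        show "(\<gamma>(i := \<gamma> i - 1))(i := Suc ((\<gamma>(i := \<gamma> i - 1)) i)) = \<gamma>" using g by auto
        have "mi_order \<gamma> = Suc (mi_order \<gamma>')" by (subst g') (rule mi_order_upd)
        then show "\<gamma>(i := \<gamma> i - 1) \<in> {\<gamma>. mi_order \<gamma> < m}" using g by (simp add: \<gamma>'_def)
        have "mi_fact \<gamma> = real (Suc (\<gamma>' i)) * mi_fact \<gamma>'" by (subst g') (rule mi_fact_upd)
        moreover have "\<gamma> i = Suc (\<gamma>' i)" using g by (simp add: \<gamma>'_def)
        moreover have "mi_fact \<gamma>' > 0" using mi_fact_ge_1[of \<gamma>'] by linarith
        ultimately have fac: "1 / mi_fact \<gamma> * real (\<gamma> i) = 1 / mi_fact \<gamma>'" by simp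
        have "b h i \<gamma> = (1 / mi_fact \<gamma> * real (\<gamma> i)) * (G \<gamma> x * (h $ i * mi_power (y - x) \<gamma>'))"
          by (simp add: b_def \<gamma>'_def)
        also have "\<dots> = a h i \<gamma>'" unfolding fac a_def using g' by simp
        finally have "b h i \<gamma> = a h i \<gamma>'" .
        then show "a h i (\<gamma>(i := \<gamma> i - 1)) = b h i \<gamma>" by (simp add: \<gamma>'_def)
      next
        fix \<gamma> :: "'n \<Rightarrow> nat" assume "\<gamma> \<in> {\<gamma>. mi_order \<gamma> < m}"
        then show "\<gamma>(i := Suc (\<gamma> i)) \<in> {\<gamma>. mi_order \<gamma> \<le> m \<and> \<gamma> i \<noteq> 0}" by (simp add: mi_order_upd)
      qed auto
      finally show ?thesis .
    qed
    have "(\<Sum>\<gamma> | mi_order \<gamma> \<le> m. 1 / mi_fact \<gamma> * (G \<gamma> x * (- (\<Sum>i\<in>UNIV. h $ i * (real (\<gamma> i) * mi_power (y - x) (\<gamma>(i := \<gamma> i - 1)))))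
      + (\<Sum>i\<in>UNIV. h $ i * G (\<gamma>(i := Suc (\<gamma> i))) x) * mi_power (y - x) \<gamma>)) =
      (\<Sum>\<gamma> | mi_order \<gamma> \<le> m. \<Sum>i\<in>UNIV. a h i \<gamma> - b h i \<gamma>)"
      by (intro sum.cong refl)
        (simp add: a_def b_def sum_subtractf sum_distrib_left sum_distrib_right distrib_left sum_negf ac_simps diff_divide_distrib sum_divide_distrib)
    also have "\<dots> = (\<Sum>i\<in>UNIV. (\<Sum>\<gamma> | mi_order \<gamma> \<le> m. a h i \<gamma>) - (\<Sum>\<gamma> | mi_order \<gamma> \<le> m. b h i \<gamma>))"
      by (subst sum.swap) (simp add: sum_subtractf)
    also have "\<dots> = (\<Sum>i\<in>UNIV. \<Sum>\<gamma> | mi_order \<gamma> = m. a h i \<gamma>)"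
    proof (rule sum.cong[OF refl])
      fix i
      have "{\<gamma> :: 'n \<Rightarrow> nat. mi_order \<gamma> \<le> m} = {\<gamma>. mi_order \<gamma> < m} \<union> {\<gamma>. mi_order \<gamma> = m}" by auto
      then have "(\<Sum>\<gamma> | mi_order \<gamma> \<le> m. a h i \<gamma>) = (\<Sum>\<gamma> | mi_order \<gamma> < m. a h i \<gamma>) + (\<Sum>\<gamma> | mi_order \<gamma> = m. a h i \<gamma>)"
        by (simp, intro sum.union_disjoint)
          (auto intro: finite_subset[OF _ finite_mi_le[of m]])
      then show "(\<Sum>\<gamma> | mi_order \<gamma> \<le> m. a h i \<gamma>) - (\<Sum>\<gamma> | mi_order \<gamma> \<le> m. b h i \<gamma>) = (\<Sum>\<gamma> | mi_order \<gamma> = m. a h i \<gamma>)"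
        by (simp add: shift)
    qed
    also have "\<dots> = (\<Sum>\<gamma> | mi_order \<gamma> = m. \<Sum>i\<in>UNIV. a h i \<gamma>)" by (rule sum.swap)
    finally show "(\<Sum>\<gamma> | mi_order \<gamma> \<le> m. 1 / mi_fact \<gamma> * (G \<gamma> x * (- (\<Sum>i\<in>UNIV. h $ i * (real (\<gamma> i) * mi_power (y - x) (\<gamma>(i := \<gamma> i - 1)))))
      + (\<Sum>i\<in>UNIV. h $ i * G (\<gamma>(i := Suc (\<gamma> i))) x) * mi_power (y - x) \<gamma>)) =
      (\<Sum>\<gamma> | mi_order \<gamma> = m. \<Sum>i\<in>UNIV. a h i \<gamma>)" .
  qed
  finally show ?thesis unfolding a_def .
qed

text \<open>Indexed by \<open>\<gamma>\<close> and \<open>i\<close> as in the derivative of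
  \<open>jet_poly\<close>, so a derivative of order \<open>m + 1\<close> may be counted several
  times.\<close>

definition top_jet :: "nat \<Rightarrow> (('n::finite \<Rightarrow> nat) \<Rightarrow> real^'n \<Rightarrow> real) \<Rightarrow> real^'n \<Rightarrow> real" where
  "top_jet m G x = (\<Sum>\<gamma> | mi_order \<gamma> = m. \<Sum>i\<in>UNIV. \<bar>G (\<gamma>(i := Suc (\<gamma> i))) x\<bar>)"

lemma top_jet_nonneg: "0 \<le> top_jet m G x"
  unfolding top_jet_def by (intro sum_nonneg) auto

text \<open>The fundamental theorem of calculus for a centre that moves along the segment. Of the
  \<open>m + 1\<close> factors \<open>D\<close>, one bounds the velocity \<open>w - x\<close> and
  \<open>m\<close> bound the monomial.\<close>

lemma jet_poly_segment:
  fixes G :: "('n::finite \<Rightarrow> nat) \<Rightarrow> real^'n \<Rightarrow> real"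
  assumes G: "\<And>\<gamma> s. mi_order \<gamma> \<le> m \<Longrightarrow> s \<in> {0..1} \<Longrightarrow>
    (G \<gamma> has_derivative (\<lambda>h. \<Sum>i\<in>UNIV. h $ i * G (\<gamma>(i := Suc (\<gamma> i))) (x + s *\<^sub>R (w - x)))) (at (x + s *\<^sub>R (w - x)))"
    and cont: "\<And>\<gamma>. continuous_on UNIV (G \<gamma>)"
    and d: "norm (w - x) \<le> D" "\<And>s. s \<in> {0..1} \<Longrightarrow> norm (y - (x + s *\<^sub>R (w - x))) \<le> D"
  shows "ennreal \<bar>jet_poly m G w y - jet_poly m G x y\<bar> \<le>
    ennreal (D ^ Suc m) * (\<integral>\<^sup>+s\<in>{0<..<1}. ennreal (top_jet m G (x + s *\<^sub>R (w - x))) \<partial>lborel)"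
proof -
  have D: "D \<ge> 0" using d(1) norm_ge_zero order_trans by blast
  define X where "X s = x + s *\<^sub>R (w - x)" for s :: real
  define q where "q s = (\<Sum>\<gamma> | mi_order \<gamma> = m. \<Sum>i\<in>UNIV. (w - x) $ i *
     (1 / mi_fact \<gamma> * G (\<gamma>(i := Suc (\<gamma> i))) (X s) * mi_power (y - X s) \<gamma>))" for s
  have der: "((\<lambda>s. jet_poly m G (X s) y) has_vector_derivative q s) (at s within {0..1})" if s: "0 \<le> s" "s \<le> 1" for s
  proof -
    have "((\<lambda>s. jet_poly m G (X s) y) has_derivative (\<lambda>t. \<Sum>\<gamma> | mi_order \<gamma> = m. \<Sum>i\<in>UNIV. (t *\<^sub>R (w - x)) $ i *
     (1 / mi_fact \<gamma> * G (\<gamma>(i := Suc (\<gamma> i))) (X s) * mi_power (y - X s) \<gamma>))) (at s within {0..1})"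
    proof (rule has_derivative_compose[OF _ jet_poly_has_derivative])
      show "(X has_derivative (\<lambda>t. t *\<^sub>R (w - x))) (at s within {0..1})"
        unfolding X_def by (auto intro!: derivative_eq_intros)
    next
      fix \<gamma> :: "'n \<Rightarrow> nat" assume "mi_order \<gamma> \<le> m"
      then show "(G \<gamma> has_derivative (\<lambda>h. \<Sum>i\<in>UNIV. h $ i * G (\<gamma>(i := Suc (\<gamma> i))) (X s))) (at (X s))"
        using G[of \<gamma> s] s by (simp add: X_def)
    qed
    then show ?thesis
      by (simp add: has_vector_derivative_def q_def sum_distrib_left ac_simps)
  qed
  have contq: "continuous_on {0..1} q"
  proof -
    have X: "continuous_on {0..1} X" unfolding X_def by (intro continuous_intros)
    have "continuous_on {0..1} (\<lambda>s. G \<gamma> (X s))" for \<gamma>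
      by (rule continuous_on_compose2[OF cont X]) auto
    then show ?thesis unfolding q_def mi_power_def
      by (intro continuous_on_sum continuous_on_mult continuous_on_const continuous_on_prod continuous_on_power
        continuous_on_component continuous_on_diff X)
  qed
  have fund: "has_bochner_integral lborel (\<lambda>s. indicator {0..1} s *\<^sub>R q s) (jet_poly m G (X 1) y - jet_poly m G (X 0) y)"
    by (rule has_bochner_integral_FTC_Icc[OF _ der contq]) auto
  have "ennreal \<bar>jet_poly m G w y - jet_poly m G x y\<bar> = ennreal (norm (\<integral>s. indicator {0..1} s *\<^sub>R q s \<partial>lborel))"
    using has_bochner_integral_integral_eq[OF fund] by (simp add: X_def)
  also have "\<dots> \<le> (\<integral>\<^sup>+s. ennreal (norm (indicator {0..1} s *\<^sub>R q s)) \<partial>lborel)"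
    using fund by (intro integral_norm_bound_ennreal) (auto simp: has_bochner_integral_iff)
  also have "\<dots> \<le> (\<integral>\<^sup>+s. ennreal (D ^ Suc m) * (ennreal (top_jet m G (X s)) * indicator {0<..<1} s) \<partial>lborel)"
  proof (rule nn_integral_mono_AE)
    \<comment> \<open>The endpoints are discarded because the right-hand side integrates over the
      open interval.\<close>
    have "AE s in lborel. s \<noteq> (0::real)" "AE s in lborel. s \<noteq> (1::real)" by (rule AE_lborel_singleton)+
    then show "AE s in lborel. ennreal (norm (indicator {0..1} s *\<^sub>R q s)) \<le>
       ennreal (D ^ Suc m) * (ennreal (top_jet m G (X s)) * indicator {0<..<1} s)"
    proof eventually_elim
      case (elim s)
      show ?case
      proof (cases "s \<in> {0<..<1}")
        case True
        have "\<bar>q s\<bar> \<le> (\<Sum>\<gamma> | mi_order \<gamma> = m. \<bar>\<Sum>i\<in>UNIV. (w - x) $ i *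
           (1 / mi_fact \<gamma> * G (\<gamma>(i := Suc (\<gamma> i))) (X s) * mi_power (y - X s) \<gamma>)\<bar>)"
          unfolding q_def by (rule sum_abs)
        also have "\<dots> \<le> (\<Sum>\<gamma> | mi_order \<gamma> = m. \<Sum>i\<in>UNIV. D ^ Suc m * \<bar>G (\<gamma>(i := Suc (\<gamma> i))) (X s)\<bar>)"
        proof (rule sum_mono, rule order_trans[OF sum_abs], rule sum_mono)
          fix \<gamma> :: "'n \<Rightarrow> nat" and i assume "\<gamma> \<in> {\<gamma>. mi_order \<gamma> = m}"
          then have g: "mi_order \<gamma> = m" by simp
          have 1: "\<bar>(w - x) $ i\<bar> \<le> D" using d(1) component_le_norm_cart order_trans by blast
          have "\<bar>mi_power (y - X s) \<gamma>\<bar> \<le> norm (y - X s) ^ m" using abs_mi_power_le[of _ \<gamma>] g by metis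
          also have "\<dots> \<le> D ^ m" using d(2)[of s] True by (intro power_mono) (auto simp: X_def)
          finally have 2: "\<bar>mi_power (y - X s) \<gamma>\<bar> \<le> D ^ m" .
          have 3: "\<bar>1 / mi_fact \<gamma>\<bar> \<le> 1" using mi_fact_ge_1[of \<gamma>] by simp
          let ?g = "\<bar>G (\<gamma>(i := Suc (\<gamma> i))) (X s)\<bar>"
          have "\<bar>(w - x) $ i * (1 / mi_fact \<gamma> * G (\<gamma>(i := Suc (\<gamma> i))) (X s) * mi_power (y - X s) \<gamma>)\<bar>
            = \<bar>(w - x) $ i\<bar> * (\<bar>1 / mi_fact \<gamma>\<bar> * ?g * \<bar>mi_power (y - X s) \<gamma>\<bar>)"
            by (simp only: abs_mult)
          also have "\<dots> \<le> D * (1 * ?g * D ^ m)"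
            using 1 2 3 D by (intro mult_mono) auto
          finally show "\<bar>(w - x) $ i * (1 / mi_fact \<gamma> * G (\<gamma>(i := Suc (\<gamma> i))) (X s) * mi_power (y - X s) \<gamma>)\<bar>
            \<le> D ^ Suc m * ?g" by (simp add: ac_simps)
        qed
        also have "\<dots> = D ^ Suc m * top_jet m G (X s)" by (simp add: top_jet_def sum_distrib_left)
        finally show ?thesis using True D by (simp add: ennreal_mult'[symmetric] ennreal_leI top_jet_nonneg)
      qed (use elim in \<open>auto simp: indicator_def\<close>)
    qed
  qed
  also have "\<dots> = ennreal (D ^ Suc m) * (\<integral>\<^sup>+s\<in>{0<..<1}. ennreal (top_jet m G (X s)) \<partial>lborel)"
  proof (rule nn_integral_cmult)
    have "continuous_on UNIV (\<lambda>s. top_jet m G (X s))"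
      unfolding top_jet_def X_def
      by (intro continuous_intros continuous_on_compose2[OF cont]) auto
    then have [measurable]: "(\<lambda>s. top_jet m G (X s)) \<in> borel_measurable borel" by (rule borel_measurable_continuous_onI)
    show "(\<lambda>s. ennreal (top_jet m G (X s)) * indicator {0<..<1} s) \<in> borel_measurable lborel" by measurable
  qed
  finally show ?thesis unfolding X_def .
qed

subsection \<open>Remainders of weakly differentiable functions\<close>

text \<open>Integration by parts is required one coordinate at a time, the form in which it is used
  to differentiate a mollification. Integrability on the whole space allows the functions to be
  mollified everywhere.\<close>

definition weak_jet :: "nat \<Rightarrow> (real^'n) set \<Rightarrow> (('n::finite \<Rightarrow> nat) \<Rightarrow> real^'n \<Rightarrow> real) \<Rightarrow> bool" where
  "weak_jet m S V \<longleftrightarrow> (\<forall>\<gamma>. integrable lborel (V \<gamma>)) \<and>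
     (\<forall>\<gamma> i \<phi>. mi_order \<gamma> \<le> m \<longrightarrow> test_function S \<phi> \<longrightarrow>
        (\<integral>x. V \<gamma> x * partial_deriv i \<phi> x \<partial>lborel) = - (\<integral>x. V (\<gamma>(i := Suc (\<gamma> i))) x * \<phi> x \<partial>lborel))"

section \<open>Mollified weak jets\<close>

lemma compact_supp_subset_cball: "supp \<psi> \<subseteq> cball 0 r \<Longrightarrow> compact (supp \<psi>)"
  by (metis bounded_cball bounded_subset closed_closure compact_eq_bounded_closed supp_def)

lemma partial_deriv_affine:
  assumes "smooth f"
  shows "partial_deriv i (\<lambda>x. f (b + c *\<^sub>R x)) x = c * partial_deriv i f (b + c *\<^sub>R x)"
  using foldr_partial_deriv_affine[OF assms, of "[i]" b c] by (simp add: fun_eq_iff)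

lemma compact_supp_scaled:
  assumes "supp \<psi> \<subseteq> cball 0 r" "0 < c"
  shows "compact (supp (\<lambda>x. \<psi> (0 + c *\<^sub>R x)))"
proof -
  have "{x. \<psi> (c *\<^sub>R x) \<noteq> 0} \<subseteq> cball 0 (r / c)"
  proof
    fix x assume "x \<in> {x. \<psi> (c *\<^sub>R x) \<noteq> 0}"
    then have "c *\<^sub>R x \<in> cball 0 r" using assms(1) not_in_supp by blast
    then show "x \<in> cball 0 (r / c)" using assms(2) by (simp add: pos_le_divide_eq mult.commute)
  qed
  then have "supp (\<lambda>x. \<psi> (0 + c *\<^sub>R x)) \<subseteq> cball 0 (r / c)"
    unfolding supp_def by (intro closure_minimal) auto
  then show ?thesis by (rule compact_supp_subset_cball)
qed

lemma mollify_has_derivative_kernel: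
  fixes u :: "real^'n \<Rightarrow> real"
  assumes \<psi>: "smooth \<psi>" "supp \<psi> \<subseteq> cball 0 r" and c: "0 < c" and u: "integrable lborel u"
  shows "(mollify \<psi> c u has_derivative (\<lambda>h. \<Sum>i\<in>UNIV. h $ i *
     (c ^ CARD('n) * (\<integral>x. u x * (c * partial_deriv i \<psi> (c *\<^sub>R (y - x))) \<partial>lborel)))) (at y)"
proof -
  define \<phi> where "\<phi> = (\<lambda>x. \<psi> (0 + c *\<^sub>R x))"
  have \<phi>: "smooth \<phi>" "compact (supp \<phi>)"
    unfolding \<phi>_def using smooth_affine[OF \<psi>(1), of 0 c] compact_supp_scaled[OF \<psi>(2) c] by auto
  have pd: "partial_deriv i \<phi> x = c * partial_deriv i \<psi> (c *\<^sub>R x)" for i x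
    unfolding \<phi>_def using partial_deriv_affine[OF \<psi>(1), of i 0 c x] by simp
  have "mollify \<psi> c u = (\<lambda>y. c ^ CARD('n) * (\<integral>x. u x * \<phi> (y - x) \<partial>lborel))"
    unfolding mollify_def integral_mult_right_zero[symmetric] \<phi>_def
    by (intro ext Bochner_Integration.integral_cong) auto
  moreover have "((\<lambda>y. c ^ CARD('n) * (\<integral>x. u x * \<phi> (y - x) \<partial>lborel)) has_derivative
     (\<lambda>h. c ^ CARD('n) * (\<Sum>i\<in>UNIV. h $ i * (\<integral>x. u x * partial_deriv i \<phi> (y - x) \<partial>lborel)))) (at y)"
    by (intro has_derivative_mult_right convolution_has_derivative u \<phi>)
  ultimately show ?thesis by (simp add: pd sum_distrib_left ac_simps)
qed

lemma mollify_continuous_on: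
  assumes "smooth \<psi>" "supp \<psi> \<subseteq> cball 0 r" "0 < c" "integrable lborel u"
  shows "continuous_on UNIV (mollify \<psi> c u)"
  using mollify_has_derivative_kernel[OF assms]
  by (intro continuous_at_imp_continuous_on ballI has_derivative_continuous)

text \<open>The derivative in \<open>y\<close> falls on the kernel. With respect to \<open>x\<close>
  the kernel has the opposite derivative, and this sign cancels the one from the integration by
  parts.\<close>

lemma mollify_weak_jet_has_derivative:
  fixes V :: "('n::finite \<Rightarrow> nat) \<Rightarrow> real^'n \<Rightarrow> real"
  assumes \<psi>: "smooth \<psi>" "supp \<psi> \<subseteq> cball 0 r" and c: "0 < c" and V: "weak_jet m S V"
    and x: "cball y (r / c) \<subseteq> interior S" and g: "mi_order \<gamma> \<le> m"
  shows "(mollify \<psi> c (V \<gamma>) has_derivative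
    (\<lambda>h. \<Sum>i\<in>UNIV. h $ i * mollify \<psi> c (V (\<gamma>(i := Suc (\<gamma> i)))) y)) (at y)"
proof -
  have V1: "integrable lborel (V \<gamma>)" for \<gamma> using V by (simp add: weak_jet_def)
  have "c ^ CARD('n) * (\<integral>x. V \<gamma> x * (c * partial_deriv i \<psi> (c *\<^sub>R (y - x))) \<partial>lborel) =
    mollify \<psi> c (V (\<gamma>(i := Suc (\<gamma> i)))) y" for i
  proof -
    let ?\<phi> = "\<lambda>x. \<psi> (c *\<^sub>R (y - x))"
    have pd: "partial_deriv i ?\<phi> x = - c * partial_deriv i \<psi> (c *\<^sub>R (y - x))" for x
      using partial_deriv_affine[OF \<psi>(1), of i "c *\<^sub>R y" "- c" x] by (simp add: scaleR_diff_right)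
    have "test_function S ?\<phi>" by (rule test_function_scaled[OF \<psi> c x])
    then have "(\<integral>x. V \<gamma> x * partial_deriv i ?\<phi> x \<partial>lborel) = - (\<integral>x. V (\<gamma>(i := Suc (\<gamma> i))) x * ?\<phi> x \<partial>lborel)"
      using V g by (simp add: weak_jet_def)
    moreover have "(\<integral>x. V \<gamma> x * partial_deriv i ?\<phi> x \<partial>lborel) =
       - (\<integral>x. V \<gamma> x * (c * partial_deriv i \<psi> (c *\<^sub>R (y - x))) \<partial>lborel)"
      unfolding pd by (subst Bochner_Integration.integral_minus[symmetric]) (simp add: ac_simps)
    ultimately have "(\<integral>x. V \<gamma> x * (c * partial_deriv i \<psi> (c *\<^sub>R (y - x))) \<partial>lborel) =
       (\<integral>x. V (\<gamma>(i := Suc (\<gamma> i))) x * ?\<phi> x \<partial>lborel)" by simp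
    then show ?thesis
      unfolding mollify_def by (simp add: mult.left_commute)
  qed
  then show ?thesis using mollify_has_derivative_kernel[OF \<psi> c V1, of \<gamma> y] by simp
qed

lemma seg_avg_swap:
  assumes [measurable]: "f \<in> borel_measurable borel"
  shows "seg_avg z \<delta> f y = (\<integral>\<^sup>+w\<in>ball z \<delta>. (\<integral>\<^sup>+s\<in>{0<..<1}. f (y + s *\<^sub>R (w - y)) \<partial>lborel) \<partial>lborel)"
proof -
  have "seg_avg z \<delta> f y = (\<integral>\<^sup>+s. \<integral>\<^sup>+w. f (y + s *\<^sub>R (w - y)) * indicator (ball z \<delta>) w * indicator {0<..<1} s \<partial>lborel \<partial>lborel)"
    unfolding seg_avg_def by (intro nn_integral_cong, rule nn_integral_multc[symmetric]) measurable
  also have "\<dots> = (\<integral>\<^sup>+w. \<integral>\<^sup>+s. f (y + s *\<^sub>R (w - y)) * indicator (ball z \<delta>) w * indicator {0<..<1} s \<partial>lborel \<partial>lborel)"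
    by (rule lborel_pair.Fubini') measurable
  also have "\<dots> = (\<integral>\<^sup>+w\<in>ball z \<delta>. (\<integral>\<^sup>+s\<in>{0<..<1}. f (y + s *\<^sub>R (w - y)) \<partial>lborel) \<partial>lborel)"
  proof (rule nn_integral_cong)
    fix w
    have "(\<integral>\<^sup>+s. f (y + s *\<^sub>R (w - y)) * indicator (ball z \<delta>) w * indicator {0<..<1} s \<partial>lborel) =
       (\<integral>\<^sup>+s. (f (y + s *\<^sub>R (w - y)) * indicator {0<..<1} s) * indicator (ball z \<delta>) w \<partial>lborel)"
      by (simp add: ac_simps)
    also have "\<dots> = (\<integral>\<^sup>+s\<in>{0<..<1}. f (y + s *\<^sub>R (w - y)) \<partial>lborel) * indicator (ball z \<delta>) w"
      by (rule nn_integral_multc) measurable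
    finally show "(\<integral>\<^sup>+s. f (y + s *\<^sub>R (w - y)) * indicator (ball z \<delta>) w * indicator {0<..<1} s \<partial>lborel) =
      (\<integral>\<^sup>+s\<in>{0<..<1}. f (y + s *\<^sub>R (w - y)) \<partial>lborel) * indicator (ball z \<delta>) w" .
  qed
  finally show ?thesis .
qed

text \<open>Both \<open>x\<close> and \<open>y\<close> are joined to every point \<open>w\<close> of a small ball, and the inequality is averaged over \<open>w\<close>.\<close>
lemma smooth_jet_remainder:
  fixes G :: "('n::finite \<Rightarrow> nat) \<Rightarrow> real^'n \<Rightarrow> real"
  assumes G: "\<And>\<gamma> x. mi_order \<gamma> \<le> m \<Longrightarrow> x \<in> S \<Longrightarrow>
     (G \<gamma> has_derivative (\<lambda>h. \<Sum>i\<in>UNIV. h $ i * G (\<gamma>(i := Suc (\<gamma> i))) x)) (at x)"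
    and cont: "\<And>\<gamma>. continuous_on UNIV (G \<gamma>)"
    and S: "S \<subseteq> cball z d" and \<delta>: "\<delta> \<le> d"
    and star: "\<And>w x s. w \<in> ball z \<delta> \<Longrightarrow> x \<in> S \<Longrightarrow> s \<in> {0..1} \<Longrightarrow> x + s *\<^sub>R (w - x) \<in> S"
    and xy: "x \<in> S" "y \<in> S"
  shows "emeasure lborel (ball z \<delta>) * ennreal \<bar>G (\<lambda>_. 0) y - jet_poly m G x y\<bar>
    \<le> ennreal ((2 * d) ^ Suc m) * (seg_avg z \<delta> (\<lambda>x. ennreal (top_jet m G x)) y + seg_avg z \<delta> (\<lambda>x. ennreal (top_jet m G x)) x)"
proof -
  let ?f = "\<lambda>x. ennreal (top_jet m G x)"
  define I where "I x w = (\<integral>\<^sup>+s\<in>{0<..<1}. ?f (x + s *\<^sub>R (w - x)) \<partial>lborel)" for x w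
  have "continuous_on UNIV (top_jet m G)"
    unfolding top_jet_def by (intro continuous_intros cont)
  then have [measurable]: "top_jet m G \<in> borel_measurable borel" by (rule borel_measurable_continuous_onI)
  have [measurable]: "I x \<in> borel_measurable borel" for x unfolding I_def by measurable
  have close: "norm (a - b) \<le> 2 * d" if "a \<in> cball z d" "b \<in> cball z d" for a b
    using dist_triangle[of a b z] that by (simp add: dist_norm[symmetric] dist_commute)
  have seg: "ennreal \<bar>jet_poly m G w y - jet_poly m G x' y\<bar> \<le> ennreal ((2 * d) ^ Suc m) * I x' w"
    if "w \<in> ball z \<delta>" "x' \<in> S" for x' w
    unfolding I_def
  proof (rule jet_poly_segment[OF _ cont])
    fix \<gamma> :: "'n \<Rightarrow> nat" and s :: real assume "mi_order \<gamma> \<le> m" "s \<in> {0..1}"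
    then show "(G \<gamma> has_derivative (\<lambda>h. \<Sum>i\<in>UNIV. h $ i * G (\<gamma>(i := Suc (\<gamma> i))) (x' + s *\<^sub>R (w - x')))) (at (x' + s *\<^sub>R (w - x')))"
      using G star that by blast
  next
    show "norm (w - x') \<le> 2 * d" using that S \<delta> by (intro close) auto
    fix s :: real assume "s \<in> {0..1}"
    then show "norm (y - (x' + s *\<^sub>R (w - x'))) \<le> 2 * d"
      using star[OF that, of s] xy S by (intro close) auto
  qed
  have pt: "ennreal \<bar>G (\<lambda>_. 0) y - jet_poly m G x y\<bar> \<le> ennreal ((2 * d) ^ Suc m) * (I y w + I x w)"
    if w: "w \<in> ball z \<delta>" for w
  proof -
    \<comment> \<open>With centre \<open>y\<close> the polynomial takes at \<open>y\<close> the
      value \<open>G (\<lambda>_. 0) y\<close>, so the remainder splits along the path from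
      \<open>y\<close> over \<open>w\<close> to \<open>x\<close>.\<close>
    have "\<bar>G (\<lambda>_. 0) y - jet_poly m G x y\<bar> \<le> \<bar>jet_poly m G w y - jet_poly m G y y\<bar> + \<bar>jet_poly m G w y - jet_poly m G x y\<bar>"
      unfolding jet_poly_same by linarith
    then have "ennreal \<bar>G (\<lambda>_. 0) y - jet_poly m G x y\<bar> \<le>
        ennreal \<bar>jet_poly m G w y - jet_poly m G y y\<bar> + ennreal \<bar>jet_poly m G w y - jet_poly m G x y\<bar>"
      by (simp add: ennreal_leI flip: ennreal_plus)
    also have "\<dots> \<le> ennreal ((2 * d) ^ Suc m) * I y w + ennreal ((2 * d) ^ Suc m) * I x w"
      using xy by (intro add_mono seg w) auto
    finally show ?thesis by (simp add: distrib_left)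
  qed
  have "emeasure lborel (ball z \<delta>) * ennreal \<bar>G (\<lambda>_. 0) y - jet_poly m G x y\<bar> =
     (\<integral>\<^sup>+w\<in>ball z \<delta>. ennreal \<bar>G (\<lambda>_. 0) y - jet_poly m G x y\<bar> \<partial>lborel)"
    by (subst nn_integral_cmult_indicator) (auto simp: mult.commute)
  also have "\<dots> \<le> (\<integral>\<^sup>+w. ennreal ((2 * d) ^ Suc m) * (I y w * indicator (ball z \<delta>) w + I x w * indicator (ball z \<delta>) w) \<partial>lborel)"
    using pt by (intro nn_integral_mono) (auto simp: indicator_def)
  also have "\<dots> = ennreal ((2 * d) ^ Suc m) * (\<integral>\<^sup>+w. I y w * indicator (ball z \<delta>) w + I x w * indicator (ball z \<delta>) w \<partial>lborel)"
    by (rule nn_integral_cmult) measurable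
  also have "(\<integral>\<^sup>+w. I y w * indicator (ball z \<delta>) w + I x w * indicator (ball z \<delta>) w \<partial>lborel) = seg_avg z \<delta> ?f y + seg_avg z \<delta> ?f x"
    by (subst nn_integral_add) (auto simp: seg_avg_swap I_def)
  finally show ?thesis .
qed

section \<open>Passage to the limit in the mollification\<close>

lemma ennreal_eq_0_if_le_mult:
  fixes X C :: ennreal
  assumes "\<And>e. e > 0 \<Longrightarrow> X \<le> C * ennreal e" "C < top"
  shows "X = 0"
proof -
  obtain c where c: "c \<ge> 0" "C = ennreal c" using assms(2) by (cases C) auto
  have "X \<le> 0"
  proof (rule ennreal_le_epsilon)
    fix e :: real assume e: "e > 0"
    have "X \<le> C * ennreal (e / (c + 1))" using e c by (intro assms(1)) auto
    also have "\<dots> = ennreal (c * (e / (c + 1)))" unfolding c(2) by (rule ennreal_mult'[OF c(1), symmetric])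
    also have "\<dots> \<le> ennreal e" using c e by (intro ennreal_leI) (auto simp: field_simps)
    finally show "X \<le> 0 + ennreal e" by simp
  qed
  then show ?thesis by simp
qed

lemma jet_poly_diff_le:
  fixes G V :: "('n::finite \<Rightarrow> nat) \<Rightarrow> real^'n \<Rightarrow> real"
  assumes "norm (y - x) \<le> D"
  shows "\<bar>jet_poly m G x y - jet_poly m V x y\<bar> \<le> (1 + D) ^ m * (\<Sum>\<alpha> | mi_order \<alpha> \<le> m. \<bar>G \<alpha> x - V \<alpha> x\<bar>)"
proof -
  have D: "D \<ge> 0" using assms norm_ge_zero order_trans by blast
  have "\<bar>jet_poly m G x y - jet_poly m V x y\<bar> = \<bar>\<Sum>\<alpha> | mi_order \<alpha> \<le> m. 1 / mi_fact \<alpha> * (G \<alpha> x - V \<alpha> x) * mi_power (y - x) \<alpha>\<bar>"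
    unfolding jet_poly_def sum_subtractf[symmetric] by (simp add: algebra_simps)
  also have "\<dots> \<le> (\<Sum>\<alpha> | mi_order \<alpha> \<le> m. \<bar>1 / mi_fact \<alpha> * (G \<alpha> x - V \<alpha> x) * mi_power (y - x) \<alpha>\<bar>)" by (rule sum_abs)
  also have "\<dots> \<le> (\<Sum>\<alpha> | mi_order \<alpha> \<le> m. (1 + D) ^ m * \<bar>G \<alpha> x - V \<alpha> x\<bar>)"
  proof (rule sum_mono)
    fix \<alpha> :: "'n \<Rightarrow> nat" assume "\<alpha> \<in> {\<alpha>. mi_order \<alpha> \<le> m}"
    then have a: "mi_order \<alpha> \<le> m" by simp
    have "\<bar>mi_power (y - x) \<alpha>\<bar> \<le> norm (y - x) ^ mi_order \<alpha>" by (rule abs_mi_power_le)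
    also have "\<dots> \<le> (1 + D) ^ mi_order \<alpha>" using assms by (intro power_mono) auto
    \<comment> \<open>The 1 in \<open>1 + D\<close> makes the powers increase, so that one bound
      serves all orders up to \<open>m\<close>.\<close>
    also have "\<dots> \<le> (1 + D) ^ m" using a D by (intro power_increasing) auto
    finally have 2: "\<bar>mi_power (y - x) \<alpha>\<bar> \<le> (1 + D) ^ m" .
    have 3: "\<bar>1 / mi_fact \<alpha>\<bar> \<le> 1" using mi_fact_ge_1[of \<alpha>] by simp
    have "\<bar>1 / mi_fact \<alpha> * (G \<alpha> x - V \<alpha> x) * mi_power (y - x) \<alpha>\<bar> =
      \<bar>1 / mi_fact \<alpha>\<bar> * \<bar>G \<alpha> x - V \<alpha> x\<bar> * \<bar>mi_power (y - x) \<alpha>\<bar>" by (simp only: abs_mult)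
    also have "\<dots> \<le> 1 * \<bar>G \<alpha> x - V \<alpha> x\<bar> * (1 + D) ^ m" using 2 3 by (intro mult_mono) auto
    finally show "\<bar>1 / mi_fact \<alpha> * (G \<alpha> x - V \<alpha> x) * mi_power (y - x) \<alpha>\<bar> \<le> (1 + D) ^ m * \<bar>G \<alpha> x - V \<alpha> x\<bar>"
      by (simp add: mult.commute)
  qed
  finally show ?thesis by (simp add: sum_distrib_left)
qed

lemma top_jet_triangle: "top_jet m G x \<le> top_jet m V x + top_jet m (\<lambda>\<alpha> x. G \<alpha> x - V \<alpha> x) x"
  unfolding top_jet_def sum.distrib[symmetric] by (intro sum_mono) auto

lemma measurable_vec_nth [measurable (raw)]:
  fixes f :: "'a \<Rightarrow> real^'n"
  assumes "f \<in> borel_measurable M"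
  shows "(\<lambda>x. f x $ i) \<in> borel_measurable M"
  by (rule measurable_compose[OF assms borel_measurable_continuous_onI]) (intro continuous_intros)

text \<open>The mollified jets satisfy the inequality at every pair of points of \<open>S\<close>.
  Their errors tend to 0 in L1: those of the jets by \<open>mollify_L1\<close>, those of the segment
  averages by \<open>seg_avg_L1_bound\<close>. So the integrated excess of the left side over the
  right is smaller than every positive number, without any passage to subsequences.\<close>

lemma taylor_remainder_AE_on:
  fixes V :: "('n::finite \<Rightarrow> nat) \<Rightarrow> real^'n \<Rightarrow> real"
    and \<psi> :: "real^'n \<Rightarrow> real"
  assumes \<psi>: "smooth \<psi>" "(\<integral>x. \<psi> x \<partial>lborel) = 1" "supp \<psi> \<subseteq> cball 0 r"
    and V: "weak_jet m D V" and S: "compact S" "S \<subseteq> cball z d" and \<delta>: "\<delta> \<le> d"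
    and star: "\<And>w x s. w \<in> ball z \<delta> \<Longrightarrow> x \<in> S \<Longrightarrow> s \<in> {0..1} \<Longrightarrow> x + s *\<^sub>R (w - x) \<in> S"
    and \<rho>: "\<rho> > 0" "\<And>x. x \<in> S \<Longrightarrow> cball x \<rho> \<subseteq> interior D"
  shows "AE y in lborel. AE x in lborel. y \<in> S \<longrightarrow> x \<in> S \<longrightarrow>
    emeasure lborel (ball z \<delta>) * ennreal \<bar>V (\<lambda>_. 0) y - jet_poly m V x y\<bar>
    \<le> ennreal ((2 * d) ^ Suc m) * (seg_avg z \<delta> (\<lambda>x. ennreal (top_jet m V x)) y + seg_avg z \<delta> (\<lambda>x. ennreal (top_jet m V x)) x)"
proof (cases "S = {}")
  case False
  then have d: "d \<ge> 0" using S(2) dist_not_less_zero[of z] by (force intro: order_trans[OF zero_le_dist])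
  have Vi: "integrable lborel (V \<gamma>)" for \<gamma> using V by (simp add: weak_jet_def)
  then have [measurable]: "V \<gamma> \<in> borel_measurable borel" for \<gamma> by auto
  note [measurable] = smooth_borel_measurable[OF \<psi>(1)]
  have [measurable]: "S \<in> sets borel" using S(1) by (rule borel_compact)
  obtain B where B: "\<And>x. \<bar>\<psi> x\<bar> \<le> B"
    using smooth_compact_supp_bounded[OF \<psi>(1) compact_supp_subset_cball[OF \<psi>(3)]] by metis
  define \<beta> where "\<beta> = emeasure lborel (ball z \<delta>)"
  define K where "K = ennreal ((2 * d) ^ Suc m)"
  define P where "P = (1 + 2 * d) ^ m"
  have P: "P \<ge> 1" unfolding P_def using d by (intro one_le_power) auto
  define A where "A x y = \<beta> * ennreal \<bar>V (\<lambda>_. 0) y - jet_poly m V x y\<bar>" for x y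
  define F where "F = seg_avg z \<delta> (\<lambda>x. ennreal (top_jet m V x))"
  have [measurable]: "top_jet m V \<in> borel_measurable borel" unfolding top_jet_def by measurable
  have [measurable]: "F \<in> borel_measurable borel" unfolding F_def by measurable
  have [measurable]: "case_prod A \<in> borel_measurable (borel \<Otimes>\<^sub>M borel)"
    unfolding A_def case_prod_unfold jet_poly_def mi_power_def by measurable
  define N1 where "N1 = real (card {\<alpha> :: 'n \<Rightarrow> nat. mi_order \<alpha> \<le> m})"
  define N2 where "N2 = real (card {\<alpha> :: 'n \<Rightarrow> nat. mi_order \<alpha> = m}) * CARD('n)"
  define C where "C = \<beta> * ennreal P * ennreal N1 +
     K * (ennreal (2 ^ CARD('n)) * (emeasure lborel S + \<beta>) * ennreal N2)"
  \<comment> \<open>Subtraction is truncated at 0, so \<open>X\<close> integrates the positive part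
    of the excess.\<close>
  define X where "X = (\<integral>\<^sup>+y\<in>S. (\<integral>\<^sup>+x\<in>S. A x y - K * (F y + F x) \<partial>lborel) \<partial>lborel)"
  have finS: "emeasure lborel S < top" using S(1) emeasure_lborel_cbox_finite emeasure_compact_finite by auto
  have fin\<beta>: "\<beta> < top" unfolding \<beta>_def using emeasure_lborel_ball_finite by auto
  have finC: "emeasure lborel S * C + emeasure lborel S * C < top"
    using finS fin\<beta> by (simp add: C_def K_def ennreal_mult_less_top ennreal_mult_eq_top_iff less_top)
  have "X \<le> (emeasure lborel S * C + emeasure lborel S * C) * ennreal e" if e: "e > 0" for e
  proof -
    have "\<exists>c0>0. \<forall>c\<ge>c0. (\<integral>\<^sup>+y. ennreal \<bar>mollify \<psi> c (V \<gamma>) y - V \<gamma> y\<bar> \<partial>lborel) \<le> ennreal e" for \<gamma>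
      by (rule mollify_L1[OF _ \<psi>(2) B \<psi>(3) Vi e]) measurable
    then obtain c0 where c0: "\<And>\<gamma>. c0 \<gamma> > 0"
      "\<And>\<gamma> c. c \<ge> c0 \<gamma> \<Longrightarrow> (\<integral>\<^sup>+y. ennreal \<bar>mollify \<psi> c (V \<gamma>) y - V \<gamma> y\<bar> \<partial>lborel) \<le> ennreal e" by metis
    \<comment> \<open>Large enough for all of the finitely many orders that occur, and for the
      kernels to fit into balls of radius \<open>\<rho>\<close>.\<close>
    define c where "c = max (\<bar>r\<bar> / \<rho>) (Max (c0 ` {\<gamma>. mi_order \<gamma> \<le> Suc m}))"
    have c1: "c \<ge> c0 \<gamma>" if "mi_order \<gamma> \<le> Suc m" for \<gamma>
      unfolding c_def using that finite_mi_le by (intro max.coboundedI2 Max_ge) auto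
    have c: "c > 0" using c1[of "\<lambda>_. 0"] c0(1)[of "\<lambda>_. 0"] by (simp add: mi_order_def)
    have "\<bar>r\<bar> / \<rho> \<le> c" by (simp add: c_def)
    then have rc: "r / c \<le> \<rho>" using c \<rho> by (simp add: field_simps)
    define G where "G \<gamma> = mollify \<psi> c (V \<gamma>)" for \<gamma>
    define E where "E \<gamma> x = G \<gamma> x - V \<gamma> x" for \<gamma> x
    have [measurable]: "G \<gamma> \<in> borel_measurable borel" for \<gamma> unfolding G_def by measurable
    have [measurable]: "E \<gamma> \<in> borel_measurable borel" for \<gamma> unfolding E_def[abs_def] by measurable
    have [measurable]: "top_jet m G \<in> borel_measurable borel" "top_jet m E \<in> borel_measurable borel"
      unfolding top_jet_def by measurable
    have Ei: "(\<integral>\<^sup>+y. ennreal \<bar>E \<gamma> y\<bar> \<partial>lborel) \<le> ennreal e" if "mi_order \<gamma> \<le> Suc m" for \<gamma>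
      unfolding E_def G_def by (rule c0(2)[OF c1[OF that]])
    define L where "L x = (\<Sum>\<alpha> | mi_order \<alpha> \<le> m. ennreal \<bar>E \<alpha> x\<bar>)" for x
    have [measurable]: "L \<in> borel_measurable borel" unfolding L_def by measurable
    define FE where "FE = seg_avg z \<delta> (\<lambda>x. ennreal (top_jet m E x))"
    have [measurable]: "FE \<in> borel_measurable borel" unfolding FE_def by measurable
    \<comment> \<open>The error contributed by one point of the pair: from the jet itself and from
      its segment average.\<close>
    define H where "H x = \<beta> * ennreal P * L x + K * FE x" for x
    have [measurable]: "H \<in> borel_measurable borel" unfolding H_def by measurable
    have L_real: "L x = ennreal (\<Sum>\<alpha> | mi_order \<alpha> \<le> m. \<bar>E \<alpha> x\<bar>)" for x
      unfolding L_def by (simp add: sum_ennreal)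
    have "(\<integral>\<^sup>+x. L x \<partial>lborel) = (\<Sum>\<alpha>\<in>{\<alpha> :: 'n \<Rightarrow> nat. mi_order \<alpha> \<le> m}. \<integral>\<^sup>+x. ennreal \<bar>E \<alpha> x\<bar> \<partial>lborel)"
      unfolding L_def by (rule nn_integral_sum) measurable
    also have "\<dots> \<le> (\<Sum>\<alpha>\<in>{\<alpha> :: 'n \<Rightarrow> nat. mi_order \<alpha> \<le> m}. ennreal e)"
      by (intro sum_mono Ei) auto
    also have "\<dots> = ennreal N1 * ennreal e" by (simp add: N1_def ennreal_of_nat_eq_real_of_nat)
    finally have intL: "(\<integral>\<^sup>+x. L x \<partial>lborel) \<le> ennreal N1 * ennreal e" .
    have "(\<integral>\<^sup>+x. ennreal (top_jet m E x) \<partial>lborel) =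
       (\<integral>\<^sup>+x. (\<Sum>\<gamma> | mi_order \<gamma> = m. \<Sum>i\<in>UNIV. ennreal \<bar>E (\<gamma>(i := Suc (\<gamma> i))) x\<bar>) \<partial>lborel)"
      unfolding top_jet_def by (simp add: sum_ennreal sum_nonneg)
    also have "\<dots> = (\<Sum>\<gamma>\<in>{\<gamma> :: 'n \<Rightarrow> nat. mi_order \<gamma> = m}. \<Sum>i\<in>UNIV. \<integral>\<^sup>+x. ennreal \<bar>E (\<gamma>(i := Suc (\<gamma> i))) x\<bar> \<partial>lborel)"
      by (simp add: nn_integral_sum del: sum_ennreal)
    also have "\<dots> \<le> (\<Sum>\<gamma>\<in>{\<gamma> :: 'n \<Rightarrow> nat. mi_order \<gamma> = m}. \<Sum>i\<in>(UNIV::'n set). ennreal e)"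
      by (intro sum_mono Ei) (auto simp: mi_order_upd)
    also have "\<dots> = ennreal N2 * ennreal e" by (simp add: N2_def ennreal_mult mult.assoc ennreal_of_nat_eq_real_of_nat)
    finally have intT: "(\<integral>\<^sup>+x. ennreal (top_jet m E x) \<partial>lborel) \<le> ennreal N2 * ennreal e" .
    have intFE: "(\<integral>\<^sup>+x\<in>S. FE x \<partial>lborel) \<le> ennreal (2 ^ CARD('n)) * (emeasure lborel S + \<beta>) * (ennreal N2 * ennreal e)"
    proof -
      have "(\<integral>\<^sup>+x\<in>S. FE x \<partial>lborel) \<le> ennreal (2 ^ DIM(real^'n)) * (emeasure lborel S + \<beta>) * (\<integral>\<^sup>+x. ennreal (top_jet m E x) \<partial>lborel)"
        unfolding FE_def \<beta>_def by (rule seg_avg_L1_bound) measurable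
      also have "\<dots> \<le> ennreal (2 ^ DIM(real^'n)) * (emeasure lborel S + \<beta>) * (ennreal N2 * ennreal e)"
        by (intro mult_left_mono intT) auto
      finally show ?thesis by simp
    qed
    have intH: "(\<integral>\<^sup>+x\<in>S. H x \<partial>lborel) \<le> C * ennreal e"
    proof -
      have "(\<integral>\<^sup>+x\<in>S. H x \<partial>lborel) = (\<integral>\<^sup>+x. \<beta> * ennreal P * (L x * indicator S x) + K * (FE x * indicator S x) \<partial>lborel)"
        by (intro nn_integral_cong) (simp add: H_def distrib_right mult.assoc)
      also have "\<dots> = \<beta> * ennreal P * (\<integral>\<^sup>+x\<in>S. L x \<partial>lborel) + K * (\<integral>\<^sup>+x\<in>S. FE x \<partial>lborel)"
        by (subst nn_integral_add) (auto simp: nn_integral_cmult)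
      also have "(\<integral>\<^sup>+x\<in>S. L x \<partial>lborel) \<le> (\<integral>\<^sup>+x. L x \<partial>lborel)"
        by (intro nn_integral_mono) (auto simp: indicator_def)
      also note intL
      also note intFE
      finally show ?thesis by (simp add: C_def distrib_right mult.assoc mult_left_mono add_mono)
    qed
    have pt: "A x y - K * (F y + F x) \<le> H y + H x" if xy: "x \<in> S" "y \<in> S" for x y
    proof -
      have dxy: "norm (y - x) \<le> 2 * d"
      proof -
        have "dist z x \<le> d" "dist z y \<le> d" using xy S(2) by auto
        then show ?thesis using dist_triangle[of y x z] by (simp add: dist_norm[symmetric] dist_commute)
      qed
      have 1: "\<beta> * ennreal \<bar>G (\<lambda>_. 0) y - jet_poly m G x y\<bar> \<le>
         K * (seg_avg z \<delta> (\<lambda>x. ennreal (top_jet m G x)) y + seg_avg z \<delta> (\<lambda>x. ennreal (top_jet m G x)) x)"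
        unfolding \<beta>_def K_def
      proof (rule smooth_jet_remainder[OF _ _ S(2) \<delta> star xy])
        show "continuous_on UNIV (G \<gamma>)" for \<gamma>
          unfolding G_def by (rule mollify_continuous_on[OF \<psi>(1,3) c Vi])
        fix \<gamma> :: "'n \<Rightarrow> nat" and x assume g: "mi_order \<gamma> \<le> m" and x: "x \<in> S"
        have "cball x (r / c) \<subseteq> interior D" using \<rho>(2)[OF x] subset_cball[OF rc] by blast
        then show "(G \<gamma> has_derivative (\<lambda>h. \<Sum>i\<in>UNIV. h $ i * G (\<gamma>(i := Suc (\<gamma> i))) x)) (at x)"
          unfolding G_def by (intro mollify_weak_jet_has_derivative[OF \<psi>(1,3) c V] g)
      qed
      have 2: "seg_avg z \<delta> (\<lambda>x. ennreal (top_jet m G x)) a \<le> F a + FE a" for a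
      proof -
        have "seg_avg z \<delta> (\<lambda>x. ennreal (top_jet m G x)) a \<le>
          seg_avg z \<delta> (\<lambda>x. ennreal (top_jet m V x) + ennreal (top_jet m E x)) a"
          unfolding E_def using top_jet_triangle[of m G _ V]
          by (intro seg_avg_mono) (simp add: ennreal_leI top_jet_nonneg flip: ennreal_plus)
        also have "\<dots> = F a + FE a" unfolding F_def FE_def by (rule seg_avg_add) measurable
        finally show ?thesis .
      qed
      have 3: "ennreal \<bar>E (\<lambda>_. 0) y\<bar> \<le> L y"
        unfolding L_def
        by (rule member_le_sum[where f = "\<lambda>\<alpha>. ennreal \<bar>E \<alpha> y\<bar>", OF _ _ finite_mi_le]) (auto simp: mi_order_def)
      also have "L y \<le> ennreal P * L y" using P mult_right_mono[of 1 "ennreal P" "L y"] by simp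
      finally have 3: "ennreal \<bar>E (\<lambda>_. 0) y\<bar> \<le> ennreal P * L y" .
      have 4: "ennreal \<bar>jet_poly m G x y - jet_poly m V x y\<bar> \<le> ennreal P * L x"
        using jet_poly_diff_le[OF dxy, of m G V] P
        unfolding L_real P_def E_def by (simp add: ennreal_leI flip: ennreal_mult')
      have "\<bar>V (\<lambda>_. 0) y - jet_poly m V x y\<bar> \<le> \<bar>E (\<lambda>_. 0) y\<bar> + \<bar>G (\<lambda>_. 0) y - jet_poly m G x y\<bar> + \<bar>jet_poly m G x y - jet_poly m V x y\<bar>"
        unfolding E_def by linarith
      then have "ennreal \<bar>V (\<lambda>_. 0) y - jet_poly m V x y\<bar> \<le>
         ennreal \<bar>E (\<lambda>_. 0) y\<bar> + ennreal \<bar>G (\<lambda>_. 0) y - jet_poly m G x y\<bar> + ennreal \<bar>jet_poly m G x y - jet_poly m V x y\<bar>"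
        by (simp add: ennreal_leI flip: ennreal_plus)
      also have "\<dots> \<le> ennreal P * L y + ennreal \<bar>G (\<lambda>_. 0) y - jet_poly m G x y\<bar> + ennreal P * L x"
        by (intro add_mono 3 4 order_refl)
      finally have "A x y \<le> \<beta> * (ennreal P * L y + ennreal \<bar>G (\<lambda>_. 0) y - jet_poly m G x y\<bar> + ennreal P * L x)"
        unfolding A_def by (rule mult_left_mono) simp
      also have "\<dots> = \<beta> * ennreal P * L y + \<beta> * ennreal \<bar>G (\<lambda>_. 0) y - jet_poly m G x y\<bar> + \<beta> * ennreal P * L x"
        by (simp add: distrib_left mult.assoc)
      also have "\<dots> \<le> \<beta> * ennreal P * L y + K * ((F y + FE y) + (F x + FE x)) + \<beta> * ennreal P * L x"
        by (intro add_mono order_refl order_trans[OF 1] mult_left_mono 2) auto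
      also have "\<dots> = K * (F y + F x) + (H y + H x)"
        by (simp add: H_def distrib_left ac_simps)
      finally have "A x y \<le> K * (F y + F x) + (H y + H x)" .
      moreover have "A x y \<noteq> top" using fin\<beta> by (auto simp: A_def ennreal_mult_eq_top_iff)
      ultimately show ?thesis by (simp add: ennreal_minus_le_iff)
    qed
    have "X \<le> (\<integral>\<^sup>+y. \<integral>\<^sup>+x. H y * indicator S y * indicator S x + H x * indicator S x * indicator S y \<partial>lborel \<partial>lborel)"
      unfolding X_def
    proof (rule nn_integral_mono)
      fix y
      have "(\<integral>\<^sup>+x\<in>S. A x y - K * (F y + F x) \<partial>lborel) * indicator S y =
         (\<integral>\<^sup>+x. (A x y - K * (F y + F x)) * indicator S x * indicator S y \<partial>lborel)"
        by (rule nn_integral_multc[symmetric]) measurable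
      also have "\<dots> \<le> (\<integral>\<^sup>+x. H y * indicator S y * indicator S x + H x * indicator S x * indicator S y \<partial>lborel)"
        using pt by (intro nn_integral_mono) (auto simp: indicator_def)
      finally show "(\<integral>\<^sup>+x\<in>S. A x y - K * (F y + F x) \<partial>lborel) * indicator S y \<le> \<dots>" .
    qed
    also have "\<dots> = (\<integral>\<^sup>+y. H y * indicator S y * emeasure lborel S + (\<integral>\<^sup>+x\<in>S. H x \<partial>lborel) * indicator S y \<partial>lborel)"
      by (intro nn_integral_cong, subst nn_integral_add) (auto simp: nn_integral_multc nn_integral_cmult)
    also have "\<dots> = (\<integral>\<^sup>+x\<in>S. H x \<partial>lborel) * emeasure lborel S + (\<integral>\<^sup>+x\<in>S. H x \<partial>lborel) * emeasure lborel S"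
      by (subst nn_integral_add) (auto simp: nn_integral_multc nn_integral_cmult)
    also have "\<dots> \<le> (C * ennreal e) * emeasure lborel S + (C * ennreal e) * emeasure lborel S"
      by (intro add_mono mult_right_mono intH) auto
    also have "\<dots> = (emeasure lborel S * C + emeasure lborel S * C) * ennreal e"
      by (simp add: distrib_right distrib_left ac_simps)
    finally show ?thesis .
  qed
  then have "X = 0" using finC by (rule ennreal_eq_0_if_le_mult)
  then have "AE y in lborel. (\<integral>\<^sup>+x\<in>S. A x y - K * (F y + F x) \<partial>lborel) * indicator S y = 0"
    unfolding X_def by (subst (asm) nn_integral_0_iff_AE) auto
  then show ?thesis
  proof eventually_elim
    case (elim y)
    show ?case
    proof (cases "y \<in> S")
      case True
      then have "(\<integral>\<^sup>+x\<in>S. A x y - K * (F y + F x) \<partial>lborel) = 0" using elim by simp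
      then have "AE x in lborel. (A x y - K * (F y + F x)) * indicator S x = 0"
        by (subst (asm) nn_integral_0_iff_AE) auto
      then show ?thesis
        by eventually_elim (auto simp: ennreal_minus_eq_0 A_def K_def F_def \<beta>_def indicator_def split: if_splits)
    qed simp
  qed
qed simp

lemma cball_subset_interior:
  assumes "ball x \<rho> \<subseteq> S" "0 < \<rho>" shows "cball x (\<rho> / 2) \<subseteq> interior S"
proof -
  have "cball x (\<rho> / 2) \<subseteq> ball x \<rho>" using assms(2) by (auto simp: subset_eq)
  also have "ball x \<rho> \<subseteq> interior S" using assms(1) by (simp add: interior_maximal)
  finally show ?thesis .
qed

text \<open>The remainder estimate holds on the shrunken sets \<open>z + \<lambda> (S - z)\<close>, which are compactly contained in the interior.\<close>
lemma taylor_remainder_AE: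
  fixes V :: "('n::finite \<Rightarrow> nat) \<Rightarrow> real^'n \<Rightarrow> real"
    and \<psi> :: "real^'n \<Rightarrow> real"
  assumes \<psi>: "smooth \<psi>" "(\<integral>x. \<psi> x \<partial>lborel) = 1" "supp \<psi> \<subseteq> cball 0 r"
    and V: "weak_jet m S V" and S: "compact S" "S \<subseteq> cball z d" and \<delta>: "0 < \<delta>" "\<delta> \<le> d"
    and star: "\<And>w x s. w \<in> cball z \<delta> \<Longrightarrow> x \<in> S \<Longrightarrow> s \<in> {0..1} \<Longrightarrow> w + s *\<^sub>R (x - w) \<in> S"
  shows "AE y in lborel. AE x in lborel. y \<in> interior S \<longrightarrow> x \<in> interior S \<longrightarrow>
    emeasure lborel (ball z (\<delta> / 2)) * ennreal \<bar>V (\<lambda>_. 0) y - jet_poly m V x y\<bar>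
    \<le> ennreal ((2 * d) ^ Suc m) *
      (seg_avg z (\<delta> / 2) (\<lambda>x. ennreal (top_jet m V x)) y + seg_avg z (\<delta> / 2) (\<lambda>x. ennreal (top_jet m V x)) x)"
    (is "AE y in lborel. AE x in lborel. _ \<longrightarrow> _ \<longrightarrow> ?ineq x y")
proof -
  define S' where "S' l = (\<lambda>x. z + l *\<^sub>R (x - z)) ` S" for l
  have part: "AE y in lborel. AE x in lborel. y \<in> S' l \<longrightarrow> x \<in> S' l \<longrightarrow> ?ineq x y" if l: "1 / 2 \<le> l" "l < 1" for l
  proof (rule taylor_remainder_AE_on[OF \<psi> V])
    show "compact (S' l)" unfolding S'_def using S(1)
      by (intro compact_continuous_image continuous_intros)
    show "S' l \<subseteq> cball z d"
    proof
      fix y assume "y \<in> S' l"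
      then obtain x where x: "x \<in> S" "y = z + l *\<^sub>R (x - z)" by (auto simp: S'_def)
      then have "dist z y = l * dist z x" using l by (simp add: dist_norm norm_minus_commute)
      also have "\<dots> \<le> 1 * d" using l x S(2) by (intro mult_mono) auto
      finally show "y \<in> cball z d" by simp
    qed
    show "\<delta> / 2 \<le> d" using \<delta> by simp
    show "x + s *\<^sub>R (w - x) \<in> S' l" if win: "w \<in> ball z (\<delta> / 2)" and xin: "x \<in> S' l" and sin: "s \<in> {0..1}" for w x s
    proof -
      obtain x0 where x0: "x0 \<in> S" "x = z + l *\<^sub>R (x0 - z)" using xin by (auto simp: S'_def)
      \<comment> \<open>Undoing the contraction by \<open>l \<ge> 1 / 2\<close> at most doubles the
        distance from \<open>z\<close>; hence the ball of radius
        \<open>\<delta> / 2\<close>.\<close>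
      define w0 where "w0 = z + (1 / l) *\<^sub>R (w - z)"
      have w: "w = z + l *\<^sub>R (w0 - z)" using l by (simp add: w0_def)
      have "dist z w0 = dist z w / l" using l by (simp add: w0_def dist_norm norm_minus_commute)
      also have "\<dots> \<le> (\<delta> / 2) / l" using win l by (intro divide_right_mono) auto
      also have "\<dots> \<le> (\<delta> / 2) / (1 / 2)" using l \<delta> by (intro divide_left_mono) auto
      finally have "w0 \<in> cball z \<delta>" by simp
      then have "w0 + (1 - s) *\<^sub>R (x0 - w0) \<in> S" using star[of w0 x0 "1 - s"] x0 sin by simp
      moreover have "x + s *\<^sub>R (w - x) = z + l *\<^sub>R ((w0 + (1 - s) *\<^sub>R (x0 - w0)) - z)"
        unfolding w x0(2) by (simp add: algebra_simps)
      ultimately show ?thesis unfolding S'_def by blast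
    qed
    show "0 < (1 - l) * \<delta> / 2" using l \<delta> by simp
    show "cball x ((1 - l) * \<delta> / 2) \<subseteq> interior S" if xin: "x \<in> S' l" for x
    proof (rule cball_subset_interior)
      obtain x0 where x0: "x0 \<in> S" "x = z + l *\<^sub>R (x0 - z)" using xin by (auto simp: S'_def)
      show "ball x ((1 - l) * \<delta>) \<subseteq> S"
      proof
        fix p assume p: "p \<in> ball x ((1 - l) * \<delta>)"
        \<comment> \<open>\<open>p\<close> is the combination of \<open>w\<close> and
          \<open>x0\<close> with weights \<open>1 - l\<close> and \<open>l\<close>. As
          \<open>w\<close> is in the ball about \<open>z\<close>, the segment between them stays in
          \<open>S\<close>.\<close>
        define w where "w = z + (1 / (1 - l)) *\<^sub>R (p - x)"
        have "dist z w = dist x p / (1 - l)" using l by (simp add: w_def dist_norm norm_minus_commute)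
        also have "\<dots> \<le> \<delta>" using p l by (simp add: field_simps)
        finally have "w + l *\<^sub>R (x0 - w) \<in> S" using star[of w x0 l] x0 l by simp
        moreover have "w + l *\<^sub>R (x0 - w) = p"
        proof -
          have "w + l *\<^sub>R (x0 - w) = (1 - l) *\<^sub>R w + l *\<^sub>R x0" by (simp add: algebra_simps)
          also have "(1 - l) *\<^sub>R w = (1 - l) *\<^sub>R z + (p - x)" using l by (simp add: w_def scaleR_add_right)
          finally show ?thesis using x0 by (simp add: algebra_simps)
        qed
        ultimately show "p \<in> S" by simp
      qed
    qed (use l \<delta> in auto)
  qed
  define l where "l n = 1 - 1 / real (n + 2)" for n
  have l: "1 / 2 \<le> l n" "l n < 1" for n by (auto simp: l_def field_simps)
  have "AE y in lborel. \<forall>n. AE x in lborel. y \<in> S' (l n) \<longrightarrow> x \<in> S' (l n) \<longrightarrow> ?ineq x y"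
    unfolding AE_all_countable using part l by blast
  then have ae: "AE y in lborel. AE x in lborel. \<forall>n. y \<in> S' (l n) \<longrightarrow> x \<in> S' (l n) \<longrightarrow> ?ineq x y"
    unfolding AE_all_countable .
  have ex: "\<exists>N. \<forall>n\<ge>N. x \<in> S' (l n)" if x: "x \<in> interior S" for x
  proof -
    have llim: "l \<longlonglongrightarrow> 1"
    proof -
      have "(\<lambda>n. 1 / real (n + 2)) \<longlonglongrightarrow> 0" using LIMSEQ_ignore_initial_segment[OF lim_1_over_n, of 2] by simp
      then have "(\<lambda>n. 1 - 1 / real (n + 2)) \<longlonglongrightarrow> 1 - 0" by (intro tendsto_intros)
      then show ?thesis unfolding l_def by simp
    qed
    have "(\<lambda>n. z + (1 / l n) *\<^sub>R (x - z)) \<longlonglongrightarrow> z + (1 / 1) *\<^sub>R (x - z)"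
      by (intro tendsto_intros llim) simp
    then have "(\<lambda>n. z + (1 / l n) *\<^sub>R (x - z)) \<longlonglongrightarrow> x" by simp
    then have "eventually (\<lambda>n. z + (1 / l n) *\<^sub>R (x - z) \<in> interior S) sequentially"
      using x by (intro topological_tendstoD) auto
    then obtain N where N: "\<And>n. n \<ge> N \<Longrightarrow> z + (1 / l n) *\<^sub>R (x - z) \<in> interior S"
      by (auto simp: eventually_sequentially)
    have "x \<in> S' (l n)" if "n \<ge> N" for n
    proof -
      have "l n \<noteq> 0" using l(1)[of n] by linarith
      then have "x = z + l n *\<^sub>R ((z + (1 / l n) *\<^sub>R (x - z)) - z)" by simp
      then show ?thesis unfolding S'_def using N[OF that] interior_subset by blast
    qed
    then show ?thesis by blast
  qed
  from ae show ?thesis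
  proof eventually_elim
    case (elim y)
    then show ?case
    proof eventually_elim
      case (elim x)
      show ?case
      proof (intro impI)
        assume "y \<in> interior S" "x \<in> interior S"
        then obtain N1 N2 where "\<forall>n\<ge>N1. y \<in> S' (l n)" "\<forall>n\<ge>N2. x \<in> S' (l n)" using ex by metis
        then have "y \<in> S' (l (max N1 N2))" "x \<in> S' (l (max N1 N2))" by auto
        then show "?ineq x y" using elim by blast
      qed
    qed
  qed
qed

section \<open>The weighted bound for the averaged remainder\<close>

lemma epowr_add_le:
  assumes "p \<ge> 0"
  shows "epowr p (a + b) \<le> ennreal (2 powr p) * (epowr p a + epowr p b)"
proof -
  have "a + b \<le> ennreal 2 * max a b"
    by (metis add_mono max.cobounded1 max.cobounded2 mult_2 ennreal_numeral)
  then have "epowr p (a + b) \<le> epowr p (ennreal 2 * max a b)" using assms by (intro epowr_mono)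
  also have "\<dots> = ennreal (2 powr p) * epowr p (max a b)" unfolding epowr_mult by (subst epowr_ennreal) auto
  also have "\<dots> \<le> ennreal (2 powr p) * (epowr p a + epowr p b)"
    by (intro mult_left_mono) (auto simp: max_def add_increasing add_increasing2)
  finally show ?thesis .
qed

text \<open>Each of the \<open>N\<close> terms of \<open>top_jet\<close> is at most the largest
  derivative, and the power of the latter is one term of the sum on the right.\<close>

lemma epowr_top_jet_le:
  fixes V :: "('n::finite \<Rightarrow> nat) \<Rightarrow> real^'n \<Rightarrow> real" and m :: nat
  assumes p: "p \<ge> 0"
  defines "N \<equiv> real (card {\<gamma> :: 'n \<Rightarrow> nat. mi_order \<gamma> = m} * CARD('n))"
  shows "epowr p (ennreal (top_jet m V x)) \<le>
    ennreal (N powr p) * (\<Sum>\<beta> | mi_order \<beta> = Suc m. epowr p (ennreal \<bar>V \<beta> x\<bar>))"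
proof -
  let ?M = "{\<beta> :: 'n \<Rightarrow> nat. mi_order \<beta> = Suc m}"
  \<comment> \<open>An arbitrary coordinate: it only has to yield some multi-index of order
    \<open>m + 1\<close>, so that the maximum below exists.\<close>
  define i :: 'n where "i = undefined"
  have "(\<lambda>j. if j = i then Suc m else 0) \<in> ?M" by (simp add: mi_order_def)
  then have ne: "(\<lambda>\<beta>. \<bar>V \<beta> x\<bar>) ` ?M \<noteq> {}" by blast
  have fin: "finite ((\<lambda>\<beta>. \<bar>V \<beta> x\<bar>) ` ?M)" using finite_mi_eq by (rule finite_imageI)
  obtain \<beta> where \<beta>: "\<beta> \<in> ?M" "Max ((\<lambda>\<beta>. \<bar>V \<beta> x\<bar>) ` ?M) = \<bar>V \<beta> x\<bar>" using Max_in[OF fin ne] by auto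
  have "top_jet m V x \<le> (\<Sum>\<gamma>\<in>{\<gamma> :: 'n \<Rightarrow> nat. mi_order \<gamma> = m}. \<Sum>i\<in>(UNIV::'n set). \<bar>V \<beta> x\<bar>)"
    unfolding top_jet_def
  proof (intro sum_mono)
    fix \<gamma> :: "'n \<Rightarrow> nat" and i assume "\<gamma> \<in> {\<gamma>. mi_order \<gamma> = m}"
    then have "\<gamma>(i := Suc (\<gamma> i)) \<in> ?M" by (simp add: mi_order_upd)
    then show "\<bar>V (\<gamma>(i := Suc (\<gamma> i))) x\<bar> \<le> \<bar>V \<beta> x\<bar>" unfolding \<beta>(2)[symmetric] by (intro Max_ge fin) auto
  qed
  also have "\<dots> = N * \<bar>V \<beta> x\<bar>" by (simp add: N_def)
  finally have "epowr p (ennreal (top_jet m V x)) \<le> epowr p (ennreal (N * \<bar>V \<beta> x\<bar>))"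
    using p by (intro epowr_mono ennreal_leI) auto
  also have "\<dots> = ennreal (N powr p) * epowr p (ennreal \<bar>V \<beta> x\<bar>)"
  proof -
    have "N \<ge> 0" by (simp add: N_def)
    then show ?thesis by (simp add: ennreal_mult' epowr_mult epowr_ennreal)
  qed
  also have "\<dots> \<le> ennreal (N powr p) * (\<Sum>\<beta>\<in>?M. epowr p (ennreal \<bar>V \<beta> x\<bar>))"
    using \<beta>(1) finite_mi_eq by (intro mult_left_mono member_le_sum[where f = "\<lambda>\<beta>. epowr p (ennreal \<bar>V \<beta> x\<bar>)"]) auto
  finally show ?thesis .
qed

text \<open>As \<open>\<Psi>\<close> has integral 1, the error at \<open>y\<close> is an integral of
  remainders against \<open>\<Psi>\<close>, hence at most a multiple of
  \<open>M1 * F y + M * J\<close> with \<open>J\<close> the integral of \<open>F\<close> over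
  \<open>S\<close>. The first term is covered by \<open>seg_avg_weighted_bound\<close>. The second
  is constant in \<open>y\<close>; Hoelder's inequality for \<open>J\<close> and the Muckenhoupt
  condition on a ball around \<open>S\<close> bound its weighted norm by that of
  \<open>F\<close>.\<close>

lemma averaged_remainder_bound:
  fixes V :: "('n::finite \<Rightarrow> nat) \<Rightarrow> real^'n \<Rightarrow> real"
    and \<psi> \<Psi> w :: "real^'n \<Rightarrow> real" and m :: nat and d \<delta> :: real and z :: "real^'n"
  assumes p: "1 < p" and w: "Ap_bound p A w" and A: "0 \<le> A"
    and \<psi>: "smooth \<psi>" "(\<integral>x. \<psi> x \<partial>lborel) = 1" "supp \<psi> \<subseteq> cball 0 r"
    and V: "weak_jet m S V" "\<And>\<gamma> x. x \<notin> S \<Longrightarrow> V \<gamma> x = 0"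
    and S: "compact S" "S \<subseteq> cball z d" "negligible (frontier S)" and \<delta>: "0 < \<delta>" "\<delta> \<le> d"
    and star: "\<And>w x s. w \<in> cball z \<delta> \<Longrightarrow> x \<in> S \<Longrightarrow> s \<in> {0..1} \<Longrightarrow> w + s *\<^sub>R (x - w) \<in> S"
    and \<Psi>: "\<Psi> \<in> borel_measurable borel" "(\<integral>x. \<Psi> x \<partial>lborel) = 1" "\<And>x. \<bar>\<Psi> x\<bar> \<le> M" "\<And>x. x \<notin> S \<Longrightarrow> \<Psi> x = 0"
    and M1: "(\<integral>x. \<bar>\<Psi> x\<bar> \<partial>lborel) \<le> M1"
  defines "\<kappa> \<equiv> measure lborel (ball z (2 * d))" and "\<beta> \<equiv> measure lborel (ball z (\<delta> / 2))"
    and "N \<equiv> real (card {\<gamma> :: 'n \<Rightarrow> nat. mi_order \<gamma> = m} * CARD('n))"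
  shows "(\<integral>\<^sup>+y\<in>S. epowr p (ennreal \<bar>V (\<lambda>_. 0) y - (\<integral>x. jet_poly m V x y * \<Psi> x \<partial>lborel)\<bar>) * w y \<partial>lborel)
    \<le> ennreal ((2 * (2 * d) ^ Suc m / \<beta>) powr p * (M1 powr p + (M * \<kappa>) powr p * A) * (A * \<kappa> powr p) * N powr p) *
      (\<Sum>\<beta> | mi_order \<beta> = Suc m. \<integral>\<^sup>+x\<in>S. epowr p (ennreal \<bar>V \<beta> x\<bar>) * w x \<partial>lborel)"
proof -
  have Vi: "integrable lborel (V \<gamma>)" for \<gamma> using V(1) by (simp add: weak_jet_def)
  then have [measurable]: "V \<gamma> \<in> borel_measurable borel" for \<gamma> by auto
  note [measurable] = \<Psi>(1) Ap_boundD(1)[OF w]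
  have [measurable]: "S \<in> sets borel" using S(1) by (rule borel_compact)
  have [measurable]: "top_jet m V \<in> borel_measurable borel" unfolding top_jet_def by measurable
  have \<Psi>i: "integrable lborel \<Psi>" by (rule integral_one_integrable) fact
  have M0: "0 \<le> M" using \<Psi>(3)[of 0] by linarith
  have "0 \<le> (\<integral>x. \<bar>\<Psi> x\<bar> \<partial>lborel)" by (rule Bochner_Integration.integral_nonneg) simp
  then have M10: "0 \<le> M1" using M1 by linarith
  have d: "d > 0" using \<delta> by linarith
  define f where "f x = ennreal (top_jet m V x)" for x
  define F where "F = seg_avg z (\<delta> / 2) f"
  have [measurable]: "f \<in> borel_measurable borel" unfolding f_def by measurable
  have [measurable]: "F \<in> borel_measurable borel" unfolding F_def by measurable
  define K where "K = (2 * d) ^ Suc m"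
  have K: "K > 0" using d by (simp add: K_def)
  have \<beta>0: "\<beta> > 0" unfolding \<beta>_def using \<delta> by (intro content_ball_pos) auto
  have \<kappa>0: "\<kappa> > 0" unfolding \<kappa>_def using d by (intro content_ball_pos) auto
  have em: "emeasure lborel (ball c s) = ennreal (measure lborel (ball c s))" for c :: "real^'n" and s
    by (rule emeasure_eq_ennreal_measure) (metis emeasure_lborel_ball_finite infinity_ennreal_def less_irrefl)
  define R where "R y = V (\<lambda>_. 0) y - (\<integral>x. jet_poly m V x y * \<Psi> x \<partial>lborel)" for y
  define J where "J = (\<integral>\<^sup>+x\<in>S. F x \<partial>lborel)"
  define \<Phi> where "\<Phi> = (\<integral>\<^sup>+x. epowr p (f x) * w x \<partial>lborel)"
  have frontS: "AE x in lborel. x \<notin> frontier S"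
  proof -
    have "AE x in lebesgue. x \<notin> frontier S"
      using S(3) by (intro AE_not_in) (simp add: negligible_iff_null_sets)
    then show ?thesis by (simp add: AE_completion_iff)
  qed
  have pt: "AE y in lborel. y \<in> S \<longrightarrow> ennreal \<beta> * ennreal \<bar>R y\<bar> \<le> ennreal K * (ennreal M1 * F y + ennreal M * J)"
  proof -
    have "AE y in lborel. AE x in lborel. y \<in> interior S \<longrightarrow> x \<in> interior S \<longrightarrow>
      ennreal \<beta> * ennreal \<bar>V (\<lambda>_. 0) y - jet_poly m V x y\<bar> \<le> ennreal K * (F y + F x)"
      using taylor_remainder_AE[OF \<psi> V(1) S(1,2) \<delta>] star
      unfolding em \<beta>_def K_def F_def f_def by blast
    from this frontS show ?thesis
    proof eventually_elim
      case (elim y)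
      show ?case
      proof
        assume "y \<in> S"
        then have y: "y \<in> interior S" using elim(2) closure_subset by (auto simp: frontier_def)
        \<comment> \<open>On \<open>S\<close> the monomials are bounded, and outside
          \<open>S\<close> the function \<open>\<Psi>\<close> vanishes; so integrability of the jet
          suffices.\<close>
        have int: "integrable lborel (\<lambda>x. jet_poly m V x y * \<Psi> x)"
        proof -
          have "integrable lborel (\<lambda>x. V \<alpha> x * (mi_power (y - x) \<alpha> * \<Psi> x))" for \<alpha>
          proof (rule bounded_mult_integrable[OF Vi, where K = "(2 * d) ^ mi_order \<alpha> * M"])
            show "(\<lambda>x. mi_power (y - x) \<alpha> * \<Psi> x) \<in> borel_measurable lborel"
              unfolding mi_power_def by measurable
            fix x
            show "\<bar>mi_power (y - x) \<alpha> * \<Psi> x\<bar> \<le> (2 * d) ^ mi_order \<alpha> * M"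
            proof (cases "x \<in> S")
              case True
              have "dist z x \<le> d" "dist z y \<le> d" using True \<open>y \<in> S\<close> S(2) by auto
              then have "norm (y - x) \<le> 2 * d" using dist_triangle[of y x z] by (simp add: dist_norm[symmetric] dist_commute)
              then have "\<bar>mi_power (y - x) \<alpha>\<bar> \<le> (2 * d) ^ mi_order \<alpha>"
                by (intro order_trans[OF abs_mi_power_le] power_mono) auto
              then show ?thesis unfolding abs_mult using \<Psi>(3)[of x] d by (intro mult_mono) auto
            qed (use \<Psi>(4) M0 d in auto)
          qed
          then have "integrable lborel (\<lambda>x. \<Sum>\<alpha> | mi_order \<alpha> \<le> m. 1 / mi_fact \<alpha> * (V \<alpha> x * (mi_power (y - x) \<alpha> * \<Psi> x)))"
            by (intro Bochner_Integration.integrable_sum Bochner_Integration.integrable_mult_right)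
          also have "(\<lambda>x. \<Sum>\<alpha> | mi_order \<alpha> \<le> m. 1 / mi_fact \<alpha> * (V \<alpha> x * (mi_power (y - x) \<alpha> * \<Psi> x))) =
            (\<lambda>x. jet_poly m V x y * \<Psi> x)"
            unfolding jet_poly_def sum_distrib_right by (intro ext sum.cong refl) simp
          finally show ?thesis .
        qed
        have "R y = (\<integral>x. V (\<lambda>_. 0) y * \<Psi> x \<partial>lborel) - (\<integral>x. jet_poly m V x y * \<Psi> x \<partial>lborel)"
          using \<Psi>(2) by (simp add: R_def)
        also have "\<dots> = (\<integral>x. V (\<lambda>_. 0) y * \<Psi> x - jet_poly m V x y * \<Psi> x \<partial>lborel)"
          by (rule Bochner_Integration.integral_diff[symmetric]) (use int \<Psi>i in auto)
        finally have "ennreal \<bar>R y\<bar> = ennreal (norm (\<integral>x. V (\<lambda>_. 0) y * \<Psi> x - jet_poly m V x y * \<Psi> x \<partial>lborel))" by simp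
        also have "\<dots> \<le> (\<integral>\<^sup>+x. ennreal (norm (V (\<lambda>_. 0) y * \<Psi> x - jet_poly m V x y * \<Psi> x)) \<partial>lborel)"
          by (rule integral_norm_bound_ennreal) (use int \<Psi>i in auto)
        finally have "ennreal \<beta> * ennreal \<bar>R y\<bar> \<le>
           ennreal \<beta> * (\<integral>\<^sup>+x. ennreal (norm (V (\<lambda>_. 0) y * \<Psi> x - jet_poly m V x y * \<Psi> x)) \<partial>lborel)"
          by (rule mult_left_mono) simp
        also have "\<dots> = (\<integral>\<^sup>+x. ennreal \<beta> * ennreal (norm (V (\<lambda>_. 0) y * \<Psi> x - jet_poly m V x y * \<Psi> x)) \<partial>lborel)"
          unfolding jet_poly_def mi_power_def by (rule nn_integral_cmult[symmetric]) measurable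
        also have "\<dots> \<le> (\<integral>\<^sup>+x. ennreal K * F y * ennreal \<bar>\<Psi> x\<bar> + ennreal K * ennreal M * (F x * indicator S x) \<partial>lborel)"
        proof (rule nn_integral_mono_AE)
          from elim(1) frontS
          show "AE x in lborel. ennreal \<beta> * ennreal (norm (V (\<lambda>_. 0) y * \<Psi> x - jet_poly m V x y * \<Psi> x)) \<le>
            ennreal K * F y * ennreal \<bar>\<Psi> x\<bar> + ennreal K * ennreal M * (F x * indicator S x)"
          proof eventually_elim
            case (elim x)
            show ?case
            proof (cases "x \<in> S")
              case True
              then have "x \<in> interior S" using elim(2) closure_subset by (auto simp: frontier_def)
              then have i: "ennreal \<beta> * ennreal \<bar>V (\<lambda>_. 0) y - jet_poly m V x y\<bar> \<le> ennreal K * (F y + F x)"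
                using elim(1) y by blast
              have "ennreal \<beta> * ennreal (norm (V (\<lambda>_. 0) y * \<Psi> x - jet_poly m V x y * \<Psi> x)) =
                (ennreal \<beta> * ennreal \<bar>V (\<lambda>_. 0) y - jet_poly m V x y\<bar>) * ennreal \<bar>\<Psi> x\<bar>"
                by (simp add: mult.assoc abs_mult flip: ennreal_mult' left_diff_distrib)
              also have "\<dots> \<le> (ennreal K * (F y + F x)) * ennreal \<bar>\<Psi> x\<bar>" by (rule mult_right_mono[OF i]) simp
              also have "\<dots> = ennreal K * F y * ennreal \<bar>\<Psi> x\<bar> + ennreal K * F x * ennreal \<bar>\<Psi> x\<bar>"
                by (simp add: distrib_left distrib_right)
              also have "\<dots> \<le> ennreal K * F y * ennreal \<bar>\<Psi> x\<bar> + ennreal K * F x * ennreal M"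
                by (intro add_left_mono mult_left_mono ennreal_leI \<Psi>(3)) auto
              finally show ?thesis using True by (simp add: ac_simps)
            qed (simp add: \<Psi>(4))
          qed
        qed
        also have "\<dots> = ennreal K * F y * (\<integral>\<^sup>+x. ennreal \<bar>\<Psi> x\<bar> \<partial>lborel) + ennreal K * ennreal M * J"
          unfolding J_def by (subst nn_integral_add) (auto simp: nn_integral_cmult)
        also have "(\<integral>\<^sup>+x. ennreal \<bar>\<Psi> x\<bar> \<partial>lborel) = ennreal (\<integral>x. \<bar>\<Psi> x\<bar> \<partial>lborel)"
          using \<Psi>i by (intro nn_integral_eq_integral) auto
        also have "ennreal K * F y * \<dots> + ennreal K * ennreal M * J \<le> ennreal K * F y * ennreal M1 + ennreal K * ennreal M * J"
          by (intro add_right_mono mult_left_mono ennreal_leI M1) auto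
        finally show "ennreal \<beta> * ennreal \<bar>R y\<bar> \<le> ennreal K * (ennreal M1 * F y + ennreal M * J)"
          by (simp add: distrib_left ac_simps)
      qed
    qed
  qed
  \<comment> \<open>\<open>K / \<beta>\<close> stems from the remainder estimate, the 2 from the
    p-th power of a sum.\<close>
  define c where "c = 2 * K / \<beta>"
  have c: "c > 0" using K \<beta>0 by (simp add: c_def)
  have ptp: "AE y in lborel. y \<in> S \<longrightarrow> epowr p (ennreal \<bar>R y\<bar>) \<le>
      ennreal (c powr p) * (ennreal (M1 powr p) * epowr p (F y) + ennreal (M powr p) * epowr p J)"
    using pt
  proof eventually_elim
    case (elim y)
    show ?case
    proof
      assume "y \<in> S"
      have "ennreal \<bar>R y\<bar> = ennreal (1 / \<beta>) * (ennreal \<beta> * ennreal \<bar>R y\<bar>)"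
        using \<beta>0 by (simp flip: ennreal_mult')
      also have "\<dots> \<le> ennreal (1 / \<beta>) * (ennreal K * (ennreal M1 * F y + ennreal M * J))"
        using elim \<open>y \<in> S\<close> by (intro mult_left_mono) auto
      also have "\<dots> = ennreal (K / \<beta>) * (ennreal M1 * F y + ennreal M * J)"
        using K \<beta>0 by (simp add: mult.assoc[symmetric] flip: ennreal_mult')
      finally have "epowr p (ennreal \<bar>R y\<bar>) \<le> epowr p (ennreal (K / \<beta>) * (ennreal M1 * F y + ennreal M * J))"
        using p by (intro epowr_mono) auto
      also have "\<dots> = ennreal ((K / \<beta>) powr p) * epowr p (ennreal M1 * F y + ennreal M * J)"
        using K \<beta>0 by (simp add: epowr_mult epowr_ennreal)
      also have "\<dots> \<le> ennreal ((K / \<beta>) powr p) * (ennreal (2 powr p) * (epowr p (ennreal M1 * F y) + epowr p (ennreal M * J)))"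
        using p by (intro mult_left_mono epowr_add_le) auto
      also have "\<dots> = (ennreal ((K / \<beta>) powr p) * ennreal (2 powr p)) * (epowr p (ennreal M1 * F y) + epowr p (ennreal M * J))"
        by (simp add: mult.assoc)
      also have "ennreal ((K / \<beta>) powr p) * ennreal (2 powr p) = ennreal (c powr p)"
      proof -
        have "c = (K / \<beta>) * 2" by (simp add: c_def)
        then have "c powr p = (K / \<beta>) powr p * 2 powr p" using K \<beta>0 by (simp only: powr_mult)
        then show ?thesis by (simp add: ennreal_mult')
      qed
      also have "epowr p (ennreal M1 * F y) + epowr p (ennreal M * J) = ennreal (M1 powr p) * epowr p (F y) + ennreal (M powr p) * epowr p J"
        using M0 M10 by (simp add: epowr_mult epowr_ennreal)
      finally show "epowr p (ennreal \<bar>R y\<bar>) \<le>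
        ennreal (c powr p) * (ennreal (M1 powr p) * epowr p (F y) + ennreal (M powr p) * epowr p J)" .
    qed
  qed
  define Q where "Q = (\<integral>\<^sup>+y\<in>S. epowr p (F y) * w y \<partial>lborel)"
  define W where "W = (\<integral>\<^sup>+y\<in>S. w y \<partial>lborel)"
  have Sball: "S \<subseteq> ball z (2 * d)" using S(2) d by (auto simp: subset_eq)
  have Q: "Q \<le> ennreal (A * \<kappa> powr p) * \<Phi>"
    unfolding Q_def F_def \<Phi>_def \<kappa>_def
    by (rule seg_avg_weighted_bound[OF p w A]) (use \<delta> S(2) in auto)
  have JW: "epowr p J * W \<le> Q * ennreal (A * \<kappa> powr p)"
  proof -
    define W' where "W' = (\<integral>\<^sup>+x\<in>S. ennreal (w x powr (1 / (1 - p))) \<partial>lborel)"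
    have "epowr p J \<le> Q * epowr (p - 1) W'"
      unfolding J_def Q_def W'_def by (rule weighted_Holder[OF p w]) measurable
    then have "epowr p J * W \<le> Q * epowr (p - 1) W' * W" by (rule mult_right_mono) simp
    also have "\<dots> = Q * (W * epowr (p - 1) W')" by (simp add: ac_simps)
    also have "\<dots> \<le> Q * ((\<integral>\<^sup>+x\<in>ball z (2 * d). w x \<partial>lborel) *
        epowr (p - 1) (\<integral>\<^sup>+x\<in>ball z (2 * d). ennreal (w x powr (1 / (1 - p))) \<partial>lborel))"
      unfolding W_def W'_def using p Sball
      by (intro mult_left_mono mult_mono epowr_mono nn_integral_mono) (auto simp: indicator_def)
    also have "\<dots> \<le> Q * (ennreal A * epowr p (emeasure lborel (ball z (2 * d))))"
      using d by (intro mult_left_mono Ap_boundD(3)[OF w]) auto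
    also have "ennreal A * epowr p (emeasure lborel (ball z (2 * d))) = ennreal (A * \<kappa> powr p)"
      using A \<kappa>0 by (simp add: em \<kappa>_def[symmetric] epowr_ennreal ennreal_mult')
    finally show ?thesis .
  qed
  \<comment> \<open>\<open>V\<close> vanishes outside \<open>S\<close>, so the integral over the
    whole space that the segment averages lead to is one over \<open>S\<close>.\<close>
  have \<Phi>: "\<Phi> \<le> ennreal (N powr p) * (\<Sum>\<beta> | mi_order \<beta> = Suc m. \<integral>\<^sup>+x\<in>S. epowr p (ennreal \<bar>V \<beta> x\<bar>) * w x \<partial>lborel)"
  proof -
    have "\<Phi> \<le> (\<integral>\<^sup>+x. ennreal (N powr p) * (\<Sum>\<beta> | mi_order \<beta> = Suc m. epowr p (ennreal \<bar>V \<beta> x\<bar>) * w x * indicator S x) \<partial>lborel)"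
      unfolding \<Phi>_def
    proof (rule nn_integral_mono)
      fix x
      have "epowr p (f x) * w x \<le> ennreal (N powr p) * (\<Sum>\<beta> | mi_order \<beta> = Suc m. epowr p (ennreal \<bar>V \<beta> x\<bar>)) * w x"
        unfolding f_def N_def using p by (intro mult_right_mono epowr_top_jet_le) auto
      also have "\<dots> = ennreal (N powr p) * (\<Sum>\<beta> | mi_order \<beta> = Suc m. epowr p (ennreal \<bar>V \<beta> x\<bar>) * w x * indicator S x)"
        by (cases "x \<in> S") (auto simp: V(2) sum_distrib_right mult.assoc)
      finally show "epowr p (f x) * w x \<le> \<dots>" .
    qed
    also have "\<dots> = ennreal (N powr p) * (\<integral>\<^sup>+x. (\<Sum>\<beta> | mi_order \<beta> = Suc m. epowr p (ennreal \<bar>V \<beta> x\<bar>) * w x * indicator S x) \<partial>lborel)"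
      by (rule nn_integral_cmult) measurable
    also have "(\<integral>\<^sup>+x. (\<Sum>\<beta> | mi_order \<beta> = Suc m. epowr p (ennreal \<bar>V \<beta> x\<bar>) * w x * indicator S x) \<partial>lborel) =
       (\<Sum>\<beta> | mi_order \<beta> = Suc m. \<integral>\<^sup>+x\<in>S. epowr p (ennreal \<bar>V \<beta> x\<bar>) * w x \<partial>lborel)"
      by (rule nn_integral_sum) measurable
    finally show ?thesis .
  qed
  have "(\<integral>\<^sup>+y\<in>S. epowr p (ennreal \<bar>R y\<bar>) * w y \<partial>lborel) \<le>
     (\<integral>\<^sup>+y. ennreal (c powr p) * (ennreal (M1 powr p) * (epowr p (F y) * w y * indicator S y)
        + ennreal (M powr p) * epowr p J * (ennreal (w y) * indicator S y)) \<partial>lborel)"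
  proof (rule nn_integral_mono_AE)
    show "AE y in lborel. epowr p (ennreal \<bar>R y\<bar>) * w y * indicator S y \<le>
      ennreal (c powr p) * (ennreal (M1 powr p) * (epowr p (F y) * w y * indicator S y)
        + ennreal (M powr p) * epowr p J * (ennreal (w y) * indicator S y))"
      using ptp
    proof eventually_elim
      case (elim y)
      show ?case
      proof (cases "y \<in> S")
        case True
        then have "epowr p (ennreal \<bar>R y\<bar>) * w y \<le>
           (ennreal (c powr p) * (ennreal (M1 powr p) * epowr p (F y) + ennreal (M powr p) * epowr p J)) * w y"
          using elim by (intro mult_right_mono) auto
        then show ?thesis using True by (simp add: distrib_left distrib_right ac_simps)
      qed simp
    qed
  qed
  also have "\<dots> = ennreal (c powr p) * (ennreal (M1 powr p) * Q + ennreal (M powr p) * epowr p J * W)"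
  proof -
    define g where "g y = epowr p (F y) * w y * indicator S y" for y
    define h where "h y = ennreal (w y) * indicator S y" for y
    define b where "b = ennreal (M powr p) * epowr p J"
    have [measurable]: "g \<in> borel_measurable borel" unfolding g_def by measurable
    have [measurable]: "h \<in> borel_measurable borel" unfolding h_def by measurable
    have "(\<integral>\<^sup>+y. ennreal (c powr p) * (ennreal (M1 powr p) * g y + b * h y) \<partial>lborel) =
      ennreal (c powr p) * (\<integral>\<^sup>+y. ennreal (M1 powr p) * g y + b * h y \<partial>lborel)"
      by (rule nn_integral_cmult) measurable
    also have "(\<integral>\<^sup>+y. ennreal (M1 powr p) * g y + b * h y \<partial>lborel) =
      (\<integral>\<^sup>+y. ennreal (M1 powr p) * g y \<partial>lborel) + (\<integral>\<^sup>+y. b * h y \<partial>lborel)"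
      by (rule nn_integral_add) measurable
    also have "(\<integral>\<^sup>+y. ennreal (M1 powr p) * g y \<partial>lborel) = ennreal (M1 powr p) * Q"
      unfolding Q_def g_def[symmetric] by (rule nn_integral_cmult) measurable
    also have "(\<integral>\<^sup>+y. b * h y \<partial>lborel) = b * W"
      unfolding W_def h_def[symmetric] by (rule nn_integral_cmult) measurable
    finally show ?thesis unfolding g_def h_def b_def .
  qed
  also have "\<dots> \<le> ennreal (c powr p) * (ennreal (M1 powr p) * Q + ennreal (M powr p) * (Q * ennreal (A * \<kappa> powr p)))"
  proof -
    have "ennreal (M powr p) * epowr p J * W \<le> ennreal (M powr p) * (Q * ennreal (A * \<kappa> powr p))"
      unfolding mult.assoc by (rule mult_left_mono[OF JW]) simp
    then show ?thesis by (intro mult_left_mono add_left_mono) auto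
  qed
  also have "\<dots> = ennreal (c powr p) * (ennreal (M1 powr p) + ennreal (M powr p) * ennreal (A * \<kappa> powr p)) * Q"
    by (simp add: distrib_left distrib_right ac_simps)
  also have "ennreal (M1 powr p) + ennreal (M powr p) * ennreal (A * \<kappa> powr p) = ennreal (M1 powr p + (M * \<kappa>) powr p * A)"
    using A M0 \<kappa>0 by (simp add: powr_mult ac_simps flip: ennreal_mult' ennreal_plus)
  also have "ennreal (c powr p) * ennreal (M1 powr p + (M * \<kappa>) powr p * A) * Q \<le>
     ennreal (c powr p) * ennreal (M1 powr p + (M * \<kappa>) powr p * A) * (ennreal (A * \<kappa> powr p) *
      (ennreal (N powr p) * (\<Sum>\<beta> | mi_order \<beta> = Suc m. \<integral>\<^sup>+x\<in>S. epowr p (ennreal \<bar>V \<beta> x\<bar>) * w x \<partial>lborel)))"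
    by (intro mult_left_mono order_trans[OF Q] \<Phi>) auto
  also have "\<dots> = ennreal (c powr p * (M1 powr p + (M * \<kappa>) powr p * A) * (A * \<kappa> powr p) * N powr p) *
      (\<Sum>\<beta> | mi_order \<beta> = Suc m. \<integral>\<^sup>+x\<in>S. epowr p (ennreal \<bar>V \<beta> x\<bar>) * w x \<partial>lborel)"
    using A by (simp add: ennreal_mult mult.assoc)
  finally show ?thesis unfolding R_def c_def K_def .
qed

subsection \<open>Borel representatives\<close>

text \<open>Norms and weak derivatives are defined over \<open>lebesgue\<close>, while Tonelli's
  theorem is applied over \<open>lborel\<close>; functions that agree almost everywhere link the
  two.\<close>

lemma lebesgue_integral_Borel_version:
  fixes f g :: "'a::euclidean_space \<Rightarrow> real"
  assumes [measurable]: "g \<in> borel_measurable borel" and eq: "AE x in lebesgue. f x = g x"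
  shows "f \<in> borel_measurable lebesgue" "integrable lebesgue f \<longleftrightarrow> integrable lborel g"
    "(\<integral>x. f x \<partial>lebesgue) = (\<integral>x. g x \<partial>lborel)"
proof -
  have g: "g \<in> borel_measurable lborel" by simp
  then have g': "g \<in> borel_measurable lebesgue" by (rule measurable_completion)
  have "AE x in lebesgue. g x = f x" using eq by eventually_elim simp
  with g' show f': "f \<in> borel_measurable lebesgue" by (rule borel_measurable_AE)
  have "integrable lebesgue f \<longleftrightarrow> integrable lebesgue g" by (rule integrable_cong_AE[OF f' g' eq])
  also have "\<dots> \<longleftrightarrow> integrable lborel g" by (rule integrable_completion[OF g])
  finally show "integrable lebesgue f \<longleftrightarrow> integrable lborel g" .
  have "(\<integral>x. f x \<partial>lebesgue) = (\<integral>x. g x \<partial>lebesgue)" by (rule integral_cong_AE[OF f' g' eq])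
  also have "\<dots> = (\<integral>x. g x \<partial>lborel)" by (rule integral_completion[OF g])
  finally show "(\<integral>x. f x \<partial>lebesgue) = (\<integral>x. g x \<partial>lborel)" .
qed

text \<open>A Bochner integral is 0 if the function is not integrable, so integrability is
  characterized separately before the values are compared.\<close>

lemma nn_integral_set_lebesgue:
  fixes f g :: "'a::euclidean_space \<Rightarrow> real"
  assumes g [measurable]: "g \<in> borel_measurable borel" "\<And>x. 0 \<le> g x" and B [measurable]: "B \<in> sets borel"
    and eq: "AE x in lebesgue. x \<in> B \<longrightarrow> f x = g x"
  shows "set_integrable lebesgue B f \<longleftrightarrow> (\<integral>\<^sup>+x\<in>B. ennreal (g x) \<partial>lborel) < \<infinity>"
    and "set_integrable lebesgue B f \<Longrightarrow> (\<integral>\<^sup>+x\<in>B. ennreal (g x) \<partial>lborel) = ennreal (LINT x:B|lebesgue. f x)"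
proof -
  define k where "k x = indicator B x *\<^sub>R g x" for x
  have k [measurable]: "k \<in> borel_measurable borel" unfolding k_def by measurable
  have ae: "AE x in lebesgue. indicator B x *\<^sub>R f x = k x"
    using eq by eventually_elim (auto simp: k_def indicator_def)
  note * = lebesgue_integral_Borel_version[OF k ae]
  have k0: "0 \<le> k x" for x using g(2) by (simp add: k_def)
  have nn: "(\<integral>\<^sup>+x\<in>B. ennreal (g x) \<partial>lborel) = (\<integral>\<^sup>+x. ennreal (k x) \<partial>lborel)"
    by (intro nn_integral_cong) (auto simp: k_def indicator_def)
  have "set_integrable lebesgue B f \<longleftrightarrow> integrable lborel k" using *(2) by (simp add: set_integrable_def)
  also have "\<dots> \<longleftrightarrow> (\<integral>\<^sup>+x\<in>B. ennreal (g x) \<partial>lborel) < \<infinity>"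
    unfolding nn integrable_iff_bounded using k0 by simp
  finally show "set_integrable lebesgue B f \<longleftrightarrow> (\<integral>\<^sup>+x\<in>B. ennreal (g x) \<partial>lborel) < \<infinity>" .
  assume "set_integrable lebesgue B f"
  then have "integrable lborel k" using *(2) by (simp add: set_integrable_def)
  then have "(\<integral>\<^sup>+x. ennreal (k x) \<partial>lborel) = ennreal (\<integral>x. k x \<partial>lborel)" using k0 by (intro nn_integral_eq_integral) auto
  also have "(\<integral>x. k x \<partial>lborel) = (LINT x:B|lebesgue. f x)" using *(3) by (simp add: set_lebesgue_integral_def)
  finally show "(\<integral>\<^sup>+x\<in>B. ennreal (g x) \<partial>lborel) = ennreal (LINT x:B|lebesgue. f x)" by (simp only: nn)
qed

lemma Ap_const_nonneg:
  assumes "muckenhoupt p \<omega>"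
  shows "0 \<le> Ap_const p \<omega>"
proof -
  have bdd: "bdd_above (Ap_quotients p \<omega>)" using assms by (simp add: muckenhoupt_def)
  have pos: "AE x in lebesgue. \<omega> x > 0" using assms by (simp add: muckenhoupt_def weight_def)
  let ?q = "average (ball 0 1) \<omega> * average (ball 0 1) (\<lambda>y. \<omega> y powr (1 / (1 - p))) powr (p - 1)"
  have "0 \<le> (LINT x:ball 0 1|lebesgue. \<omega> x)"
    unfolding set_lebesgue_integral_def
  proof (rule integral_nonneg_AE)
    show "AE x in lebesgue. 0 \<le> indicator (ball 0 1) x *\<^sub>R \<omega> x" using pos by eventually_elim (simp add: indicator_def)
  qed
  then have "0 \<le> ?q" by (simp add: average_def)
  also have "?q \<le> Ap_const p \<omega>"
    unfolding Ap_const_def Ap_quotients_def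
    by (rule cSup_upper[OF _ bdd[unfolded Ap_quotients_def]], rule CollectI, rule exI[of _ 0], rule exI[of _ 1]) simp
  finally show ?thesis .
qed

lemma muckenhoupt_Borel_version:
  fixes \<omega> :: "real^'n \<Rightarrow> real"
  assumes p: "1 < p" and m: "muckenhoupt p \<omega>"
  obtains w where "Ap_bound p (Ap_const p \<omega>) w" "AE x in lebesgue. \<omega> x = w x"
    "\<And>c s. s > 0 \<Longrightarrow> (\<integral>\<^sup>+x\<in>ball c s. ennreal (w x powr (1 / (1 - p))) \<partial>lborel) < \<infinity>"
proof -
  have meas: "\<omega> \<in> borel_measurable lebesgue" and cpt: "\<And>K. compact K \<Longrightarrow> set_integrable lebesgue K \<omega>"
    and pos: "AE x in lebesgue. \<omega> x > 0" and bdd: "bdd_above (Ap_quotients p \<omega>)"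
    and dual: "\<And>x s. s > 0 \<Longrightarrow> set_integrable lebesgue (ball x s) (\<lambda>y. \<omega> y powr (1 / (1 - p)))"
    using m by (auto simp: muckenhoupt_def weight_def)
  obtain w0 where [measurable]: "w0 \<in> borel_measurable lborel" and w0: "AE x in lborel. \<omega> x = w0 x"
    using completion_ex_borel_measurable_real[OF meas] by blast
  \<comment> \<open>The value 1 is inserted only on a null set, since the weight is positive almost
    everywhere.\<close>
  define w where "w x = (if w0 x > 0 then w0 x else 1)" for x
  have [measurable]: "w \<in> borel_measurable borel" unfolding w_def by measurable
  have w_pos: "w x > 0" for x by (simp add: w_def)
  have ae: "AE x in lebesgue. \<omega> x = w x"
    using AE_completion[OF w0] pos by eventually_elim (simp add: w_def)
  define a where "a c s = (LINT x:ball c s|lebesgue. \<omega> x)" for c s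
  define b where "b c s = (LINT x:ball c s|lebesgue. \<omega> x powr (1 / (1 - p)))" for c s
  have A: "(\<integral>\<^sup>+x\<in>ball c s. ennreal (w x) \<partial>lborel) = ennreal (a c s)" for c s
    unfolding a_def
  proof (rule nn_integral_set_lebesgue(2))
    show "set_integrable lebesgue (ball c s) \<omega>"
      by (rule set_integrable_subset[OF cpt[of "cball c s"]]) auto
    show "AE x in lebesgue. x \<in> ball c s \<longrightarrow> \<omega> x = w x" using ae by eventually_elim simp
  qed (use w_pos in \<open>auto intro: less_imp_le\<close>)
  have B: "(\<integral>\<^sup>+x\<in>ball c s. ennreal (w x powr (1 / (1 - p))) \<partial>lborel) = ennreal (b c s)" if "s > 0" for c s
    unfolding b_def
  proof (rule nn_integral_set_lebesgue(2))
    show "set_integrable lebesgue (ball c s) (\<lambda>x. \<omega> x powr (1 / (1 - p)))" by (rule dual[OF that])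
    show "AE x in lebesgue. x \<in> ball c s \<longrightarrow> \<omega> x powr (1 / (1 - p)) = w x powr (1 / (1 - p))"
      using ae by eventually_elim simp
  qed auto
  show thesis
  proof (rule that[OF _ ae])
    show "(\<integral>\<^sup>+x\<in>ball c s. ennreal (w x powr (1 / (1 - p))) \<partial>lborel) < \<infinity>" if "s > 0" for c s
      using B[OF that] by simp
    show "Ap_bound p (Ap_const p \<omega>) w"
      unfolding Ap_bound_def
    proof (intro conjI allI impI w_pos)
      fix c :: "real^'n" and s :: real assume s: "0 < s"
      define V where "V = measure lborel (ball c s)"
      have V: "V > 0" unfolding V_def using s by (intro content_ball_pos)
      have Ve: "emeasure lborel (ball c s) = ennreal V"
        unfolding V_def by (rule emeasure_eq_ennreal_measure) (metis emeasure_lborel_ball_finite infinity_ennreal_def less_irrefl)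
      have Vl: "measure lebesgue (ball c s) = V" by (simp add: V_def)
      have a0: "0 \<le> a c s" unfolding a_def set_lebesgue_integral_def
      proof (rule integral_nonneg_AE)
        show "AE x in lebesgue. 0 \<le> indicator (ball c s) x *\<^sub>R \<omega> x" using pos by eventually_elim (simp add: indicator_def)
      qed
      have b0: "0 \<le> b c s" unfolding b_def set_lebesgue_integral_def
        by (rule integral_nonneg_AE) (simp add: indicator_def)
      have "average (ball c s) \<omega> * average (ball c s) (\<lambda>y. \<omega> y powr (1 / (1 - p))) powr (p - 1) \<le> Ap_const p \<omega>"
        unfolding Ap_const_def by (rule cSup_upper[OF _ bdd]) (use s in \<open>auto simp: Ap_quotients_def\<close>)
      then have le: "(a c s / V) * (b c s / V) powr (p - 1) \<le> Ap_const p \<omega>"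
        by (simp add: average_def Vl a_def b_def)
      \<comment> \<open>Of the factors \<open>V powr p\<close>, one \<open>V\<close> belongs to the
        average of the weight and \<open>V powr (p - 1)\<close> to that of the dual weight.\<close>
      have "a c s * b c s powr (p - 1) = (a c s / V) * (b c s / V) powr (p - 1) * V powr p"
      proof -
        have "V powr p = V powr (1 + (p - 1))" by simp
        also have "\<dots> = V * V powr (p - 1)" using V by (subst powr_add) simp
        finally have "V powr p = V * V powr (p - 1)" .
        then show ?thesis using V b0 by (simp add: powr_divide)
      qed
      also have "\<dots> \<le> Ap_const p \<omega> * V powr p" by (rule mult_right_mono[OF le]) simp
      finally have "ennreal (a c s * b c s powr (p - 1)) \<le> ennreal (Ap_const p \<omega> * V powr p)" by (rule ennreal_leI)
      then show "(\<integral>\<^sup>+x\<in>ball c s. ennreal (w x) \<partial>lborel) *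
         epowr (p - 1) (\<integral>\<^sup>+x\<in>ball c s. ennreal (w x powr (1 / (1 - p))) \<partial>lborel)
         \<le> ennreal (Ap_const p \<omega>) * epowr p (emeasure lborel (ball c s))"
        using a0 b0 V Ap_const_nonneg[OF m] unfolding A B[OF s] Ve by (simp add: epowr_ennreal ennreal_mult)
    qed simp
  qed
qed

lemma has_weak_deriv_0:
  assumes "locally_integrable D v"
  shows "has_weak_deriv D (\<lambda>_. 0) v v"
  using assms by (auto simp: has_weak_deriv_def test_function_def mi_deriv_0 mi_order_def)

text \<open>\<open>weak_deriv\<close> is an arbitrary choice, so integrability is transferred to it
  by uniqueness from the derivatives that the Sobolev space provides. Since the dual weight is
  integrable on balls, Hoelder's inequality makes them integrable on all of \<open>S\<close> without
  the weight; extended by 0 they form a jet on the whole space.\<close>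

lemma sobolev_weak_jet:
  fixes v \<omega> w \<psi> :: "real^'n \<Rightarrow> real"
  assumes p: "1 < p" and w: "Ap_bound p A w" and \<omega>w: "AE x in lebesgue. \<omega> x = w x"
    and wd: "\<And>c s. s > 0 \<Longrightarrow> (\<integral>\<^sup>+x\<in>ball c s. ennreal (w x powr (1 / (1 - p))) \<partial>lborel) < \<infinity>"
    and \<psi>: "smooth \<psi>" "(\<integral>x. \<psi> x \<partial>lborel) = 1" "supp \<psi> \<subseteq> cball 0 r"
    and S: "compact S" "negligible (frontier S)" and v: "v \<in> weighted_sobolev (Suc m) p \<omega> S"
  obtains V where "weak_jet m S V" "\<And>\<gamma> x. x \<notin> S \<Longrightarrow> V \<gamma> x = 0"
    "\<And>\<gamma>. mi_order \<gamma> \<le> Suc m \<Longrightarrow> AE x in lebesgue. x \<in> S \<longrightarrow> weak_deriv S \<gamma> v x = V \<gamma> x"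
    "AE x in lebesgue. x \<in> S \<longrightarrow> v x = V (\<lambda>_. 0) x"
    "\<And>\<gamma>. mi_order \<gamma> \<le> Suc m \<Longrightarrow> set_integrable lebesgue S (\<lambda>x. \<bar>weak_deriv S \<gamma> v x\<bar> powr p * \<omega> x)"
proof -
  define D where "D \<gamma> = weak_deriv S \<gamma> v" for \<gamma>
  note [measurable] = Ap_boundD(1)[OF w]
  have w0: "w x > 0" for x by (rule Ap_boundD(2)[OF w])
  have Sb [measurable]: "S \<in> sets borel" using S(1) by (rule borel_compact)
  have front: "AE x in lebesgue. x \<notin> frontier S"
    using S(2) by (intro AE_not_in) (simp add: negligible_iff_null_sets)
  have int: "x \<in> interior S" if "x \<in> S" "x \<notin> frontier S" for x
    using that closure_subset by (auto simp: frontier_def)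
  have unique: "AE x in lebesgue. x \<in> S \<longrightarrow> g1 x = g2 x"
    if "has_weak_deriv S \<kappa> v g1" "has_weak_deriv S \<kappa> v g2" for \<kappa> g1 g2
    using weak_deriv_unique[OF \<psi> that] front by eventually_elim (use int in blast)
  define good where "good \<gamma> U \<longleftrightarrow> integrable lborel U \<and> (\<forall>x. x \<notin> S \<longrightarrow> U x = 0) \<and>
      (AE x in lebesgue. x \<in> S \<longrightarrow> D \<gamma> x = U x) \<and>
      set_integrable lebesgue S (\<lambda>x. \<bar>D \<gamma> x\<bar> powr p * \<omega> x) \<and> has_weak_deriv S \<gamma> v (D \<gamma>)"
    for \<gamma> and U :: "real^'n \<Rightarrow> real"
  have ex: "\<exists>U. good \<gamma> U" if \<gamma>: "mi_order \<gamma> \<le> Suc m" for \<gamma>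
  proof -
    obtain g where g: "g \<in> weighted_Lp p \<omega> S" "has_weak_deriv S \<gamma> v g"
      using v \<gamma> by (auto simp: weighted_sobolev_def)
    have hD: "has_weak_deriv S \<gamma> v (D \<gamma>)" unfolding D_def weak_deriv_def using g(2) by (rule someI[where P = "has_weak_deriv S \<gamma> v"])
    have Dg: "AE x in lebesgue. x \<in> S \<longrightarrow> D \<gamma> x = g x" by (rule unique[OF hD g(2)])
    have "(\<lambda>x. indicator S x *\<^sub>R g x) \<in> borel_measurable lebesgue"
      using g(1) by (simp add: weighted_Lp_def set_borel_measurable_def)
    then obtain G where [measurable]: "G \<in> borel_measurable lborel" and G: "AE x in lborel. indicator S x *\<^sub>R g x = G x"
      using completion_ex_borel_measurable_real by blast
    define U where "U x = indicator S x *\<^sub>R G x" for x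
    have [measurable]: "U \<in> borel_measurable borel" unfolding U_def by measurable
    have gU: "AE x in lebesgue. x \<in> S \<longrightarrow> g x = U x"
      using AE_completion[OF G] by eventually_elim (auto simp: U_def indicator_def)
    have DU: "AE x in lebesgue. x \<in> S \<longrightarrow> D \<gamma> x = U x"
      using Dg gU by eventually_elim auto
    let ?k = "\<lambda>x. \<bar>U x\<bar> powr p * w x"
    have k: "?k \<in> borel_measurable borel" by measurable
    have k0: "0 \<le> ?k x" for x using w0[of x] by simp
    have gi: "set_integrable lebesgue S (\<lambda>x. \<bar>g x\<bar> powr p * \<omega> x)" using g(1) by (simp add: weighted_Lp_def)
    have gk: "AE x in lebesgue. x \<in> S \<longrightarrow> \<bar>g x\<bar> powr p * \<omega> x = ?k x"
      using gU \<omega>w by eventually_elim simp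
    have fin: "(\<integral>\<^sup>+x\<in>S. ennreal (?k x) \<partial>lborel) < \<infinity>"
      by (rule nn_integral_set_lebesgue(1)[OF k k0 Sb gk, THEN iffD1, OF gi])
    have Dk: "AE x in lebesgue. x \<in> S \<longrightarrow> \<bar>D \<gamma> x\<bar> powr p * \<omega> x = ?k x"
      using DU \<omega>w by eventually_elim simp
    have si: "set_integrable lebesgue S (\<lambda>x. \<bar>D \<gamma> x\<bar> powr p * \<omega> x)"
      by (rule nn_integral_set_lebesgue(1)[OF k k0 Sb Dk, THEN iffD2, OF fin])
    have "epowr p (\<integral>\<^sup>+x\<in>S. ennreal \<bar>U x\<bar> \<partial>lborel) \<le> (\<integral>\<^sup>+x\<in>S. epowr p (ennreal \<bar>U x\<bar>) * w x \<partial>lborel) *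
       epowr (p - 1) (\<integral>\<^sup>+x\<in>S. ennreal (w x powr (1 / (1 - p))) \<partial>lborel)"
      by (rule weighted_Holder[OF p w]) measurable
    also have "\<dots> < \<infinity>"
    proof -
      have "(\<integral>\<^sup>+x\<in>S. epowr p (ennreal \<bar>U x\<bar>) * w x \<partial>lborel) = (\<integral>\<^sup>+x\<in>S. ennreal (?k x) \<partial>lborel)"
        by (intro nn_integral_cong) (auto simp: epowr_ennreal ennreal_mult')
      then have 1: "(\<integral>\<^sup>+x\<in>S. epowr p (ennreal \<bar>U x\<bar>) * w x \<partial>lborel) < \<infinity>" using fin by simp
      obtain R where R: "R > 0" "S \<subseteq> ball 0 R" using compact_imp_bounded[OF S(1)] bounded_subset_ballD[of S 0] by blast
      have "(\<integral>\<^sup>+x\<in>S. ennreal (w x powr (1 / (1 - p))) \<partial>lborel) \<le> (\<integral>\<^sup>+x\<in>ball 0 R. ennreal (w x powr (1 / (1 - p))) \<partial>lborel)"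
        using R(2) by (intro nn_integral_mono) (auto simp: indicator_def)
      also have "\<dots> < \<infinity>" by (rule wd[OF R(1)])
      finally have "epowr (p - 1) (\<integral>\<^sup>+x\<in>S. ennreal (w x powr (1 / (1 - p))) \<partial>lborel) < \<infinity>"
        by (simp add: less_top[symmetric])
      then show ?thesis using 1 by (simp add: ennreal_mult_less_top)
    qed
    finally have "(\<integral>\<^sup>+x\<in>S. ennreal \<bar>U x\<bar> \<partial>lborel) < \<infinity>" by (simp add: less_top[symmetric])
    moreover have "(\<integral>\<^sup>+x\<in>S. ennreal \<bar>U x\<bar> \<partial>lborel) = (\<integral>\<^sup>+x. ennreal (norm (U x)) \<partial>lborel)"
      by (intro nn_integral_cong) (auto simp: U_def indicator_def)
    ultimately have "integrable lborel U" by (simp add: integrable_iff_bounded)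
    moreover have "\<forall>x. x \<notin> S \<longrightarrow> U x = 0" by (simp add: U_def)
    ultimately have "good \<gamma> U" unfolding good_def using DU si hD by (intro conjI)
    then show ?thesis by (rule exI[where P = "good \<gamma>"])
  qed
  define U where "U \<gamma> = (SOME u. good \<gamma> u)" for \<gamma>
  have U: "integrable lborel (U \<gamma>)" "x \<notin> S \<Longrightarrow> U \<gamma> x = 0" "AE x in lebesgue. x \<in> S \<longrightarrow> D \<gamma> x = U \<gamma> x"
      "set_integrable lebesgue S (\<lambda>x. \<bar>D \<gamma> x\<bar> powr p * \<omega> x)" "has_weak_deriv S \<gamma> v (D \<gamma>)"
    if "mi_order \<gamma> \<le> Suc m" for \<gamma> x
  proof -
    have "good \<gamma> (U \<gamma>)" unfolding U_def using ex[OF that] by (rule someI_ex)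
    then show "integrable lborel (U \<gamma>)" "x \<notin> S \<Longrightarrow> U \<gamma> x = 0" "AE x in lebesgue. x \<in> S \<longrightarrow> D \<gamma> x = U \<gamma> x"
      "set_integrable lebesgue S (\<lambda>x. \<bar>D \<gamma> x\<bar> powr p * \<omega> x)" "has_weak_deriv S \<gamma> v (D \<gamma>)"
      unfolding good_def by simp_all
  qed
  \<comment> \<open>Orders above \<open>m + 1\<close>, where no derivative need exist, are filled
    with 0; \<open>weak_jet\<close> asks only for integrability there.\<close>
  define V where "V \<gamma> = (if mi_order \<gamma> \<le> Suc m then U \<gamma> else (\<lambda>_. 0))" for \<gamma>
  have VU: "V \<gamma> = U \<gamma>" if "mi_order \<gamma> \<le> Suc m" for \<gamma> using that by (simp add: V_def)
  have Vi: "integrable lborel (V \<gamma>)" for \<gamma> using U(1) by (simp add: V_def)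
  have V0: "V \<gamma> x = 0" if "x \<notin> S" for \<gamma> x using U(2) that by (simp add: V_def)
  have VD: "AE x in lebesgue. x \<in> S \<longrightarrow> D \<gamma> x = V \<gamma> x" if "mi_order \<gamma> \<le> Suc m" for \<gamma>
    unfolding VU[OF that] by (rule U(3)[OF that])
  have conv: "(LINT x:S|lebesgue. D \<gamma> x * \<phi> x) = (\<integral>x. V \<gamma> x * \<phi> x \<partial>lborel)"
    if \<gamma>: "mi_order \<gamma> \<le> Suc m" and \<phi>: "smooth \<phi>" for \<gamma> \<phi>
    unfolding set_lebesgue_integral_def
  proof (rule lebesgue_integral_Borel_version(3))
    have "V \<gamma> \<in> borel_measurable borel" using Vi[of \<gamma>] by auto
    then show "(\<lambda>x. V \<gamma> x * \<phi> x) \<in> borel_measurable borel" using smooth_borel_measurable[OF \<phi>] by measurable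
    show "AE x in lebesgue. indicator S x *\<^sub>R (D \<gamma> x * \<phi> x) = V \<gamma> x * \<phi> x"
      using VD[OF \<gamma>] by eventually_elim (auto simp: V0 indicator_def)
  qed
  have "weak_jet m S V"
    unfolding weak_jet_def
  proof (intro conjI allI impI Vi)
    fix \<gamma> :: "'n \<Rightarrow> nat" and i :: 'n and \<phi> :: "real^'n \<Rightarrow> real" assume \<gamma>: "mi_order \<gamma> \<le> m" and tf: "test_function S \<phi>"
    have sm: "smooth \<phi>" using tf by (simp add: test_function_def)
    let ?\<gamma> = "\<gamma>(i := Suc (\<gamma> i))"
    have o: "mi_order \<gamma> \<le> Suc m" "mi_order ?\<gamma> \<le> Suc m" using \<gamma> by (auto simp: mi_order_upd)
    \<comment> \<open>Two weak derivatives of \<open>v\<close>, one tested with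
      \<open>partial_deriv i \<phi>\<close> and one with \<open>\<phi>\<close>, have the same
      left-hand side in their definitions; comparing them gives the integration by parts.\<close>
    have "(LINT x:S|lebesgue. v x * mi_deriv \<gamma> (partial_deriv i \<phi>) x) =
       (-1) ^ mi_order \<gamma> * (LINT x:S|lebesgue. D \<gamma> x * partial_deriv i \<phi> x)"
      using U(5)[OF o(1)] test_function_partial_deriv[OF tf] by (simp add: has_weak_deriv_def)
    moreover have "(LINT x:S|lebesgue. v x * mi_deriv ?\<gamma> \<phi> x) =
       (-1) ^ mi_order ?\<gamma> * (LINT x:S|lebesgue. D ?\<gamma> x * \<phi> x)"
      using U(5)[OF o(2)] tf by (simp add: has_weak_deriv_def)
    ultimately have "(-1) ^ mi_order \<gamma> * (LINT x:S|lebesgue. D \<gamma> x * partial_deriv i \<phi> x) =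
        (-1) ^ mi_order \<gamma> * - (LINT x:S|lebesgue. D ?\<gamma> x * \<phi> x)"
      by (simp add: mi_deriv_Suc[OF sm] mi_order_upd)
    then have "(LINT x:S|lebesgue. D \<gamma> x * partial_deriv i \<phi> x) = - (LINT x:S|lebesgue. D ?\<gamma> x * \<phi> x)"
      by (subst (asm) mult_cancel_left) simp
    then show "(\<integral>x. V \<gamma> x * partial_deriv i \<phi> x \<partial>lborel) = - (\<integral>x. V ?\<gamma> x * \<phi> x \<partial>lborel)"
      by (simp add: conv o sm smooth_partial_deriv)
  qed
  moreover have "AE x in lebesgue. x \<in> S \<longrightarrow> v x = V (\<lambda>_. 0) x"
  proof -
    have o: "mi_order (\<lambda>_::'n. 0) \<le> Suc m" by (simp add: mi_order_def)
    have "locally_integrable S v" using U(5)[OF o] by (simp add: has_weak_deriv_def)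
    then have "has_weak_deriv S (\<lambda>_. 0) v v" by (rule has_weak_deriv_0)
    from unique[OF this U(5)[OF o]] VD[OF o] show ?thesis by eventually_elim auto
  qed
  ultimately show thesis using that[of V] V0 VD U(4) unfolding D_def by blast
qed

subsection \<open>The estimate\<close>

text \<open>The substitution preserves the integral and the L1 norm, while the supremum grows like
  the inverse of \<open>h ^ n\<close>; in the estimate this is offset by a volume.\<close>

lemma scaled_bump_properties:
  fixes \<psi> :: "real^'n \<Rightarrow> real"
  assumes \<psi>: "\<psi> \<in> borel_measurable borel" and K: "\<And>x. \<bar>\<psi> x\<bar> \<le> K" and h: "0 < h"
  shows "scaled_bump m \<psi> h z \<in> borel_measurable borel"
    "\<bar>scaled_bump m \<psi> h z x\<bar> \<le> real (m + 1) ^ CARD('n) / h ^ CARD('n) * K"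
    "(\<integral>x. scaled_bump m \<psi> h z x \<partial>lborel) = (\<integral>x. \<psi> x \<partial>lborel)"
    "(\<integral>x. \<bar>scaled_bump m \<psi> h z x\<bar> \<partial>lborel) = (\<integral>x. \<bar>\<psi> x\<bar> \<partial>lborel)"
proof -
  define c where "c = real (m + 1) / h"
  have c: "c > 0" using h by (simp add: c_def)
  have eq: "scaled_bump m \<psi> h z = (\<lambda>x. c ^ CARD('n) * \<psi> (c *\<^sub>R z + (- c) *\<^sub>R x))"
    by (simp add: fun_eq_iff scaled_bump_def c_def power_divide scaleR_diff_right)
  note [measurable] = \<psi>
  show "scaled_bump m \<psi> h z \<in> borel_measurable borel" unfolding eq by measurable
  have "\<bar>scaled_bump m \<psi> h z x\<bar> = c ^ CARD('n) * \<bar>\<psi> (c *\<^sub>R z + (- c) *\<^sub>R x)\<bar>"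
    using c by (simp add: eq abs_mult)
  also have "\<dots> \<le> c ^ CARD('n) * K" using c K by (intro mult_left_mono) auto
  finally show "\<bar>scaled_bump m \<psi> h z x\<bar> \<le> real (m + 1) ^ CARD('n) / h ^ CARD('n) * K"
    by (simp add: c_def power_divide)
  have scale: "(\<integral>x. f x \<partial>lborel) = (\<integral>x. c ^ CARD('n) * f (c *\<^sub>R z + (- c) *\<^sub>R x) \<partial>lborel)"
    if "f \<in> borel_measurable borel" for f :: "real^'n \<Rightarrow> real"
    using integral_lborel_affine[OF that, of "- c" "c *\<^sub>R z"] c by simp
  show "(\<integral>x. scaled_bump m \<psi> h z x \<partial>lborel) = (\<integral>x. \<psi> x \<partial>lborel)"
    unfolding eq by (rule scale[OF \<psi>, symmetric])
  have "(\<integral>x. \<bar>scaled_bump m \<psi> h z x\<bar> \<partial>lborel) = (\<integral>x. c ^ CARD('n) * \<bar>\<psi> (c *\<^sub>R z + (- c) *\<^sub>R x)\<bar> \<partial>lborel)"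
    using c by (simp add: eq abs_mult)
  also have "\<dots> = (\<integral>x. \<bar>\<psi> x\<bar> \<partial>lborel)" by (rule scale[symmetric]) measurable
  finally show "(\<integral>x. \<bar>scaled_bump m \<psi> h z x\<bar> \<partial>lborel) = (\<integral>x. \<bar>\<psi> x\<bar> \<partial>lborel)" .
qed

lemma weighted_Lp_norm_powr:
  assumes "0 < p" "0 \<le> (LINT x:S|lebesgue. \<bar>u x\<bar> powr p * \<omega> x)"
  shows "weighted_Lp_norm p \<omega> S u powr p = (LINT x:S|lebesgue. \<bar>u x\<bar> powr p * \<omega> x)"
  using assms by (simp add: weighted_Lp_norm_def powr_powr)

text \<open>The p-th root of the constant in \<open>averaged_remainder_bound\<close> for
  \<open>d = \<Lambda> * h\<close>, \<open>\<delta> = h / (2 * \<sigma> * max m 1)\<close> and the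
  supremum bound of \<open>scaled_bump\<close>, once all powers of \<open>h\<close> are taken out.
  \<open>A\<close> comes last, so that the partial application is a function of the Muckenhoupt
  constant.\<close>

definition stability_const :: "nat \<Rightarrow> nat \<Rightarrow> real \<Rightarrow> real \<Rightarrow> real \<Rightarrow> real \<Rightarrow> real \<Rightarrow> real \<Rightarrow> real" where
  "stability_const n m p \<sigma> K M1 N A =
     (let \<Lambda> = size_ratio n \<sigma> in
      ((2 * (2 * \<Lambda>) ^ Suc m) powr p *
       (M1 powr p + (real (m + 1) ^ n * K * (unit_ball_vol (real n) * (2 * \<Lambda>) ^ n)) powr p * A) *
       (A * ((8 * \<Lambda> * \<sigma> * real (max m 1)) ^ n) powr p) * N powr p) powr (1 / p))"

text \<open>\<open>\<kappa> / \<beta>\<close> and \<open>\<kappa> / h ^ n\<close> are ratios of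
  quantities that scale alike, so \<open>h\<close> survives only in the \<open>m + 1\<close> factors
  \<open>2 * d\<close>.\<close>

lemma scaling_identity:
  fixes m n :: nat and h \<Lambda> \<sigma> k K p V A M M1 N :: real
  assumes h: "0 < h" and \<Lambda>: "0 < \<Lambda>" and \<sigma>: "0 < \<sigma>" and k: "0 < k" and K: "0 \<le> K" and p: "0 < p" and V: "0 < V"
    and A: "0 \<le> A" and M1: "0 \<le> M1"
  defines "d \<equiv> \<Lambda> * h" and "\<delta> \<equiv> h / (2 * \<sigma> * k)"
  defines "\<kappa> \<equiv> V * (2 * d) ^ n" and "\<beta> \<equiv> V * (\<delta> / 2) ^ n"
  shows "(2 * (2 * d) ^ Suc m / \<beta>) powr p * (M1 powr p + (M / h ^ n * K * \<kappa>) powr p * A) * (A * \<kappa> powr p) * N powr p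
    = ((2 * (2 * \<Lambda>) ^ Suc m) powr p * (M1 powr p + (M * K * (V * (2 * \<Lambda>) ^ n)) powr p * A) *
       (A * ((8 * \<Lambda> * \<sigma> * k) ^ n) powr p) * N powr p) * (h ^ Suc m) powr p"
proof -
  have 1: "M / h ^ n * K * \<kappa> = M * K * (V * (2 * \<Lambda>) ^ n)"
    using h by (simp add: \<kappa>_def d_def power_mult_distrib)
  have "0 < \<delta>" using h \<sigma> k by (simp add: \<delta>_def)
  then have \<beta>: "\<beta> > 0" using V by (simp add: \<beta>_def)
  have \<kappa>: "\<kappa> > 0" using V h \<Lambda> by (simp add: \<kappa>_def d_def)
  have r: "\<kappa> / \<beta> = (8 * \<Lambda> * \<sigma> * k) ^ n"
  proof -
    have "\<kappa> / \<beta> = (2 * d) ^ n / (\<delta> / 2) ^ n"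
      unfolding \<kappa>_def \<beta>_def using V by (subst mult_divide_mult_cancel_left) auto
    also have "\<dots> = ((2 * d) / (\<delta> / 2)) ^ n" by (simp only: power_divide)
    also have "(2 * d) / (\<delta> / 2) = 8 * \<Lambda> * \<sigma> * k" using h \<sigma> k by (simp add: d_def \<delta>_def)
    finally show ?thesis .
  qed
  have "(2 * (2 * d) ^ Suc m / \<beta>) powr p * \<kappa> powr p = (2 * (2 * d) ^ Suc m / \<beta> * \<kappa>) powr p"
    using \<beta> \<kappa> h \<Lambda> by (subst powr_mult) (auto simp: d_def)
  also have "2 * (2 * d) ^ Suc m / \<beta> * \<kappa> = (2 * (2 * \<Lambda>) ^ Suc m) * (\<kappa> / \<beta>) * h ^ Suc m"
    by (simp add: d_def power_mult_distrib)
  also have "\<dots> powr p = (2 * (2 * \<Lambda>) ^ Suc m) powr p * (\<kappa> / \<beta>) powr p * (h ^ Suc m) powr p"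
    using \<beta> \<kappa> h \<Lambda> by (simp only: powr_mult)
  finally have 2: "(2 * (2 * d) ^ Suc m / \<beta>) powr p * \<kappa> powr p =
    (2 * (2 * \<Lambda>) ^ Suc m) powr p * ((8 * \<Lambda> * \<sigma> * k) ^ n) powr p * (h ^ Suc m) powr p" unfolding r .
  have "(2 * (2 * d) ^ Suc m / \<beta>) powr p * (M1 powr p + (M / h ^ n * K * \<kappa>) powr p * A) * (A * \<kappa> powr p) * N powr p =
    ((2 * (2 * d) ^ Suc m / \<beta>) powr p * \<kappa> powr p) * ((M1 powr p + (M / h ^ n * K * \<kappa>) powr p * A) * A * N powr p)"
    by (simp only: mult.assoc mult.commute mult.left_commute)
  then show ?thesis unfolding 1 2 by (simp only: mult.assoc mult.commute mult.left_commute)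
qed

lemma averaged_taylor_estimate:
  fixes z :: "real^'n" and \<T> :: "(real^'n) set set" and \<psi> \<omega> v :: "real^'n \<Rightarrow> real"
  assumes p: "1 < p" and \<sigma>: "1 < \<sigma>"
    and \<psi>: "smooth \<psi>" "(\<integral>x. \<psi> x \<partial>lborel) = 1" "supp \<psi> \<subseteq> cball 0 r" and K: "\<And>x. \<bar>\<psi> x\<bar> \<le> K"
    and \<omega>: "muckenhoupt p \<omega>" and \<Omega>: "open \<Omega>" and mesh: "conforming_mesh \<Omega> \<T>" and sr: "shape_regular \<sigma> \<T>"
    and one: "CARD('n) = 1 \<Longrightarrow> \<forall>T\<in>\<T>. \<forall>T'\<in>\<T>. T \<inter> T' \<noteq> {} \<longrightarrow> diameter T \<le> \<sigma> * diameter T'"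
    and z: "z \<in> interior_nodes m \<Omega> \<T>"
    and bump: "supp (scaled_bump m \<psi> (node_size \<T> z) z) \<subseteq> star \<T> z"
    and v: "v \<in> weighted_sobolev (Suc m) p \<omega> (star \<T> z)"
  defines "S \<equiv> star \<T> z" and "h \<equiv> node_size \<T> z"
    and "N \<equiv> real (card {\<gamma> :: 'n \<Rightarrow> nat. mi_order \<gamma> = m} * CARD('n))" and "M1 \<equiv> (\<integral>x. \<bar>\<psi> x\<bar> \<partial>lborel)"
  shows "(\<lambda>y. v y - averaged_taylor m \<psi> \<T> z v y) \<in> weighted_Lp p \<omega> S"
    and "weighted_Lp_norm p \<omega> S (\<lambda>y. v y - averaged_taylor m \<psi> \<T> z v y)
      \<le> stability_const CARD('n) m p \<sigma> K M1 N (Ap_const p \<omega>) * h ^ Suc m * sobolev_seminorm (Suc m) p \<omega> S v"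
proof -
  note geo = star_geometry[OF \<sigma> \<Omega> mesh sr one z, folded S_def h_def]
  have h: "0 < h" and S: "compact S" "S \<subseteq> cball z (size_ratio CARD('n) \<sigma> * h)" "negligible (frontier S)"
    by (rule geo; assumption)+
  define \<Lambda> where "\<Lambda> = size_ratio CARD('n) \<sigma>"
  have \<Lambda>: "1 \<le> \<Lambda>" unfolding \<Lambda>_def size_ratio_def using \<sigma> by (intro one_le_power) auto
  define k where "k = real (max m 1)"
  have k: "1 \<le> k" by (simp add: k_def)
  define d where "d = \<Lambda> * h"
  define \<delta> where "\<delta> = h / (2 * \<sigma> * k)"
  have \<sigma>k: "1 \<le> 2 * \<sigma> * k" using \<sigma> k mult_mono[of 1 "2 * \<sigma>" 1 k] by simp
  have \<delta>: "0 < \<delta>" "\<delta> \<le> d"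
  proof -
    show "0 < \<delta>" using h \<sigma>k by (simp add: \<delta>_def)
    have "\<delta> \<le> h / 1" unfolding \<delta>_def using h \<sigma>k by (intro divide_left_mono) auto
    also have "\<dots> \<le> \<Lambda> * h" using \<Lambda> h by simp
    finally show "\<delta> \<le> d" by (simp add: d_def)
  qed
  define \<Psi> where "\<Psi> = scaled_bump m \<psi> h z"
  note [measurable] = smooth_borel_measurable[OF \<psi>(1)]
  note bumps = scaled_bump_properties[OF smooth_borel_measurable[OF \<psi>(1)] K h, of m z, folded \<Psi>_def]
  have \<Psi>_out: "\<Psi> x = 0" if "x \<notin> S" for x
    using bump that unfolding \<Psi>_def h_def S_def by (intro not_in_supp) blast
  have A0: "0 \<le> Ap_const p \<omega>" by (rule Ap_const_nonneg[OF \<omega>])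
  obtain w where w: "Ap_bound p (Ap_const p \<omega>) w" and \<omega>w: "AE x in lebesgue. \<omega> x = w x"
    and wd: "\<And>c s. s > 0 \<Longrightarrow> (\<integral>\<^sup>+x\<in>ball c s. ennreal (w x powr (1 / (1 - p))) \<partial>lborel) < \<infinity>"
    by (rule muckenhoupt_Borel_version[OF p \<omega>]) blast
  note [measurable] = Ap_boundD(1)[OF w]
  have w0: "w x > 0" for x by (rule Ap_boundD(2)[OF w])
  have Sb [measurable]: "S \<in> sets borel" using S(1) by (rule borel_compact)
  obtain V where V: "weak_jet m S V" "\<And>\<gamma> x. x \<notin> S \<Longrightarrow> V \<gamma> x = 0"
    and VD: "\<And>\<gamma>. mi_order \<gamma> \<le> Suc m \<Longrightarrow> AE x in lebesgue. x \<in> S \<longrightarrow> weak_deriv S \<gamma> v x = V \<gamma> x"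
    and Vv: "AE x in lebesgue. x \<in> S \<longrightarrow> v x = V (\<lambda>_. 0) x"
    and Dint: "\<And>\<gamma>. mi_order \<gamma> \<le> Suc m \<Longrightarrow> set_integrable lebesgue S (\<lambda>x. \<bar>weak_deriv S \<gamma> v x\<bar> powr p * \<omega> x)"
    by (rule sobolev_weak_jet[OF p w \<omega>w wd \<psi> S(1,3) v[folded S_def]]) blast+
  have Vi: "integrable lborel (V \<gamma>)" for \<gamma> using V(1) by (simp add: weak_jet_def)
  then have [measurable]: "V \<gamma> \<in> borel_measurable borel" for \<gamma> by auto
  note [measurable] = bumps(1)
  define q where "q y = (\<integral>x. jet_poly m V x y * \<Psi> x \<partial>lborel)" for y
  have q_eq: "averaged_taylor m \<psi> \<T> z v y = q y" for y
    unfolding averaged_taylor_def q_def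
  proof (rule lebesgue_integral_Borel_version(3))
    show "(\<lambda>x. jet_poly m V x y * \<Psi> x) \<in> borel_measurable borel"
      unfolding jet_poly_def mi_power_def by measurable
    \<comment> \<open>The polynomial involves finitely many weak derivatives, so their exceptional
      null sets can be united.\<close>
    have "AE x in lebesgue. \<forall>\<gamma>\<in>{\<gamma>. mi_order \<gamma> \<le> m}. x \<in> S \<longrightarrow> weak_deriv S \<gamma> v x = V \<gamma> x"
      using finite_mi_le by (rule AE_finite_allI) (use VD in auto)
    then show "AE x in lebesgue. taylor_poly (star \<T> z) m v x y * scaled_bump m \<psi> (node_size \<T> z) z x = jet_poly m V x y * \<Psi> x"
    proof eventually_elim
      case (elim x)
      show ?case
      proof (cases "x \<in> S")
        case True
        then have "taylor_poly S m v x y = jet_poly m V x y"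
          unfolding taylor_poly_def jet_poly_def using elim by (intro sum.cong) auto
        then show ?thesis by (simp add: S_def \<Psi>_def h_def)
      next
        case False
        then show ?thesis using \<Psi>_out[OF False] by (simp add: \<Psi>_def h_def)
      qed
    qed
  qed
  have [measurable]: "q \<in> borel_measurable borel" unfolding q_def jet_poly_def mi_power_def by measurable
  define R where "R y = V (\<lambda>_. 0) y - q y" for y
  have [measurable]: "R \<in> borel_measurable borel" unfolding R_def by measurable
  have vR: "AE y in lebesgue. y \<in> S \<longrightarrow> v y - averaged_taylor m \<psi> \<T> z v y = R y"
    using Vv by eventually_elim (auto simp: R_def q_eq)
  define \<kappa> where "\<kappa> = measure lborel (ball z (2 * d))"
  define \<beta> where "\<beta> = measure lborel (ball z (\<delta> / 2))"
  define M where "M = real (m + 1) ^ CARD('n) / h ^ CARD('n) * K"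
  define Cst where "Cst = (2 * (2 * d) ^ Suc m / \<beta>) powr p * (M1 powr p + (M * \<kappa>) powr p * Ap_const p \<omega>) * (Ap_const p \<omega> * \<kappa> powr p) * N powr p"
  have star: "w + s *\<^sub>R (x - w) \<in> S" if "w \<in> cball z \<delta>" "x \<in> S" "s \<in> {0..1}" for w x s
    using geo(5)[of w x s] that unfolding \<delta>_def k_def by blast
  have main: "(\<integral>\<^sup>+y\<in>S. epowr p (ennreal \<bar>R y\<bar>) * w y \<partial>lborel) \<le>
    ennreal Cst * (\<Sum>\<beta> | mi_order \<beta> = Suc m. \<integral>\<^sup>+x\<in>S. epowr p (ennreal \<bar>V \<beta> x\<bar>) * w x \<partial>lborel)"
    unfolding R_def q_def Cst_def \<kappa>_def \<beta>_def N_def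
  proof (rule averaged_remainder_bound[OF p w A0 \<psi> V S(1) _ S(3) \<delta> star bumps(1) _ _ \<Psi>_out])
    show "S \<subseteq> cball z d" using S(2) by (simp add: d_def \<Lambda>_def)
    show "(\<integral>x. \<Psi> x \<partial>lborel) = 1" using bumps(3) \<psi>(2) by simp
    show "\<bar>\<Psi> x\<bar> \<le> M" for x using bumps(2) by (simp add: M_def)
    show "(\<integral>x. \<bar>\<Psi> x\<bar> \<partial>lborel) \<le> M1" using bumps(4) by (simp add: M1_def)
  qed
  have kk: "(\<lambda>x. \<bar>u x\<bar> powr p * w x) \<in> borel_measurable borel" "0 \<le> \<bar>u x\<bar> powr p * w x"
    if [measurable]: "u \<in> borel_measurable borel" for u :: "real^'n \<Rightarrow> real" and x
    using w0[of x] by (auto intro: less_imp_le)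
  have kk0: "0 \<le> \<bar>u x\<bar> powr p * w x" for u x
    using w0[of x] by simp
  have ep: "(\<integral>\<^sup>+x\<in>S. epowr p (ennreal \<bar>u x\<bar>) * w x \<partial>lborel) = (\<integral>\<^sup>+x\<in>S. ennreal (\<bar>u x\<bar> powr p * w x) \<partial>lborel)" for u :: "real^'n \<Rightarrow> real"
    by (intro nn_integral_cong) (simp add: epowr_ennreal ennreal_mult')
  define I where "I \<gamma> = (LINT x:S|lebesgue. \<bar>weak_deriv S \<gamma> v x\<bar> powr p * \<omega> x)" for \<gamma>
  have I_nonneg: "0 \<le> (LINT x:S|lebesgue. \<bar>u x\<bar> powr p * \<omega> x)" for u
    unfolding set_lebesgue_integral_def
  proof (rule integral_nonneg_AE)
    show "AE x in lebesgue. 0 \<le> indicator S x *\<^sub>R (\<bar>u x\<bar> powr p * \<omega> x)"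
      using \<omega>w by eventually_elim (use kk0 in \<open>simp add: indicator_def\<close>)
  qed
  have DI: "(\<integral>\<^sup>+x\<in>S. epowr p (ennreal \<bar>V \<gamma> x\<bar>) * w x \<partial>lborel) = ennreal (I \<gamma>)" if \<gamma>: "mi_order \<gamma> = Suc m" for \<gamma>
    unfolding ep I_def
  proof (rule nn_integral_set_lebesgue(2)[OF kk Sb])
    show "AE x in lebesgue. x \<in> S \<longrightarrow> \<bar>weak_deriv S \<gamma> v x\<bar> powr p * \<omega> x = \<bar>V \<gamma> x\<bar> powr p * w x"
      using VD[of \<gamma>] \<omega>w \<gamma> by (auto elim: eventually_elim2)
    show "set_integrable lebesgue S (\<lambda>x. \<bar>weak_deriv S \<gamma> v x\<bar> powr p * \<omega> x)" using Dint \<gamma> by simp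
  qed measurable
  define \<Sigma> where "\<Sigma> = (\<Sum>\<gamma> | mi_order \<gamma> = Suc m. I \<gamma>)"
  have \<Sigma>0: "0 \<le> \<Sigma>" unfolding \<Sigma>_def I_def by (intro sum_nonneg I_nonneg)
  have C0: "0 \<le> Cst" unfolding Cst_def using A0 by simp
  have bound: "(\<integral>\<^sup>+y\<in>S. ennreal (\<bar>R y\<bar> powr p * w y) \<partial>lborel) \<le> ennreal (Cst * \<Sigma>)"
  proof -
    have "(\<Sum>\<gamma> | mi_order \<gamma> = Suc m. \<integral>\<^sup>+x\<in>S. epowr p (ennreal \<bar>V \<gamma> x\<bar>) * w x \<partial>lborel) =
        (\<Sum>\<gamma> | mi_order \<gamma> = Suc m. ennreal (I \<gamma>))"
      by (rule sum.cong[OF refl]) (simp add: DI)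
    with main have "(\<integral>\<^sup>+y\<in>S. ennreal (\<bar>R y\<bar> powr p * w y) \<partial>lborel) \<le> ennreal Cst * (\<Sum>\<gamma> | mi_order \<gamma> = Suc m. ennreal (I \<gamma>))"
      by (simp only: ep)
    also have "(\<Sum>\<gamma> | mi_order \<gamma> = Suc m. ennreal (I \<gamma>)) = ennreal \<Sigma>"
      unfolding \<Sigma>_def I_def by (rule sum_ennreal) (rule I_nonneg)
    finally show ?thesis using C0 by (simp add: ennreal_mult')
  qed
  let ?u = "\<lambda>y. v y - averaged_taylor m \<psi> \<T> z v y"
  have aeR: "AE x in lebesgue. x \<in> S \<longrightarrow> \<bar>?u x\<bar> powr p * \<omega> x = \<bar>R x\<bar> powr p * w x"
    using vR \<omega>w by eventually_elim simp
  have R_meas: "R \<in> borel_measurable borel" by measurable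
  have "(\<integral>\<^sup>+y\<in>S. ennreal (\<bar>R y\<bar> powr p * w y) \<partial>lborel) < \<infinity>"
    using bound by (rule order_le_less_trans) simp
  then have si: "set_integrable lebesgue S (\<lambda>x. \<bar>?u x\<bar> powr p * \<omega> x)"
    by (rule nn_integral_set_lebesgue(1)[OF kk[OF R_meas] Sb aeR, THEN iffD2])
  \<comment> \<open>This rules out that the integral in the norm is 0 merely by default.\<close>
  show "?u \<in> weighted_Lp p \<omega> S"
    unfolding weighted_Lp_def
  proof (intro CollectI conjI si)
    show "set_borel_measurable lebesgue S ?u"
      unfolding set_borel_measurable_def
    proof (rule lebesgue_integral_Borel_version(1))
      show "(\<lambda>x. indicator S x *\<^sub>R R x) \<in> borel_measurable borel" by measurable
      show "AE x in lebesgue. indicator S x *\<^sub>R ?u x = indicator S x *\<^sub>R R x"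
        using vR by eventually_elim (simp add: indicator_def)
    qed
  qed
  have "ennreal (LINT x:S|lebesgue. \<bar>?u x\<bar> powr p * \<omega> x) \<le> ennreal (Cst * \<Sigma>)"
    using nn_integral_set_lebesgue(2)[OF kk[OF R_meas] Sb aeR si] bound by simp
  then have int_le: "(LINT x:S|lebesgue. \<bar>?u x\<bar> powr p * \<omega> x) \<le> Cst * \<Sigma>"
    using C0 \<Sigma>0 by (simp add: ennreal_le_iff)
  have semi: "sobolev_seminorm (Suc m) p \<omega> S v = \<Sigma> powr (1 / p)"
  proof -
    have "weighted_Lp_norm p \<omega> S (weak_deriv S \<gamma> v) powr p = I \<gamma>" for \<gamma>
      unfolding I_def using p I_nonneg by (intro weighted_Lp_norm_powr) auto
    then show ?thesis by (simp add: sobolev_seminorm_def \<Sigma>_def)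
  qed
  have K0: "0 \<le> K" using K[of 0] by linarith
  have M10: "0 \<le> M1" unfolding M1_def by (rule Bochner_Integration.integral_nonneg) simp
  define B where "B = (2 * (2 * \<Lambda>) ^ Suc m) powr p * (M1 powr p + (real (m + 1) ^ CARD('n) * K * (unit_ball_vol (real CARD('n)) * (2 * \<Lambda>) ^ CARD('n))) powr p * Ap_const p \<omega>) *
       (Ap_const p \<omega> * ((8 * \<Lambda> * \<sigma> * k) ^ CARD('n)) powr p) * N powr p"
  have B0: "0 \<le> B" unfolding B_def using A0 by simp
  have CB: "Cst = B * (h ^ Suc m) powr p"
  proof -
    have \<kappa>: "\<kappa> = unit_ball_vol (real CARD('n)) * (2 * (\<Lambda> * h)) ^ CARD('n)"
      unfolding \<kappa>_def d_def using h \<Lambda> by (simp add: content_ball)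
    have \<beta>: "\<beta> = unit_ball_vol (real CARD('n)) * (h / (2 * \<sigma> * k) / 2) ^ CARD('n)"
      unfolding \<beta>_def \<delta>_def using h \<sigma> k by (simp add: content_ball)
    show ?thesis
      unfolding Cst_def B_def \<kappa> \<beta> M_def unfolding d_def
      by (rule scaling_identity) (use h \<Lambda> \<sigma> k K0 p A0 M10 unit_ball_vol_pos in auto)
  qed
  have "weighted_Lp_norm p \<omega> S ?u \<le> (Cst * \<Sigma>) powr (1 / p)"
    unfolding weighted_Lp_norm_def using int_le I_nonneg p by (intro powr_mono2) auto
  also have "\<dots> = (B powr (1 / p)) * ((h ^ Suc m) powr p) powr (1 / p) * \<Sigma> powr (1 / p)"
    unfolding CB using B0 \<Sigma>0 by (simp add: powr_mult)
  also have "((h ^ Suc m) powr p) powr (1 / p) = h ^ Suc m"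
    using h p by (simp add: powr_powr)
  also have "B powr (1 / p) = stability_const CARD('n) m p \<sigma> K M1 N (Ap_const p \<omega>)"
    by (simp add: B_def stability_const_def \<Lambda>_def k_def Let_def)
  finally show "weighted_Lp_norm p \<omega> S ?u
      \<le> stability_const CARD('n) m p \<sigma> K M1 N (Ap_const p \<omega>) * h ^ Suc m * sobolev_seminorm (Suc m) p \<omega> S v"
    unfolding semi .
qed

text \<open>\<open>C\<close> precedes the weight, the domain and the meshes and is applied to
  \<open>Ap_const p \<omega>\<close>, which expresses what the constant depends on. Neighbouring
  lengths are compared by assumption if \<open>CARD('n) = 1\<close>, as intervals of any lengths are
  shape regular. The membership makes the norm on the left a genuine integral.\<close>

theorem lemma4p4:
  fixes m :: nat and p \<sigma> r :: real and \<psi> :: "real^'n \<Rightarrow> real"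
  assumes "1 < p" and "1 < \<sigma>"
    and "smooth \<psi>" and "(LINT x|lebesgue. \<psi> x) = 1" and "supp \<psi> \<subseteq> cball 0 r"
  shows "\<exists>C :: real \<Rightarrow> real.
    \<forall>(\<omega> :: real^'n \<Rightarrow> real) (\<Omega> :: (real^'n) set) (\<TT> :: (real^'n) set set set).
      muckenhoupt p \<omega> \<and>
      polyhedral_lipschitz_domain \<Omega> \<and>
      (\<forall>\<T>\<in>\<TT>. conforming_mesh \<Omega> \<T> \<and> shape_regular \<sigma> \<T>) \<and>
      (CARD('n) = 1 \<longrightarrow>
        (\<forall>\<T>\<in>\<TT>. \<forall>T\<in>\<T>. \<forall>T'\<in>\<T>. T \<inter> T' \<noteq> {} \<longrightarrow> diameter T \<le> \<sigma> * diameter T')) \<and>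
      (\<forall>\<T>\<in>\<TT>. \<forall>z\<in>interior_nodes m \<Omega> \<T>.
        supp (scaled_bump m \<psi> (node_size \<T> z) z) \<subseteq> star \<T> z) \<longrightarrow>
      (\<forall>\<T>\<in>\<TT>. \<forall>z\<in>interior_nodes m \<Omega> \<T>. \<forall>v\<in>weighted_sobolev (m + 1) p \<omega> (star \<T> z).
        (\<lambda>y. v y - averaged_taylor m \<psi> \<T> z v y) \<in> weighted_Lp p \<omega> (star \<T> z) \<and>
        weighted_Lp_norm p \<omega> (star \<T> z) (\<lambda>y. v y - averaged_taylor m \<psi> \<T> z v y)
          \<le> C (Ap_const p \<omega>) * node_size \<T> z ^ (m + 1) *
            sobolev_seminorm (m + 1) p \<omega> (star \<T> z) v)"
proof -
  obtain K where K: "\<And>x. \<bar>\<psi> x\<bar> \<le> K"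
    using smooth_compact_supp_bounded[OF assms(3) compact_supp_subset_cball[OF assms(5)]] by metis
  have \<psi>1: "(\<integral>x. \<psi> x \<partial>lborel) = 1"
    using assms(4) integral_completion[of \<psi> lborel] smooth_borel_measurable[OF assms(3)] by simp
  \<comment> \<open>\<open>\<psi>\<close> enters through a bound \<open>K\<close> and its L1 norm,
    the remaining arguments through \<open>n\<close>, \<open>m\<close>, \<open>p\<close> and
    \<open>\<sigma>\<close>.\<close>
  define C where "C = stability_const CARD('n) m p \<sigma> K (\<integral>x. \<bar>\<psi> x\<bar> \<partial>lborel)
    (real (card {\<gamma> :: 'n \<Rightarrow> nat. mi_order \<gamma> = m} * CARD('n)))"
  show ?thesis
  proof (intro exI[of _ C] allI impI ballI)
    fix \<omega> :: "real^'n \<Rightarrow> real" and \<Omega> :: "(real^'n) set" and \<TT> :: "(real^'n) set set set" and \<T> z v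
    assume hyp: "muckenhoupt p \<omega> \<and>
      polyhedral_lipschitz_domain \<Omega> \<and>
      (\<forall>\<T>\<in>\<TT>. conforming_mesh \<Omega> \<T> \<and> shape_regular \<sigma> \<T>) \<and>
      (CARD('n) = 1 \<longrightarrow>
        (\<forall>\<T>\<in>\<TT>. \<forall>T\<in>\<T>. \<forall>T'\<in>\<T>. T \<inter> T' \<noteq> {} \<longrightarrow> diameter T \<le> \<sigma> * diameter T')) \<and>
      (\<forall>\<T>\<in>\<TT>. \<forall>z\<in>interior_nodes m \<Omega> \<T>.
        supp (scaled_bump m \<psi> (node_size \<T> z) z) \<subseteq> star \<T> z)"
      and \<T>: "\<T> \<in> \<TT>" and z: "z \<in> interior_nodes m \<Omega> \<T>" and v: "v \<in> weighted_sobolev (m + 1) p \<omega> (star \<T> z)"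
    have \<omega>: "muckenhoupt p \<omega>" and \<Omega>: "open \<Omega>" and mesh: "conforming_mesh \<Omega> \<T>" "shape_regular \<sigma> \<T>"
      and one: "CARD('n) = 1 \<Longrightarrow> \<forall>T\<in>\<T>. \<forall>T'\<in>\<T>. T \<inter> T' \<noteq> {} \<longrightarrow> diameter T \<le> \<sigma> * diameter T'"
      and bump: "supp (scaled_bump m \<psi> (node_size \<T> z) z) \<subseteq> star \<T> z"
      using hyp \<T> z by (auto simp: polyhedral_lipschitz_domain_def)
    note est = averaged_taylor_estimate[OF assms(1,2,3) \<psi>1 assms(5) K \<omega> \<Omega> mesh one z bump v[unfolded Suc_eq_plus1[symmetric]]]
    show "(\<lambda>y. v y - averaged_taylor m \<psi> \<T> z v y) \<in> weighted_Lp p \<omega> (star \<T> z) \<and>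
        weighted_Lp_norm p \<omega> (star \<T> z) (\<lambda>y. v y - averaged_taylor m \<psi> \<T> z v y)
          \<le> C (Ap_const p \<omega>) * node_size \<T> z ^ (m + 1) *
            sobolev_seminorm (m + 1) p \<omega> (star \<T> z) v"
      using est unfolding C_def Suc_eq_plus1 by blast
  qed
qed

end
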